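(* Let $\Omega\subset\mathbb{R}^d$ be a bounded domain. Suppose that $\sigma\in L^\infty(\mathbb{R})$ and that there exists an open interval $I\subset\mathbb{R}$ such that the Fourier transform $\hat\sigma$ (as a tempered distribution) is a non-zero bounded function on $I$. Then there is a constant $C(\mathrm{diam}(\Omega),\sigma)$, depending only on $\mathrm{diam}(\Omega)$ and $\sigma$, such that for every $f\in\mathcal{B}^1$ and every integer $n\ge1$, $$\inf_{f_n\in\Sigma_d^n(\sigma)}\|f-f_n\|_{L^2(\Omega)}\le|\Omega|^{1/2}\,C(\mathrm{diam}(\Omega),\sigma)\,n^{-1/4}\,\|f\|_{\mathcal{B}^1}.$$
   Context: For $\sigma:\mathbb{R}\to\mathbb{R}$, $\Sigma_d^n(\sigma)=\{x\mapsto\sum_{i=1}^n\beta_i\sigma(\omega_i\cdot x+b_i):\omega_i\in\mathbb{R}^d,\ b_i,\beta_i\in\mathbb{R}\}$. Fourier convention: $\hat f(\omega)=(2\pi)^{-d}\int_{\mathbb{R}^d} f(x)e^{-i\omega\cdot x}dx$, so that $f(x)=\int_{\mathbb{R}^d}e^{i\omega\cdot x}\hat f(\omega)d\omega$. The Barron norm of $f:\mathbb{R}^d\to\mathbb{R}$ is $\|f\|_{\mathcal{B}^s}=\int_{\mathbb{R}^d}(1+|\omega|)^s|\hat f(\omega)|\,d\omega$, and $\mathcal{B}^s=\{f:\|f\|_{\mathcal{B}^s}<\infty\}$ (real-valued functions whose Fourier transform is a function with this integral finite). $|\Omega|$ is the Lebesgue measure of $\Omega$. The hypothesis on $\hat\sigma$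 means that the restriction of the distribution $\hat\sigma$ to $I$ is given by integration against a function in $L^\infty(I)$ that is not almost everywhere zero. *)

theory Defs
  imports "HOL-Analysis.Analysis"
begin

(* R^d is the set of extensional functions on {..<d}, not real ^ 'n: the constant of the
   theorem must be chosen before the dimension, so d has to be a term rather than a type. *)

definition RR :: "nat \<Rightarrow> (nat \<Rightarrow> real) set" where
  "RR d = (\<Pi>\<^sub>E i\<in>{..<d}. UNIV)"

definition leb :: "nat \<Rightarrow> (nat \<Rightarrow> real) measure" where
  "leb d = completion (\<Pi>\<^sub>M i\<in>{..<d}. lborel)"

definition RR_top :: "nat \<Rightarrow> (nat \<Rightarrow> real) topology" where
  "RR_top d = product_topology (\<lambda>i. euclideanreal) {..<d}"

definition dotp :: "nat \<Rightarrow> (nat \<Rightarrow> real) \<Rightarrow> (nat \<Rightarrow> real) \<Rightarrow> real" where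
  "dotp d x y = (\<Sum>i<d. x i * y i)"

definition enorm :: "nat \<Rightarrow> (nat \<Rightarrow> real) \<Rightarrow> real" where
  "enorm d x = L2_set x {..<d}"

definition edist :: "nat \<Rightarrow> (nat \<Rightarrow> real) \<Rightarrow> (nat \<Rightarrow> real) \<Rightarrow> real" where
  "edist d x y = enorm d (\<lambda>i. x i - y i)"

definition ediam :: "nat \<Rightarrow> (nat \<Rightarrow> real) set \<Rightarrow> real" where
  "ediam d S = (if S = {} then 0 else SUP (x, y)\<in>S \<times> S. edist d x y)"

definition bounded_domain :: "nat \<Rightarrow> (nat \<Rightarrow> real) set \<Rightarrow> bool" where
  "bounded_domain d \<Omega> \<longleftrightarrow>
     openin (RR_top d) \<Omega> \<and> connectedin (RR_top d) \<Omega> \<and> \<Omega> \<noteq> {} \<and>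
     (\<exists>B. \<forall>x\<in>\<Omega>. enorm d x \<le> B)"

definition Linf :: "'a measure \<Rightarrow> ('a \<Rightarrow> 'b::real_normed_vector) \<Rightarrow> bool" where
  "Linf M g \<longleftrightarrow> g \<in> borel_measurable M \<and> (\<exists>B. AE x in M. norm (g x) \<le> B)"

(* Valued in ennreal, so that functions that are not square integrable have norm \<infinity>. *)
definition L2norm :: "nat \<Rightarrow> (nat \<Rightarrow> real) set \<Rightarrow> ((nat \<Rightarrow> real) \<Rightarrow> real) \<Rightarrow> ennreal" where
  "L2norm d \<Omega> g =
     (let J = \<integral>\<^sup>+ x\<in>\<Omega>. ennreal ((g x)\<^sup>2) \<partial>leb d
      in if J = \<infinity> then \<infinity> else ennreal (sqrt (enn2real J)))"

definition nets :: "nat \<Rightarrow> nat \<Rightarrow> (real \<Rightarrow> real) \<Rightarrow> ((nat \<Rightarrow> real) \<Rightarrow> real) set" where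
  "nets d n \<sigma> =
     {(\<lambda>x. \<Sum>i<n. \<beta> i * \<sigma> (dotp d (\<omega> i) x + b i)) | \<beta> \<omega> b. \<forall>i<n. \<omega> i \<in> RR d}"


text \<open>The Fourier transform of tempered distributions on \<open>\<real>\<^sup>d\<close>.\<close>

definition partial_deriv ::
    "nat \<Rightarrow> ((nat \<Rightarrow> real) \<Rightarrow> complex) \<Rightarrow> (nat \<Rightarrow> real) \<Rightarrow> complex" where
  "partial_deriv i \<phi> x = vector_derivative (\<lambda>t. \<phi> (x(i := t))) (at (x i))"

(* Continuity of the iterated partial derivatives is not demanded separately: each of them
   has bounded first order partial derivatives everywhere, hence is Lipschitz. *)
definition schwartz :: "nat \<Rightarrow> ((nat \<Rightarrow> real) \<Rightarrow> complex) \<Rightarrow> bool" where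
  "schwartz d \<phi> \<longleftrightarrow>
     (\<forall>js\<in>lists {..<d}.
        (\<forall>i<d. \<forall>x\<in>RR d.
           (\<lambda>t. foldr partial_deriv js \<phi> (x(i := t))) differentiable (at (x i))) \<and>
        (\<forall>N::nat. \<exists>B. \<forall>x\<in>RR d.
           (1 + enorm d x) ^ N * cmod (foldr partial_deriv js \<phi> x) \<le> B))"

definition fourier ::
    "nat \<Rightarrow> ((nat \<Rightarrow> real) \<Rightarrow> complex) \<Rightarrow> (nat \<Rightarrow> real) \<Rightarrow> complex" where
  "fourier d \<phi> \<xi> = (1 / (2 * pi) ^ d) *\<^sub>R (\<integral>x. cis (- dotp d \<xi> x) * \<phi> x \<partial>leb d)"

(* The functions that define a tempered distribution by integration against Schwartz
   functions. *)
definition tempered :: "nat \<Rightarrow> ((nat \<Rightarrow> real) \<Rightarrow> complex) \<Rightarrow> bool" where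
  "tempered d f \<longleftrightarrow>
     f \<in> borel_measurable (leb d) \<and>
     (\<exists>N::nat. integrable (leb d) (\<lambda>x. f x / of_real ((1 + enorm d x) ^ N)))"

(* The tempered distribution f has the function g as its Fourier transform. *)
definition has_fourier ::
    "nat \<Rightarrow> ((nat \<Rightarrow> real) \<Rightarrow> complex) \<Rightarrow> ((nat \<Rightarrow> real) \<Rightarrow> complex) \<Rightarrow> bool" where
  "has_fourier d f g \<longleftrightarrow>
     tempered d f \<and> tempered d g \<and>
     (\<forall>\<phi>. schwartz d \<phi> \<longrightarrow>
        (\<integral>x. f x * fourier d \<phi> x \<partial>leb d) = (\<integral>\<omega>. g \<omega> * \<phi> \<omega> \<partial>leb d))"

(* A Fourier transform that is a function is unique up to null sets, so the choice
   does not affect the Barron norm below. *)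
definition fhat :: "nat \<Rightarrow> ((nat \<Rightarrow> real) \<Rightarrow> real) \<Rightarrow> (nat \<Rightarrow> real) \<Rightarrow> complex" where
  "fhat d f = (SOME g. has_fourier d (\<lambda>x. complex_of_real (f x)) g)"

definition barron_norm :: "nat \<Rightarrow> real \<Rightarrow> ((nat \<Rightarrow> real) \<Rightarrow> real) \<Rightarrow> ennreal" where
  "barron_norm d s f =
     (\<integral>\<^sup>+ \<omega>. ennreal ((1 + enorm d \<omega>) powr s * cmod (fhat d f \<omega>)) \<partial>leb d)"

definition barron_space :: "nat \<Rightarrow> real \<Rightarrow> ((nat \<Rightarrow> real) \<Rightarrow> real) set" where
  "barron_space d s =
     {f. (\<exists>g. has_fourier d (\<lambda>x. complex_of_real (f x)) g) \<and> barron_norm d s f < \<infinity>}"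


text \<open>The restriction to an interval of the distributional Fourier transform of a
  function in \<open>L\<^sup>\<infinity>(\<real>)\<close>.\<close>

definition fourier1 :: "(real \<Rightarrow> complex) \<Rightarrow> real \<Rightarrow> complex" where
  "fourier1 \<phi> t = (1 / (2 * pi)) *\<^sub>R (\<integral>x. cis (- (t * x)) * \<phi> x \<partial>lebesgue)"

(* C_c^\<infinity>(I) *)
definition test_function :: "real set \<Rightarrow> (real \<Rightarrow> complex) \<Rightarrow> bool" where
  "test_function I \<phi> \<longleftrightarrow>
     (\<forall>k x. ((\<lambda>\<psi> t. vector_derivative \<psi> (at t)) ^^ k) \<phi> differentiable (at x)) \<and>
     (\<exists>K. compact K \<and> K \<subseteq> I \<and> (\<forall>x. x \<notin> K \<longrightarrow> \<phi> x = 0))"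

definition fourier_eq_on :: "(real \<Rightarrow> real) \<Rightarrow> real set \<Rightarrow> (real \<Rightarrow> complex) \<Rightarrow> bool" where
  "fourier_eq_on \<sigma> I h \<longleftrightarrow>
     (\<forall>\<phi>. test_function I \<phi> \<longrightarrow>
        (\<integral>t. complex_of_real (\<sigma> t) * fourier1 \<phi> t \<partial>lebesgue)
        = (\<integral>\<omega>. h \<omega> * \<phi> \<omega> \<partial>lebesgue_on I))"

definition fourier_nonzero_bounded_on :: "(real \<Rightarrow> real) \<Rightarrow> real set \<Rightarrow> bool" where
  "fourier_nonzero_bounded_on \<sigma> I \<longleftrightarrow>
     (\<exists>h. Linf (lebesgue_on I) h \<and> \<not> (AE \<omega> in lebesgue_on I. h \<omega> = 0) \<and> fourier_eq_on \<sigma> I h)"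

end

theory Submission
  imports Defs "HOL-Probability.Probability"
begin

text \<open>
  Let \<open>h\<close> be the Fourier transform of \<open>\<sigma>\<close> on \<open>I\<close>, and choose \<open>p < q\<close> with \<open>0 \<notin> {p..q} \<subseteq> I\<close> and
  \<open>\<integral>\<^bsub>[p,q]\<^esub> h \<noteq> 0\<close>. Testing \<open>h\<close> with \<open>\<omega> \<mapsto> e\<^bsup>i\<omega>\<tau>/a\<^esup> L k (L (\<omega> - a))\<close>, for a bump function \<open>k\<close>, gives
  \<open>\<integral> \<sigma> (\<tau>/a + v) e\<^bsup>-iav\<^esup> k' (v/L) dv = 2\<pi> e\<^bsup>i\<tau>\<^esup> \<integral> h (a + z/L) e\<^bsup>iz\<tau>/(aL)\<^esup> k z dz\<close>, where \<open>k'\<close> is the Fourier transform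
  of \<open>k\<close>. Although \<open>h\<close> is only bounded, averaging over \<open>a \<in> [p,q]\<close> turns the right hand side into
  \<open>2\<pi> e\<^bsup>i\<tau>\<^esup> \<integral>\<^bsub>[p,q]\<^esub> h\<close> up to \<open>O ((1 + \<bar>\<tau>\<bar>) / L)\<close>. So the exponential \<open>e\<^bsup>i\<tau>\<^esup>\<close> is, up to this error, a
  superposition of dilates and translates of \<open>\<sigma>\<close> with weights of total mass \<open>O (L)\<close>. Inserting this
  into \<open>f x = \<integral> e\<^bsup>i\<omega>\<cdot>x\<^esup> g \<omega> d\<omega>\<close>, with \<open>g\<close> the Fourier transform of \<open>f\<close>, and sampling \<open>n\<close>
  terms by Maurey's argument gives the error
  \<open>O (1/L + L/\<surd>n)\<close>, and \<open>L\<close> is taken proportional to \<open>n\<^bsup>1/4\<^esup>\<close>.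

  That \<open>f\<close> is given by this integral follows by testing with modulated Gaussians, whose Fourier
  transforms are Gaussians with arbitrary centres and widths.
\<close>

section \<open>A bump function\<close>

text \<open>The obstacle is that \<open>h\<close> is merely bounded, so testing it near a single
  frequency \<open>a\<close> gives no rate. Its integral over \<open>[p,q]\<close> behaves better:
  shifting the interval by \<open>z/L\<close> alters it only near the two ends. This makes
  \<open>a\<close> a sampling parameter beside \<open>\<omega>\<close> and \<open>v\<close>; and
  since \<tau> is divided by \<open>a\<close>, the interval has to avoid 0. Phases are measured from
  a point \<open>x0\<close> of \<Omega>. Then |\<tau>| \<le> |\<omega>| diam \<Omega>, so that the
  error \<open>1 + |\<tau>|\<close>, integrated against \<open>|g|\<close>, becomes the Barron norm
  of order 1, and the constant sees \<Omega> only through its diameter. A network evaluates \<sigma>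
  at points, whereas the integral identities determine it only up to null sets. The integrals are
  therefore computed with a Borel version of \<sigma>, and almost every parameter is shown to yield
  a neuron that agrees with its Borel version for almost every \<open>x\<close>; samples are drawn
  among those. The weights come out complex, but \<sigma> and \<open>f\<close> are real, so their
  real parts suffice.\<close>

definition bumpE :: "nat \<Rightarrow> real \<Rightarrow> real" where
  "bumpE m u = (if u > 0 then exp (- 1 / u) / u ^ m else 0)"

lemma bumpE_tendsto_0: "(bumpE m \<longlongrightarrow> 0) (at 0)"
proof -
  have "((\<lambda>u::real. exp (- 1 / u) / u ^ m) \<longlongrightarrow> 0) (at_right 0)"
    by real_asymp
  hence r: "(bumpE m \<longlongrightarrow> 0) (at_right 0)"
    by (rule Lim_transform_eventually)
       (auto simp: bumpE_def eventually_at_right_less intro!: eventually_mono[OF eventually_at_right_less])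
  have l: "(bumpE m \<longlongrightarrow> 0) (at_left 0)"
    by (rule Lim_transform_eventually[OF tendsto_const])
       (auto simp: bumpE_def eventually_at_filter)
  show ?thesis using l r by (simp add: filterlim_split_at)
qed

text \<open>The index \<open>m\<close> exists for this closure property: differentiating
  \<open>exp (- 1 / u)\<close> brings down \<open>1 / u^2\<close>, differentiating the power brings
  down \<open>1 / u\<close>, and both results stay in the family.\<close>

lemma has_field_derivative_bumpE:
  "(bumpE m has_real_derivative bumpE (m + 2) u - real m * bumpE (Suc m) u) (at u)"
proof -
  consider "u > 0" | "u < 0" | "u = 0" by linarith
  then show ?thesis
  proof cases
    case 1
    have "((\<lambda>u. exp (- 1 / u) / u ^ m) has_real_derivative
            bumpE (m + 2) u - real m * bumpE (Suc m) u) (at u)"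
      using 1
      apply (auto intro!: derivative_eq_intros simp: bumpE_def)
      \<comment> \<open>The derivative of \<open>u ^ m\<close> contains the truncated exponent
        \<open>m - 1\<close>; the case split removes the subtraction.\<close>
      apply (cases m)
      apply (auto simp: field_simps power2_eq_square)
      done
    moreover have "eventually (\<lambda>v. bumpE m v = exp (- 1 / v) / v ^ m) (nhds u)"
      using eventually_nhds_in_open[of "{0<..}" u] 1 by (auto elim!: eventually_mono simp: bumpE_def)
    ultimately show ?thesis by (subst DERIV_cong_ev[OF refl _ refl])
  next
    case 2
    have "eventually (\<lambda>v. bumpE m v = 0) (nhds u)"
      using eventually_nhds_in_open[of "{..<0}" u] 2 by (auto elim!: eventually_mono simp: bumpE_def)
    hence "(bumpE m has_real_derivative 0) (at u)"
      by (subst DERIV_cong_ev[OF refl _ refl]) auto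
    thus ?thesis using 2 by (simp add: bumpE_def)
  next
    case 3
    \<comment> \<open>As \<open>bumpE m 0 = 0\<close>, the difference quotient at 0 is
      \<open>bumpE (Suc m)\<close> itself.\<close>
    have "((\<lambda>h. bumpE (Suc m) h) \<longlongrightarrow> 0) (at 0)" by (rule bumpE_tendsto_0)
    hence "((\<lambda>h. (bumpE m (0 + h) - bumpE m 0) / h) \<longlongrightarrow> 0) (at 0)"
      by (rule Lim_transform_eventually) (auto simp: bumpE_def eventually_at_filter)
    hence "(bumpE m has_real_derivative 0) (at 0)" by (simp add: DERIV_def)
    thus ?thesis using 3 by (simp add: bumpE_def)
  qed
qed

text \<open>The polynomial and the index \<open>m\<close> absorb every factor that differentiation
  creates, so smoothness of all orders reduces to closure under one derivative. Sums are a
  constructor because the product rule yields terms with different \<open>m\<close>. The parameters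
  are the modulation \<open>s\<close>, the inverse width \<open>l\<close> and the centre
  \<open>a\<close>.\<close>

inductive_set bump_span :: "real \<Rightarrow> real \<Rightarrow> real \<Rightarrow> (real \<Rightarrow> complex) set" for s l a where
  base: "(\<lambda>x. poly P (of_real x) * cis (s * x) * of_real (bumpE m (1 - (l * (x - a))\<^sup>2))) \<in> bump_span s l a"
| add: "f \<in> bump_span s l a \<Longrightarrow> g \<in> bump_span s l a \<Longrightarrow> (\<lambda>x. f x + g x) \<in> bump_span s l a"

lemma has_vector_derivative_cis:
  "((\<lambda>x. cis (s * x)) has_vector_derivative (\<i> * of_real s * cis (s * x))) (at x within A)"
  unfolding cis_conv_exp
  using has_vector_derivative_real_field[of "\<lambda>z. exp (\<i> * (of_real s * z))" "\<i> * of_real s * exp (\<i> * of_real (s * x))" x A]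
  by (force intro!: derivative_eq_intros)

lemma bump_span_deriv:
  "f \<in> bump_span s l a \<Longrightarrow>
    \<exists>f'\<in>bump_span s l a. \<forall>x. (f has_vector_derivative f' x) (at x)"
proof (induction rule: bump_span.induct)
  case (base P m)
  let ?u = "\<lambda>x. 1 - (l * (x - a))\<^sup>2"
  \<comment> \<open>\<open>?Q\<close> is the derivative of \<open>?u\<close> as a polynomial in
    \<open>x\<close>, so the factor of the chain rule can be merged into \<open>P\<close>.\<close>
  let ?Q = "[:of_real (2 * l\<^sup>2 * a), of_real (- 2 * l\<^sup>2):] :: complex poly"
  let ?t = "\<lambda>P m x. poly P (of_real x) * cis (s * x) * of_real (bumpE m (?u x))"
  let ?f' = "\<lambda>x. (?t (pderiv P + smult (\<i> * of_real s) P) m x + ?t (P * ?Q) (m + 2) x)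
               + ?t (P * ?Q * [: - of_nat m:]) (Suc m) x"
  have "?f' \<in> bump_span s l a"
    by (intro bump_span.intros)
  moreover have "(?t P m has_vector_derivative ?f' x) (at x)" for x
  proof -
    have 1: "((\<lambda>x. poly P (of_real x)) has_vector_derivative poly (pderiv P) (of_real x)) (at x)"
      by (rule has_vector_derivative_real_field) (rule poly_DERIV)
    have "((\<lambda>x. bumpE m (?u x)) has_real_derivative
       (bumpE (m + 2) (?u x) - real m * bumpE (Suc m) (?u x)) * (- 2 * l\<^sup>2 * (x - a))) (at x)"
      by (rule DERIV_chain2[OF has_field_derivative_bumpE])
         (auto intro!: derivative_eq_intros simp: power2_eq_square algebra_simps)
    hence 2: "((\<lambda>x. complex_of_real (bumpE m (?u x))) has_vector_derivative
       of_real ((bumpE (m + 2) (?u x) - real m * bumpE (Suc m) (?u x)) * (- 2 * l\<^sup>2 * (x - a)))) (at x)"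
      by (intro has_vector_derivative_of_real) (simp add: has_real_derivative_iff_has_vector_derivative)
    show ?thesis
      by (rule has_vector_derivative_eq_rhs,
          rule has_vector_derivative_mult[OF has_vector_derivative_mult[OF 1 has_vector_derivative_cis] 2])
         (simp add: algebra_simps power2_eq_square)
  qed
  ultimately show ?case by (intro bexI[of _ ?f'] allI)
next
  case (add f g)
  then obtain f' g' where "f' \<in> bump_span s l a" "g' \<in> bump_span s l a"
    "\<forall>x. (f has_vector_derivative f' x) (at x)" "\<forall>x. (g has_vector_derivative g' x) (at x)" by blast
  thus ?case
    by (intro bexI[of _ "\<lambda>x. f' x + g' x"]) (auto intro!: bump_span.intros has_vector_derivative_add)
qed

lemma bump_span_eq_0: "f \<in> bump_span s l a \<Longrightarrow> \<bar>l * (x - a)\<bar> \<ge> 1 \<Longrightarrow> f x = 0"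
proof (induction rule: bump_span.induct)
  case (base P m)
  hence "(l * (x - a))\<^sup>2 \<ge> 1" by (simp add: abs_le_square_iff[of 1, simplified])
  thus ?case by (simp add: bumpE_def)
qed auto

lemma bump_span_iter:
  assumes "f \<in> bump_span s l a"
  shows "((\<lambda>\<psi> t. vector_derivative \<psi> (at t)) ^^ k) f \<in> bump_span s l a"
proof (induction k)
  case (Suc k)
  let ?g = "((\<lambda>\<psi> t. vector_derivative \<psi> (at t)) ^^ k) f"
  obtain g' where g': "g' \<in> bump_span s l a" "\<forall>x. (?g has_vector_derivative g' x) (at x)"
    using bump_span_deriv[OF Suc.IH] by blast
  hence "(\<lambda>t. vector_derivative ?g (at t)) = g'"
    by (auto intro!: vector_derivative_at)
  thus ?case using g' by simp
qed (use assms in simp)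

lemma test_function_bump_span:
  assumes f: "f \<in> bump_span s l a" and l: "l > 0" and I: "{a - 1 / l..a + 1 / l} \<subseteq> I"
  shows "test_function I f"
  unfolding test_function_def
proof (intro conjI allI exI[of _ "{a - 1 / l..a + 1 / l}"] impI)
  fix k x
  obtain g' where "\<forall>x. (((\<lambda>\<psi> t. vector_derivative \<psi> (at t)) ^^ k) f has_vector_derivative g' x) (at x)"
    using bump_span_deriv[OF bump_span_iter[OF f]] by blast
  thus "((\<lambda>\<psi> t. vector_derivative \<psi> (at t)) ^^ k) f differentiable at x"
    by (meson differentiableI_vector)
next
  fix x assume "x \<notin> {a - 1 / l..a + 1 / l}"
  hence "\<bar>l * (x - a)\<bar> \<ge> 1" using l by (auto simp: abs_mult field_simps)
  thus "f x = 0" using bump_span_eq_0[OF f] by blast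
qed (use I in auto)

lemma bump_span_continuous: "f \<in> bump_span s l a \<Longrightarrow> continuous_on A f"
  using bump_span_deriv[of f s l a]
  by (meson continuous_at_imp_continuous_on has_vector_derivative_continuous)

section \<open>Decay of the Fourier transform of the bump\<close>

lemma integral_cis_deriv:
  fixes f f' :: "real \<Rightarrow> complex"
  assumes d: "\<And>x. (f has_vector_derivative f' x) (at x)"
    and c: "continuous_on UNIV f'" and z: "\<And>x. \<bar>x\<bar> \<ge> 1 \<Longrightarrow> f x = 0" "\<And>x. \<bar>x\<bar> \<ge> 1 \<Longrightarrow> f' x = 0"
  shows "(\<integral>x. cis (- (v * x)) * f' x \<partial>lborel) = \<i> * v * (\<integral>x. cis (- (v * x)) * f x \<partial>lborel)"
proof -
  have cf: "continuous_on UNIV f"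
    by (meson continuous_at_imp_continuous_on d has_vector_derivative_continuous)
  have d2: "((\<lambda>x. cis (- (v * x)) * f x) has_vector_derivative
      cis (- (v * x)) * f' x + (\<i> * of_real (- v) * cis (- (v * x))) * f x) (at x)" for x
    using has_vector_derivative_mult[OF has_vector_derivative_cis[of "- v" x UNIV] d] by simp
  have i: "integrable lborel (\<lambda>x. cis (- (v * x)) * g x)"
    if "continuous_on UNIV g" "\<And>x. \<bar>x\<bar> \<ge> 1 \<Longrightarrow> g x = 0" for g
  proof -
    have "integrable lborel (\<lambda>x. indicator {-1..1} x *\<^sub>R (cis (- (v * x)) * g x))"
      by (rule borel_integrable_compact)
         (auto intro!: continuous_intros continuous_on_subset[OF that(1)] simp: cis_conv_exp)
    also have "(\<lambda>x. indicator {-1..1} x *\<^sub>R (cis (- (v * x)) * g x)) = (\<lambda>x. cis (- (v * x)) * g x)"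
      using that(2) by (auto simp: fun_eq_iff indicator_def)
    finally show ?thesis .
  qed
  let ?F = "\<lambda>x. cis (- (v * x)) * f' x + (\<i> * of_real (- v) * cis (- (v * x))) * f x"
  have cc: "continuous_on UNIV (\<lambda>x. cis (- (v * x)))"
    by (auto intro!: continuous_intros simp: cis_conv_exp)
  have cF: "continuous_on {-1..1} ?F"
    by (rule continuous_on_subset[of UNIV]) (intro continuous_intros cc c cf, simp)
  \<comment> \<open>Integration by parts as the fundamental theorem for the product
    \<open>cis (- (v * x)) * f x\<close>: it vanishes at both ends, and outside the interval the
    integrand is zero anyway.\<close>
  have "(\<integral>x. indicator {-1..1} x *\<^sub>R ?F x \<partial>lborel) = cis (- (v * 1)) * f 1 - cis (- (v * (-1))) * f (-1)"
    by (rule integral_FTC_Icc[where F = "\<lambda>x. cis (- (v * x)) * f x"])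
       (simp, rule has_vector_derivative_at_within[OF d2], rule cF)
  also have "\<dots> = 0" by (simp add: z)
  also have "(\<lambda>x. indicator {-1..1} x *\<^sub>R ?F x) = ?F"
    using z by (auto simp: fun_eq_iff indicator_def)
  finally have "(\<integral>x. ?F x \<partial>lborel) = 0" .
  moreover have "(\<integral>x. ?F x \<partial>lborel) = (\<integral>x. cis (- (v * x)) * f' x \<partial>lborel) +
      (\<integral>x. (\<i> * of_real (- v)) * (cis (- (v * x)) * f x) \<partial>lborel)"
    by (subst Bochner_Integration.integral_add[symmetric]) (auto intro!: i z cf c simp: mult.assoc)
  ultimately show ?thesis by (simp add: algebra_simps)
qed

lemma integral_cis_bounded:
  fixes g :: "real \<Rightarrow> complex"
  assumes "continuous_on UNIV g"
  shows "\<exists>B. \<forall>v. cmod (\<integral>x. cis (- (v * x)) * g x \<partial>lborel) \<le> B"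
proof (intro exI allI)
  fix v :: real
  have "cmod (\<integral>x. cis (- (v * x)) * g x \<partial>lborel) \<le> (\<integral>x. cmod (cis (- (v * x)) * g x) \<partial>lborel)"
    by (rule integral_norm_bound)
  thus "cmod (\<integral>x. cis (- (v * x)) * g x \<partial>lborel) \<le> (\<integral>x. cmod (g x) \<partial>lborel)"
    by (simp add: norm_mult)
qed

definition bumpC :: real where "bumpC = (\<integral>x. bumpE 0 (1 - x\<^sup>2) \<partial>lborel)"
definition bump :: "real \<Rightarrow> real" where "bump x = bumpE 0 (1 - x\<^sup>2) / bumpC"
text \<open>Unlike \<open>fourier1\<close>, this transform carries no factor
  \<open>1 / (2 * pi)\<close>; the factor reappears as \<open>2 * pi\<close> in
  \<open>fourier_eq_on_bump\<close>.\<close>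

definition bump_hat :: "real \<Rightarrow> complex" where
  "bump_hat v = (\<integral>x. cis (- (v * x)) * of_real (bump x) \<partial>lborel)"

lemma bumpE_cont: "continuous_on A (bumpE m)"
  by (meson DERIV_isCont continuous_at_imp_continuous_on has_field_derivative_bumpE)

lemma bump_cont: "continuous_on A bump"
  unfolding bump_def by (auto intro!: continuous_intros continuous_on_compose2[OF bumpE_cont[of UNIV]] simp: divide_inverse)

lemma bump_eq_0: "\<bar>x\<bar> \<ge> 1 \<Longrightarrow> bump x = 0"
  by (simp add: bump_def bumpE_def abs_le_square_iff[of 1, simplified] not_less)

lemma bump_integrable0: "integrable lborel (\<lambda>x. bumpE 0 (1 - x\<^sup>2))"
proof -
  have "integrable lborel (\<lambda>x. indicator {-1..1} x *\<^sub>R bumpE 0 (1 - x\<^sup>2))"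
    by (rule borel_integrable_compact)
       (auto intro!: continuous_intros continuous_on_compose2[OF bumpE_cont[of UNIV]])
  also have "(\<lambda>x. indicator {-1..1} x *\<^sub>R bumpE 0 (1 - x\<^sup>2)) = (\<lambda>x. bumpE 0 (1 - x\<^sup>2))"
    by (auto simp: fun_eq_iff bumpE_def indicator_def abs_square_less_1 abs_less_iff)
  finally show ?thesis .
qed

lemma bumpC_pos: "bumpC > 0"
proof -
  have "bumpC \<ge> 0" unfolding bumpC_def by (rule integral_nonneg_AE) (auto simp: bumpE_def)
  moreover have "bumpC \<noteq> 0"
  proof
    assume "bumpC = 0"
    hence "AE x in lborel. bumpE 0 (1 - x\<^sup>2) = 0"
      unfolding bumpC_def using integral_nonneg_eq_0_iff_AE[OF bump_integrable0] by (auto simp: bumpE_def)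
    hence "AE x in lborel. x \<notin> {0<..<1::real}"
      by (elim eventually_mono) (auto simp: bumpE_def abs_square_less_1)
    hence "emeasure lborel {0<..<1::real} = 0"
      by (subst (asm) AE_iff_measurable[where N = "{0<..<1::real}"]) auto
    thus False by simp
  qed
  ultimately show ?thesis by simp
qed

lemma bump_nonneg: "bump x \<ge> 0"
  using bumpC_pos by (simp add: bump_def bumpE_def)

lemma bump_integrable: "integrable lborel bump"
  unfolding bump_def[abs_def] using bump_integrable0 by simp

lemma bump_integral: "(\<integral>x. bump x \<partial>lborel) = 1"
  using bumpC_pos unfolding bump_def by (simp add: bumpC_def)

lemma bump_in_span:
  "(\<lambda>x. cis (s * x) * of_real (l * bump (l * (x - a)))) \<in> bump_span s l a"
  using bump_span.base[of "[:of_real (l / bumpC):]" s 0 l a]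
  by (simp add: bump_def mult_ac)

text \<open>Two integrations by parts move \<open>v^2\<close> onto the second derivative of the
  bump, whose transform is bounded. Quadratic decay is the aim because it makes
  \<open>bump_hat\<close> integrable, and hence the weights of finite mass.\<close>

lemma bump_hat_decay: "\<exists>B. \<forall>v. (1 + v\<^sup>2) * cmod (bump_hat v) \<le> B"
proof -
  define k where "k = (\<lambda>x. complex_of_real (bump x))"
  have k: "k \<in> bump_span 0 1 0" using bump_in_span[of 0 1 0] by (simp add: k_def)
  obtain k1 where k1: "k1 \<in> bump_span 0 1 0" "\<And>x. (k has_vector_derivative k1 x) (at x)"
    using bump_span_deriv[OF k] by blast
  obtain k2 where k2: "k2 \<in> bump_span 0 1 0" "\<And>x. (k1 has_vector_derivative k2 x) (at x)"
    using bump_span_deriv[OF k1(1)] by blast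
  have z: "\<bar>x\<bar> \<ge> 1 \<Longrightarrow> k x = 0" "\<bar>x\<bar> \<ge> 1 \<Longrightarrow> k1 x = 0" "\<bar>x\<bar> \<ge> 1 \<Longrightarrow> k2 x = 0" for x
    using bump_span_eq_0[of _ 0 1 0 x] k k1(1) k2(1) by simp_all
  note c = bump_span_continuous[of _ 0 1 0]
  have "(\<integral>x. cis (- (v * x)) * k2 x \<partial>lborel) = \<i> * v * (\<integral>x. cis (- (v * x)) * k1 x \<partial>lborel)" for v
    by (rule integral_cis_deriv[OF k2(2) c[OF k2(1)]]) (use z in auto)
  moreover have "(\<integral>x. cis (- (v * x)) * k1 x \<partial>lborel) = \<i> * v * (\<integral>x. cis (- (v * x)) * k x \<partial>lborel)" for v
    by (rule integral_cis_deriv[OF k1(2) c[OF k1(1)]]) (use z in auto)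
  moreover have "\<i> * of_real v * (\<i> * of_real v * X) = - (of_real (v\<^sup>2)) * X" for v and X :: complex
    by (simp add: power2_eq_square mult_ac)
  ultimately have 1: "(\<integral>x. cis (- (v * x)) * k2 x \<partial>lborel) = - (of_real (v\<^sup>2)) * bump_hat v" for v
    by (simp only: bump_hat_def k_def)
  have "\<exists>B. \<forall>v. cmod (\<integral>x. cis (- (v * x)) * k2 x \<partial>lborel) \<le> B"
    by (rule integral_cis_bounded[OF c[OF k2(1)]])
  then obtain B1 where B1: "\<And>v. cmod (\<integral>x. cis (- (v * x)) * k2 x \<partial>lborel) \<le> B1" by blast
  have "\<exists>B. \<forall>v. cmod (\<integral>x. cis (- (v * x)) * k x \<partial>lborel) \<le> B"
    by (rule integral_cis_bounded[OF c[OF k]])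
  then obtain B0 where B0: "\<And>v. cmod (\<integral>x. cis (- (v * x)) * k x \<partial>lborel) \<le> B0" by blast
  have "(1 + v\<^sup>2) * cmod (bump_hat v) \<le> B0 + B1" for v
    using B1[of v] B0[of v] unfolding 1
    by (simp add: norm_mult norm_power algebra_simps bump_hat_def k_def)
  thus ?thesis by blast
qed

lemma cis_measurable [measurable]: "cis \<in> borel_measurable borel"
  by (intro borel_measurable_continuous_onI) (auto intro!: continuous_intros simp: cis_conv_exp[abs_def])

lemma bump_measurable [measurable]: "bump \<in> borel_measurable borel"
  by (rule borel_measurable_continuous_onI[OF bump_cont])

lemma bump_hat_measurable [measurable]: "bump_hat \<in> borel_measurable borel"
  unfolding bump_hat_def[abs_def] by measurable

lemma bump_hat_integrable: "integrable lborel bump_hat"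
proof -
  obtain B where B: "\<And>v. (1 + v\<^sup>2) * cmod (bump_hat v) \<le> B" using bump_hat_decay by blast
  have "set_integrable lborel (einterval (-\<infinity>) \<infinity>) (\<lambda>x. inverse (1 + x\<^sup>2))"
    using integrable_inverse_1_plus_square .
  hence "integrable lborel (\<lambda>x::real. B * inverse (1 + x\<^sup>2))"
    by (simp add: set_integrable_def)
  thus ?thesis
  proof (rule Bochner_Integration.integrable_bound)
    show "AE x in lborel. norm (bump_hat x) \<le> norm (B * inverse (1 + x\<^sup>2))"
    proof (rule AE_I2)
      fix x :: real
      have p: "1 + x\<^sup>2 > 0" by (smt (verit) zero_le_power2)
      have "norm (bump_hat x) \<le> B * inverse (1 + x\<^sup>2)"
        using B[of x] p by (simp add: field_simps)
      thus "norm (bump_hat x) \<le> norm (B * inverse (1 + x\<^sup>2))" by simp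
    qed
  qed simp
qed

section \<open>Approximating exponentials by the activation function\<close>

lemma integral_lebesgue_lborel:
  fixes f :: "real \<Rightarrow> complex"
  shows "f \<in> borel_measurable borel \<Longrightarrow> integral\<^sup>L lebesgue f = integral\<^sup>L lborel f"
  by (rule integral_completion) simp

text \<open>Narrowing the test function to width \<open>1/L\<close> spreads its transform over width
  \<open>L\<close>: this is the origin of the factor \<open>L\<close> in the mass of the weights.
  The modulation \<open>s\<close> becomes a shift and the centre \<open>a\<close> a phase.\<close>

lemma fourier1_bump:
  assumes L: "L > 0"
  shows "fourier1 (\<lambda>x. cis (s * x) * of_real (L * bump (L * (x - a)))) u =
    (1 / (2 * pi)) *\<^sub>R (cis (- (a * (u - s))) * bump_hat ((u - s) / L))"
proof -
  let ?f = "\<lambda>x. cis (- (u * x)) * (cis (s * x) * of_real (L * bump (L * (x - a))))"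
  have "(\<integral>x. ?f x \<partial>lebesgue) = (\<integral>x. ?f x \<partial>lborel)"
    by (rule integral_lebesgue_lborel) measurable
  also have "\<dots> = \<bar>1 / L\<bar> *\<^sub>R (\<integral>x. ?f (a + (1 / L) * x) \<partial>lborel)"
    using L by (intro lborel_integral_real_affine) auto
  also have "(\<lambda>x. ?f (a + (1 / L) * x)) =
     (\<lambda>x. (of_real L * cis (- (a * (u - s)))) * (cis (- ((u - s) / L * x)) * of_real (bump x)))"
  proof
    fix x
    have "cis (- (u * (a + (1 / L) * x))) * cis (s * (a + (1 / L) * x)) =
      cis (- (a * (u - s))) * cis (- ((u - s) / L * x))"
      unfolding cis_mult using L by (intro arg_cong[where f = cis]) (simp add: field_simps)
    thus "?f (a + (1 / L) * x) = (of_real L * cis (- (a * (u - s)))) * (cis (- ((u - s) / L * x)) * of_real (bump x))"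
      using L by (simp add: mult_ac)
  qed
  also have "\<bar>1 / L\<bar> *\<^sub>R (\<integral>x. (of_real L * cis (- (a * (u - s)))) * (cis (- ((u - s) / L * x)) * of_real (bump x)) \<partial>lborel)
    = cis (- (a * (u - s))) * bump_hat ((u - s) / L)"
    using L by (simp add: bump_hat_def scaleR_conv_of_real)
  finally show ?thesis by (simp add: fourier1_def)
qed

text \<open>The distributional identity on \<open>I\<close>, applied to a modulated bump and
  rescaled on both sides by \<open>L\<close>. Later the shift is \<tau>/\<open>a\<close>, which
  turns \<open>cis (a * s)\<close> into \<open>cis \<tau>\<close>.\<close>

lemma fourier_eq_on_bump:
  assumes eq: "fourier_eq_on \<sigma> I h"
    and \<sigma>1: "\<sigma>1 \<in> borel_measurable borel" "AE x in lborel. \<sigma> x = \<sigma>1 x"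
    and I: "open I" and h1: "h1 \<in> borel_measurable borel" "AE x in lborel. x \<in> I \<longrightarrow> h x = h1 x"
    and \<sigma>m: "\<sigma> \<in> borel_measurable lebesgue" and hm: "h \<in> borel_measurable (lebesgue_on I)"
    and L: "L > 0" and sub: "{a - 1 / L..a + 1 / L} \<subseteq> I"
  shows "(\<integral>v. of_real (\<sigma>1 (s + v)) * (cis (- (a * v)) * bump_hat (v / L)) \<partial>lborel) =
    of_real (2 * pi) * cis (a * s) * (\<integral>z. h1 (a + z / L) * cis (s * z / L) * of_real (bump z) \<partial>lborel)"
proof -
  note [measurable] = \<sigma>1(1) h1(1)
  let ?p = "\<lambda>x. cis (s * x) * of_real (L * bump (L * (x - a)))"
  have p: "?p \<in> bump_span s L a" by (rule bump_in_span)
  have tf: "test_function I ?p" by (rule test_function_bump_span[OF p L sub])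
  have Il: "I \<in> sets lebesgue" using I by auto
  have cm: "(\<lambda>t. complex_of_real (\<sigma> t)) \<in> borel_measurable lebesgue"
    using \<sigma>m by simp
  have "(\<integral>t. complex_of_real (\<sigma> t) * fourier1 ?p t \<partial>lebesgue) =
        (\<integral>t. complex_of_real (\<sigma>1 t) * fourier1 ?p t \<partial>lebesgue)"
  proof (rule integral_cong_AE)
    show "AE t in lebesgue. complex_of_real (\<sigma> t) * fourier1 ?p t = complex_of_real (\<sigma>1 t) * fourier1 ?p t"
      by (rule AE_completion) (use \<sigma>1(2) in eventually_elim, simp)
    have "(\<lambda>t. fourier1 ?p t) \<in> borel_measurable borel"
      unfolding fourier1_bump[OF L] by measurable
    hence f: "(\<lambda>t. fourier1 ?p t) \<in> borel_measurable lebesgue"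
      by (simp add: measurable_completion)
    show "(\<lambda>t. complex_of_real (\<sigma> t) * fourier1 ?p t) \<in> borel_measurable lebesgue"
      by (rule borel_measurable_times[OF cm f])
    show "(\<lambda>t. complex_of_real (\<sigma>1 t) * fourier1 ?p t) \<in> borel_measurable lebesgue"
      by (rule borel_measurable_times[OF _ f]) (simp add: measurable_completion)
  qed
  also have "\<dots> = (\<integral>t. complex_of_real (\<sigma>1 t) * fourier1 ?p t \<partial>lborel)"
    unfolding fourier1_bump[OF L] by (rule integral_lebesgue_lborel) measurable
  also have "\<dots> = (1 / (2 * pi)) *\<^sub>R (\<integral>t. complex_of_real (\<sigma>1 t) * (cis (- (a * (t - s))) * bump_hat ((t - s) / L)) \<partial>lborel)"
    unfolding fourier1_bump[OF L] by simp
  also have "(\<integral>t. complex_of_real (\<sigma>1 t) * (cis (- (a * (t - s))) * bump_hat ((t - s) / L)) \<partial>lborel) =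
     (\<integral>v. of_real (\<sigma>1 (s + v)) * (cis (- (a * v)) * bump_hat (v / L)) \<partial>lborel)"
    by (subst lborel_integral_real_affine[of 1 _ s]) auto
  finally have 1: "(\<integral>t. complex_of_real (\<sigma> t) * fourier1 ?p t \<partial>lebesgue) =
     (1 / (2 * pi)) *\<^sub>R (\<integral>v. of_real (\<sigma>1 (s + v)) * (cis (- (a * v)) * bump_hat (v / L)) \<partial>lborel)" .
  \<comment> \<open>\<open>h\<close> and \<open>h1\<close> are compared on \<open>I\<close> only;
    outside \<open>I\<close> the test function vanishes, so that \<open>h1\<close> may be integrated
    over the whole line.\<close>
  have p0: "?p x = 0" if "x \<notin> I" for x
  proof -
    have "\<bar>L * (x - a)\<bar> \<ge> 1" using sub that L by (force simp: abs_mult field_simps subset_iff)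
    thus ?thesis using bump_span_eq_0[OF p] by blast
  qed
  have hI: "(\<lambda>x. indicator I x *\<^sub>R h x) \<in> borel_measurable lebesgue"
    using hm Il by (simp add: borel_measurable_restrict_space_iff)
  have pm: "?p \<in> borel_measurable lebesgue"
    by (rule measurable_completion) measurable
  have "(\<integral>x. h x * ?p x \<partial>lebesgue_on I) = (\<integral>x. indicator I x *\<^sub>R (h x * ?p x) \<partial>lebesgue)"
    using Il by (simp add: integral_restrict_space)
  also have "\<dots> = (\<integral>x. h1 x * ?p x \<partial>lebesgue)"
  proof (rule integral_cong_AE)
    have "(\<lambda>x. (indicator I x *\<^sub>R h x) * ?p x) \<in> borel_measurable lebesgue"
      by (rule borel_measurable_times[OF hI pm])
    thus "(\<lambda>x. indicator I x *\<^sub>R (h x * ?p x)) \<in> borel_measurable lebesgue" by simp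
    show "(\<lambda>x. h1 x * ?p x) \<in> borel_measurable lebesgue"
      by (rule measurable_completion) measurable
    show "AE x in lebesgue. indicator I x *\<^sub>R (h x * ?p x) = h1 x * ?p x"
      by (rule AE_completion) (use h1(2) in eventually_elim, use p0 in \<open>force simp: indicator_def\<close>)
  qed
  also have "\<dots> = (\<integral>x. h1 x * ?p x \<partial>lborel)"
    by (rule integral_lebesgue_lborel) measurable
  also have "\<dots> = \<bar>1 / L\<bar> *\<^sub>R (\<integral>z. h1 (a + (1 / L) * z) * ?p (a + (1 / L) * z) \<partial>lborel)"
    using L by (intro lborel_integral_real_affine) auto
  also have "(\<lambda>z. h1 (a + (1 / L) * z) * ?p (a + (1 / L) * z)) =
     (\<lambda>z. (of_real L * cis (a * s)) * (h1 (a + z / L) * cis (s * z / L) * of_real (bump z)))"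
    using L by (auto simp: fun_eq_iff distrib_left cis_mult[symmetric] mult_ac)
  also have "\<bar>1 / L\<bar> *\<^sub>R (\<integral>z. (of_real L * cis (a * s)) * (h1 (a + z / L) * cis (s * z / L) * of_real (bump z)) \<partial>lborel)
     = cis (a * s) * (\<integral>z. h1 (a + z / L) * cis (s * z / L) * of_real (bump z) \<partial>lborel)"
    using L by (simp add: scaleR_conv_of_real)
  finally have 2: "(\<integral>x. h x * ?p x \<partial>lebesgue_on I) = 
    cis (a * s) * (\<integral>z. h1 (a + z / L) * cis (s * z / L) * of_real (bump z) \<partial>lborel)" .
  have "(1 / (2 * pi)) *\<^sub>R (\<integral>v. of_real (\<sigma>1 (s + v)) * (cis (- (a * v)) * bump_hat (v / L)) \<partial>lborel) =
      cis (a * s) * (\<integral>z. h1 (a + z / L) * cis (s * z / L) * of_real (bump z) \<partial>lborel)"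
    using eq tf unfolding fourier_eq_on_def 1[symmetric] 2[symmetric] by blast
  from arg_cong[OF this, of "\<lambda>x. (2 * pi) *\<^sub>R x"] show ?thesis
    by (simp add: scaleR_conv_of_real mult_ac)
qed

section \<open>Averaging over the frequency\<close>

lemma integrable_pair_mult:
  fixes f :: "'a \<Rightarrow> real" and g :: "'b \<Rightarrow> real"
  assumes "sigma_finite_measure N" and f: "integrable M f" and g: "integrable N g"
  shows "integrable (M \<Otimes>\<^sub>M N) (\<lambda>z. f (fst z) * g (snd z))"
proof -
  interpret N: sigma_finite_measure N by fact
  have [measurable]: "f \<in> borel_measurable M" "g \<in> borel_measurable N" using f g by auto
  have "(\<integral>\<^sup>+ z. ennreal (norm (f (fst z) * g (snd z))) \<partial>(M \<Otimes>\<^sub>M N)) =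
    (\<integral>\<^sup>+ x. (\<integral>\<^sup>+ y. ennreal (norm (f x)) * ennreal (norm (g y)) \<partial>N) \<partial>M)"
    by (subst N.nn_integral_fst[symmetric]) (auto simp: abs_mult ennreal_mult)
  also have "\<dots> = (\<integral>\<^sup>+ x. ennreal (norm (f x)) \<partial>M) * (\<integral>\<^sup>+ y. ennreal (norm (g y)) \<partial>N)"
    by (simp add: nn_integral_cmult nn_integral_multc)
  also have "\<dots> < \<infinity>"
    using f g by (simp add: integrable_iff_bounded ennreal_mult_less_top)
  finally show ?thesis by (intro integrableI_bounded) auto
qed

lemma integrable_indicator_Icc [simp]: "integrable lborel (indicator {x..y::real} :: real \<Rightarrow> real)"
  by (simp add: integrable_indicator_iff emeasure_lborel_Icc_eq)

lemma cis_minus_1_le: "cmod (cis t - 1) \<le> \<bar>t\<bar>"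
  using dist_exp_i_1[of t] abs_sin_x_le_abs_x[of "t/2"] by (simp add: cis_conv_exp)

text \<open>A shift of a bounded function under an interval integral is a shift of the interval,
  which matters only in two end pieces of length |t|. This supplies the Lipschitz bound that
  \<open>h\<close> itself cannot offer.\<close>

lemma integral_shift_diff:
  fixes h :: "real \<Rightarrow> complex"
  assumes [measurable]: "h \<in> borel_measurable borel" and H: "\<And>x. cmod (h x) \<le> H" and pq: "p \<le> q"
  shows "cmod ((\<integral>a. indicator {p..q} a * h (a + t) \<partial>lborel) - (\<integral>a. indicator {p..q} a * h a \<partial>lborel)) \<le> 2 * H * \<bar>t\<bar>"
proof -
  have H0: "H \<ge> 0" using H[of 0] norm_ge_zero order_trans by blast
  have i: "integrable lborel (\<lambda>a. indicator {x..y} a * h a)" for x y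
    by (rule Bochner_Integration.integrable_bound[of _ "\<lambda>a. H * indicator {x..y} a"])
       (use H H0 in \<open>auto simp: indicator_eq_0_iff norm_mult split: split_indicator\<close>)
  have "(\<integral>a. indicator {p..q} a * h (a + t) \<partial>lborel) = (\<integral>a. indicator {p + t..q + t} a * h a \<partial>lborel)"
    by (subst (2) lborel_integral_real_affine[of 1 _ t]) (auto simp: indicator_def add_ac intro!: Bochner_Integration.integral_cong)
  hence "cmod ((\<integral>a. indicator {p..q} a * h (a + t) \<partial>lborel) - (\<integral>a. indicator {p..q} a * h a \<partial>lborel)) =
     cmod (\<integral>a. indicator {p + t..q + t} a * h a - indicator {p..q} a * h a \<partial>lborel)"
    by (simp add: Bochner_Integration.integral_diff[OF i i])
  also have "\<dots> \<le> (\<integral>a. cmod (indicator {p + t..q + t} a * h a - indicator {p..q} a * h a) \<partial>lborel)"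
    by (rule integral_norm_bound)
  \<comment> \<open>The two intervals differ only between \<open>p\<close> and \<open>p + t\<close>
    and between \<open>q\<close> and \<open>q + t\<close>; \<open>min\<close> and \<open>max\<close>
    cover both signs of \<open>t\<close>.\<close>
  also have "\<dots> \<le> (\<integral>a. H * (indicator {min p (p + t)..max p (p + t)} a + indicator {min q (q + t)..max q (q + t)} a) \<partial>lborel)"
  proof (rule integral_mono)
    show "integrable lborel (\<lambda>a. cmod (indicator {p + t..q + t} a * h a - indicator {p..q} a * h a))"
      by (intro integrable_norm Bochner_Integration.integrable_diff i)
    fix a show "cmod (indicator {p + t..q + t} a * h a - indicator {p..q} a * h a)
      \<le> H * (indicator {min p (p + t)..max p (p + t)} a + indicator {min q (q + t)..max q (q + t)} a)"
      using H[of a] H0 pq by (auto simp: indicator_def)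
  qed auto
  also have "\<dots> = 2 * H * \<bar>t\<bar>" by (auto simp: min_def max_def)
  finally show ?thesis .
qed

text \<open>The two terms of the bound come from two replacements. Dropping the exponential costs at
  most |\<tau>|/(mL), since |z| < 1 on the support of \<open>bump\<close> and |a| \<ge> m on the
  interval, which lies on one side of 0. Dropping the shift \<open>z / L\<close> costs
  \<open>2 * H / L\<close> by \<open>integral_shift_diff\<close>.\<close>

lemma integral_average_bound:
  fixes h :: "real \<Rightarrow> complex"
  assumes [measurable]: "h \<in> borel_measurable borel" and H: "\<And>x. cmod (h x) \<le> H" and pq: "p < q" "0 \<notin> {p..q}"
  defines "m \<equiv> min \<bar>p\<bar> \<bar>q\<bar>"
  assumes L: "L > 0"
  shows "cmod ((\<integral>a. indicator {p..q} a * (\<integral>z. h (a + z / L) * cis ((\<tau> / a) * z / L) * of_real (bump z) \<partial>lborel) \<partial>lborel)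
     - (\<integral>a. indicator {p..q} a * h a \<partial>lborel)) \<le> (H * (q - p) / m * \<bar>\<tau>\<bar> + 2 * H) / L"
    (is "cmod (?X1 - ?c) \<le> _")
proof -
  have H0: "H \<ge> 0" using H[of 0] norm_ge_zero order_trans by blast
  have m: "m > 0" using pq by (auto simp: m_def)
  have am: "\<bar>a\<bar> \<ge> m" if "a \<in> {p..q}" for a using that pq by (auto simp: m_def)
  note ib = Bochner_Integration.integrable_bound
  have bi: "integrable lborel (\<lambda>z. H * bump z)" using bump_integrable by simp
  have ip: "integrable (lborel \<Otimes>\<^sub>M lborel) (\<lambda>z. indicator {p..q} (fst z) * (H * bump (snd z)))"
    by (rule integrable_pair_mult[OF _ _ bi])
       (auto intro: lborel.sigma_finite_measure_axioms)
  let ?F1 = "\<lambda>a z. indicator {p..q} a * (h (a + z / L) * cis ((\<tau> / a) * z / L) * of_real (bump z))"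
  let ?F2 = "\<lambda>a z. indicator {p..q} a * (h (a + z / L) * of_real (bump z))"
  have i1: "integrable (lborel \<Otimes>\<^sub>M lborel) (case_prod ?F1)"
    by (rule ib[OF ip]) (use H H0 in \<open>auto simp: norm_mult indicator_def split_beta bump_nonneg intro!: mult_right_mono split: if_splits\<close>)
  have i2: "integrable (lborel \<Otimes>\<^sub>M lborel) (case_prod ?F2)"
    by (rule ib[OF ip]) (use H H0 in \<open>auto simp: norm_mult indicator_def split_beta bump_nonneg intro!: mult_right_mono split: if_splits\<close>)
  have X1: "?X1 = integral\<^sup>L (lborel \<Otimes>\<^sub>M lborel) (case_prod ?F1)"
    by (subst lborel_pair.integral_fst[OF i1, symmetric]) simp
  \<comment> \<open>The intermediate quantity: the exponential is gone, the shift is still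
    there.\<close>
  define X2 where "X2 = integral\<^sup>L (lborel \<Otimes>\<^sub>M lborel) (case_prod ?F2)"
  have "cmod (?X1 - X2) = cmod (\<integral>u. case_prod ?F1 u - case_prod ?F2 u \<partial>(lborel \<Otimes>\<^sub>M lborel))"
    unfolding X1 X2_def by (subst Bochner_Integration.integral_diff[OF i1 i2]) simp
  also have "\<dots> \<le> (\<integral>u. cmod (case_prod ?F1 u - case_prod ?F2 u) \<partial>(lborel \<Otimes>\<^sub>M lborel))"
    by (rule integral_norm_bound)
  also have "\<dots> \<le> (\<integral>u. (\<bar>\<tau>\<bar> / (m * L)) * (indicator {p..q} (fst u) * (H * bump (snd u))) \<partial>(lborel \<Otimes>\<^sub>M lborel))"
  proof (rule integral_mono)
    show "integrable (lborel \<Otimes>\<^sub>M lborel) (\<lambda>u. cmod (case_prod ?F1 u - case_prod ?F2 u))"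
      by (intro integrable_norm Bochner_Integration.integrable_diff i1 i2)
    show "integrable (lborel \<Otimes>\<^sub>M lborel) (\<lambda>u. (\<bar>\<tau>\<bar> / (m * L)) * (indicator {p..q} (fst u) * (H * bump (snd u))))"
      using ip by simp
    fix u :: "real \<times> real"
    obtain a z where u: "u = (a, z)" by force
    show "cmod (case_prod ?F1 u - case_prod ?F2 u) \<le> (\<bar>\<tau>\<bar> / (m * L)) * (indicator {p..q} (fst u) * (H * bump (snd u)))"
    proof (cases "a \<in> {p..q} \<and> \<bar>z\<bar> < 1")
      case True
      have "cmod (case_prod ?F1 u - case_prod ?F2 u) = cmod (h (a + z / L)) * cmod (cis ((\<tau> / a) * z / L) - 1) * bump z"
      proof -
        have "case_prod ?F1 u - case_prod ?F2 u = h (a + z / L) * (cis ((\<tau> / a) * z / L) - 1) * of_real (bump z)"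
          using True by (simp add: u algebra_simps)
        thus ?thesis using bump_nonneg[of z] by (simp add: norm_mult)
      qed
      also have "\<dots> \<le> H * (\<bar>\<tau>\<bar> / (m * L)) * bump z"
      proof (intro mult_mono H bump_nonneg)
        have "cmod (cis ((\<tau> / a) * z / L) - 1) \<le> \<bar>(\<tau> / a) * z / L\<bar>" by (rule cis_minus_1_le)
        also have "\<dots> = \<bar>\<tau>\<bar> * \<bar>z\<bar> / (\<bar>a\<bar> * L)" using L by (simp add: abs_mult)
        also have "\<dots> \<le> \<bar>\<tau>\<bar> * 1 / (m * L)"
          using True am[of a] m L by (intro frac_le mult_left_mono mult_right_mono) auto
        finally show "cmod (cis ((\<tau> / a) * z / L) - 1) \<le> \<bar>\<tau>\<bar> / (m * L)" by simp
      qed (use H0 m L bump_nonneg in auto)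
      finally show ?thesis using True by (simp add: u mult_ac)
    next
      case False
      thus ?thesis using H0 m L bump_nonneg[of z] by (auto simp: u indicator_def bump_eq_0)
    qed
  qed
  also have "\<dots> = (\<bar>\<tau>\<bar> / (m * L)) * (\<integral>u. indicator {p..q} (fst u) * (H * bump (snd u)) \<partial>(lborel \<Otimes>\<^sub>M lborel))"
    by simp
  also have "(\<integral>u. indicator {p..q} (fst u) * (H * bump (snd u)) \<partial>(lborel \<Otimes>\<^sub>M lborel)) = H * (q - p)"
    using lborel_pair.integral_fst'[OF ip, symmetric] pq by (simp add: bump_integral)
  finally have A: "cmod (?X1 - X2) \<le> H * (q - p) / m * \<bar>\<tau>\<bar> / L" by (simp add: mult_ac)
  have "X2 = (\<integral>z. (\<integral>a. indicator {p..q} a * h (a + z / L) \<partial>lborel) * of_real (bump z) \<partial>lborel)"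
    unfolding X2_def lborel_pair.integral_snd[OF i2, symmetric]
    by (intro Bochner_Integration.integral_cong refl, subst integral_mult_left_zero[symmetric]) (simp add: mult_ac)
  \<comment> \<open>\<open>bump\<close> has integral 1, so the constant can be compared with
    \<open>X2\<close> under the integral over \<open>z\<close>.\<close>
  moreover have "?c = (\<integral>z. ?c * of_real (bump z) \<partial>lborel)"
    using bump_integral by (simp add: integral_complex_of_real)
  moreover have i3: "integrable lborel (\<lambda>z. (\<integral>a. indicator {p..q} a * h (a + z / L) \<partial>lborel) * of_real (bump z))"
    using lborel_pair.integrable_snd[OF i2]
    by (rule Bochner_Integration.integrable_cong[THEN iffD1, rotated 2])
       (auto, subst integral_mult_left_zero[symmetric], simp add: mult_ac)
  moreover have i4: "integrable lborel (\<lambda>z. ?c * of_real (bump z))"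
    using bump_integrable by (simp add: integrable_of_real)
  ultimately have "X2 - ?c = (\<integral>z. (\<integral>a. indicator {p..q} a * h (a + z / L) \<partial>lborel) * of_real (bump z)
      - ?c * of_real (bump z) \<partial>lborel)"
    by (subst Bochner_Integration.integral_diff[OF i3 i4]) argo
  hence "cmod (X2 - ?c) = cmod (\<integral>z. (\<integral>a. indicator {p..q} a * h (a + z / L) \<partial>lborel) * of_real (bump z)
      - ?c * of_real (bump z) \<partial>lborel)"
    by simp
  also have "\<dots> \<le> (\<integral>z. cmod ((\<integral>a. indicator {p..q} a * h (a + z / L) \<partial>lborel) * of_real (bump z)
      - ?c * of_real (bump z)) \<partial>lborel)"
    by (rule integral_norm_bound)
  also have "\<dots> \<le> (\<integral>z. (2 * H / L) * bump z \<partial>lborel)"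
  proof (rule integral_mono)
    show "integrable lborel (\<lambda>z. cmod ((\<integral>a. indicator {p..q} a * h (a + z / L) \<partial>lborel) * of_real (bump z)
      - ?c * of_real (bump z)))"
      by (intro integrable_norm Bochner_Integration.integrable_diff i3 i4)
    show "integrable lborel (\<lambda>z. (2 * H / L) * bump z)" using bump_integrable by simp
    fix z :: real
    have "cmod ((\<integral>a. indicator {p..q} a * h (a + z / L) \<partial>lborel) * of_real (bump z) - ?c * of_real (bump z)) =
      cmod ((\<integral>a. indicator {p..q} a * h (a + z / L) \<partial>lborel) - ?c) * bump z"
      using bump_nonneg[of z] by (simp add: left_diff_distrib[symmetric] norm_mult)
    also have "\<dots> \<le> (2 * H * \<bar>z / L\<bar>) * bump z"
      by (intro mult_right_mono integral_shift_diff H bump_nonneg) (use pq in auto)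
    also have "\<dots> \<le> (2 * H / L) * bump z"
    proof (cases "\<bar>z\<bar> < 1")
      case True
      hence "2 * H * \<bar>z / L\<bar> \<le> 2 * H / L" using L H0 by (simp add: field_simps mult_left_le)
      thus ?thesis by (intro mult_right_mono bump_nonneg)
    qed (simp add: bump_eq_0)
    finally show "cmod ((\<integral>a. indicator {p..q} a * h (a + z / L) \<partial>lborel) * of_real (bump z) - ?c * of_real (bump z)) \<le> (2 * H / L) * bump z" .
  qed
  also have "\<dots> = 2 * H / L" by (simp add: bump_integral)
  finally have B: "cmod (X2 - ?c) \<le> 2 * H / L" .
  have "cmod (?X1 - ?c) \<le> cmod (?X1 - X2) + cmod (X2 - ?c)"
    using norm_triangle_ineq[of "?X1 - X2" "X2 - ?c"] by simp
  also have "\<dots> \<le> H * (q - p) / m * \<bar>\<tau>\<bar> / L + 2 * H / L" using A B by linarith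
  finally show ?thesis by (simp add: add_divide_distrib)
qed

section \<open>Vanishing integrals and Borel versions\<close>

lemma completion_ex_borel_measurable_complex:
  fixes f :: "'a \<Rightarrow> complex"
  assumes f: "f \<in> borel_measurable (completion M)"
  obtains g where "g \<in> borel_measurable M" "AE x in M. f x = g x"
proof -
  have "(\<lambda>x. Re (f x)) \<in> borel_measurable (completion M)" "(\<lambda>x. Im (f x)) \<in> borel_measurable (completion M)"
    using f by simp_all
  then obtain a b where [measurable]: "a \<in> borel_measurable M" "b \<in> borel_measurable M"
    and ab: "AE x in M. Re (f x) = a x" "AE x in M. Im (f x) = b x"
    using completion_ex_borel_measurable_real by metis
  show ?thesis
  proof
    show "(\<lambda>x. Complex (a x) (b x)) \<in> borel_measurable M"
      unfolding Complex_eq by measurable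
    show "AE x in M. f x = Complex (a x) (b x)"
      using ab by eventually_elim (simp add: complex_eq_iff)
  qed
qed

lemma AE_eq_0_if_set_integrals_eq_0:
  fixes f :: "'a \<Rightarrow> real"
  assumes f: "integrable M f" and z: "\<And>A. A \<in> sets M \<Longrightarrow> (\<integral>x\<in>A. f x \<partial>M) = 0"
  shows "AE x in M. f x = 0"
proof -
  have [measurable]: "f \<in> borel_measurable M" using f by simp
  let ?A = "{x \<in> space M. f x \<ge> 0}" and ?B = "{x \<in> space M. f x < 0}"
  have AB: "?A \<in> sets M" "?B \<in> sets M" by measurable
  have i: "integrable M (\<lambda>x. indicator A x *\<^sub>R f x)" if "A \<in> sets M" for A
    by (rule integrable_mult_indicator[OF that f])
  have "(\<integral>x. norm (f x) \<partial>M) = (\<integral>x. indicator ?A x *\<^sub>R f x - indicator ?B x *\<^sub>R f x \<partial>M)"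
    by (rule Bochner_Integration.integral_cong) (simp_all add: indicator_def)
  also have "\<dots> = (\<integral>x\<in>?A. f x \<partial>M) - (\<integral>x\<in>?B. f x \<partial>M)"
    unfolding set_lebesgue_integral_def by (rule Bochner_Integration.integral_diff[OF i[OF AB(1)] i[OF AB(2)]])
  finally have "(\<integral>x. norm (f x) \<partial>M) = 0" using z AB by simp
  thus ?thesis using integral_nonneg_eq_0_iff_AE[OF integrable_norm[OF f]] by simp
qed

text \<open>The sets with vanishing integral form a Dynkin class; the integral over the whole space
  is what the complements require. It serves twice: with half-lines on the real line, and with
  orthants in higher dimension.\<close>

lemma AE_eq_0_if_pi_system_integrals_eq_0:
  fixes f :: "'a \<Rightarrow> complex"
  assumes f: "integrable M f" and G: "Int_stable G" "sets M = sigma_sets (space M) G" "G \<subseteq> Pow (space M)"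
    and z: "\<And>A. A \<in> G \<Longrightarrow> (\<integral>x\<in>A. f x \<partial>M) = 0" "(\<integral>x. f x \<partial>M) = 0"
  shows "AE x in M. f x = 0"
proof -
  have si: "set_integrable M A f" if "A \<in> sets M" for A
    unfolding set_integrable_def using f that by (rule integrable_mult_indicator[rotated])
  have all0: "(\<integral>x\<in>A. f x \<partial>M) = 0" if "A \<in> sets M" for A
  proof -
    have "A \<in> sigma_sets (space M) G" using that G by simp
    thus ?thesis
    proof (induction rule: sigma_sets_induct_disjoint[OF G(1,3), consumes 1, case_names basic empty compl union])
      case (basic A) thus ?case using z by blast
    next
      case empty show ?case by (simp add: set_lebesgue_integral_def)
    next
      case (compl A)
      hence A: "A \<in> sets M" using G by simp
      have "(\<integral>x. f x \<partial>M) = (\<integral>x\<in>space M. f x \<partial>M)"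
        unfolding set_lebesgue_integral_def by (rule Bochner_Integration.integral_cong) auto
      also have "\<dots> = (\<integral>x\<in>A \<union> (space M - A). f x \<partial>M)"
        using sets.sets_into_space[OF A] by (simp add: Un_absorb1)
      also have "\<dots> = (\<integral>x\<in>A. f x \<partial>M) + (\<integral>x\<in>space M - A. f x \<partial>M)"
        by (rule set_integral_Un) (use A in \<open>auto intro!: si\<close>)
      finally show ?case using compl.IH z by simp
    next
      case (union A)
      hence A: "range A \<subseteq> sets M" using G by auto
      have "(\<integral>x\<in>(\<Union>i. A i). f x \<partial>M) = (\<Sum>i. (\<integral>x\<in>A i. f x \<partial>M))"
        by (rule lebesgue_integral_countable_add) (use A union in \<open>auto intro!: si simp: disjoint_family_on_def\<close>)
      thus ?case using union.IH by simp
    qed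
  qed
  have "AE x in M. Re (f x) = 0"
  proof (rule AE_eq_0_if_set_integrals_eq_0)
    fix A assume A: "A \<in> sets M"
    have "(\<integral>x\<in>A. Re (f x) \<partial>M) = Re (\<integral>x\<in>A. f x \<partial>M)"
      unfolding set_lebesgue_integral_def using si[OF A] unfolding set_integrable_def
      by (subst integral_Re[symmetric]) auto
    thus "(\<integral>x\<in>A. Re (f x) \<partial>M) = 0" using all0[OF A] by simp
  qed (use f in simp)
  moreover have "AE x in M. Im (f x) = 0"
  proof (rule AE_eq_0_if_set_integrals_eq_0)
    fix A assume A: "A \<in> sets M"
    have "(\<integral>x\<in>A. Im (f x) \<partial>M) = Im (\<integral>x\<in>A. f x \<partial>M)"
      unfolding set_lebesgue_integral_def using si[OF A] unfolding set_integrable_def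
      by (subst integral_Im[symmetric]) auto
    thus "(\<integral>x\<in>A. Im (f x) \<partial>M) = 0" using all0[OF A] by simp
  qed (use f in simp)
  ultimately show ?thesis by eventually_elim (simp add: complex_eq_iff)
qed

lemma integrable_indicator_Icc_mult:
  fixes h :: "real \<Rightarrow> complex"
  assumes [measurable]: "h \<in> borel_measurable borel" and H: "\<And>x. cmod (h x) \<le> H"
  shows "integrable lborel (\<lambda>a. indicator {p..q} a * h a)"
proof -
  have H0: "H \<ge> 0" using H[of 0] norm_ge_zero order_trans by blast
  show ?thesis
    by (rule Bochner_Integration.integrable_bound[of _ "\<lambda>a. H * indicator {p..q} a"])
       (use H H0 in \<open>auto simp: indicator_eq_0_iff norm_mult split: split_indicator\<close>)
qed

lemma AE_eq_0_if_interval_integrals_eq_0: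
  fixes h :: "real \<Rightarrow> complex"
  assumes [measurable]: "h \<in> borel_measurable borel" and H: "\<And>x. cmod (h x) \<le> H"
    and z: "\<And>t. p < t \<Longrightarrow> t \<le> q \<Longrightarrow> (\<integral>a. indicator {p..t} a * h a \<partial>lborel) = 0"
  shows "AE x in lborel. x \<in> {p..q} \<longrightarrow> h x = 0"
proof -
  note i = integrable_indicator_Icc_mult[OF assms(1) H]
  have z': "(\<integral>a. indicator {p..t} a * h a \<partial>lborel) = 0" if "t \<le> q" for t
  proof (cases "p < t")
    \<comment> \<open>For \<open>t \<le> p\<close> the interval is empty or the single point
      \<open>p\<close>, a null set.\<close>
    case False
    have "AE a in lborel. a \<noteq> p" by (rule AE_lborel_singleton)
    hence "AE a in lborel. indicator {p..t} a * h a = 0"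
      by eventually_elim (use False in \<open>auto simp: indicator_def\<close>)
    thus ?thesis by (rule integral_eq_zero_AE)
  qed (use z that in blast)
  have "AE x in lborel. indicator {p..q} x * h x = 0"
  proof (rule AE_eq_0_if_pi_system_integrals_eq_0[where G = "range (\<lambda>a::real. {..a})"])
    show "integrable lborel (\<lambda>x. indicator {p..q} x * h x)" by (rule i)
    show "Int_stable (range (\<lambda>a::real. {..a}))"
      by (auto simp: Int_stable_def)
    show "sets lborel = sigma_sets (space lborel) (range (\<lambda>a::real. {..a}))"
      by (subst sets_lborel, subst borel_eq_atMost) simp
    show "(\<integral>x. indicator {p..q} x * h x \<partial>lborel) = 0" by (rule z') simp
    fix A assume "A \<in> range (\<lambda>a::real. {..a})"
    then obtain t where A: "A = {..t}" by blast
    have "(\<integral>x\<in>A. indicator {p..q} x * h x \<partial>lborel) = (\<integral>x. indicator {p..min t q} x * h x \<partial>lborel)"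
      unfolding set_lebesgue_integral_def A by (rule Bochner_Integration.integral_cong) (auto simp: indicator_def)
    thus "(\<integral>x\<in>A. indicator {p..q} x * h x \<partial>lborel) = 0" using z'[of "min t q"] by simp
  qed auto
  thus ?thesis by eventually_elim auto
qed

text \<open>Otherwise \<open>h\<close> would vanish almost everywhere on each closed interval in
  \<open>I - {0}\<close>. Those with rational endpoints are countably many and cover
  \<open>I - {0}\<close>, and the point 0 is null, so \<open>h\<close> would vanish almost
  everywhere on \<open>I\<close>.\<close>

lemma ex_interval_integral_neq_0:
  fixes h :: "real \<Rightarrow> complex"
  assumes h: "h \<in> borel_measurable borel" and H: "\<And>x. cmod (h x) \<le> H"
    and I: "open I" and nz: "\<not> (AE x in lborel. x \<in> I \<longrightarrow> h x = 0)"
  shows "\<exists>p q. p < q \<and> {p..q} \<subseteq> I \<and> 0 \<notin> {p..q} \<and> (\<integral>a. indicator {p..q} a * h a \<partial>lborel) \<noteq> 0"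
proof (rule ccontr)
  assume c: "\<not> ?thesis"
  have "AE x in lborel. x \<in> {p..q} \<longrightarrow> h x = 0" if "{p..q} \<subseteq> I - {0}" for p q
  proof (rule AE_eq_0_if_interval_integrals_eq_0[OF h H])
    fix t assume t: "p < t" "t \<le> q"
    hence "{p..t} \<subseteq> {p..q}" by simp
    hence "{p..t} \<subseteq> I" "0 \<notin> {p..t}" using that by blast+
    thus "(\<integral>a. indicator {p..t} a * h a \<partial>lborel) = 0" using c t(1) by blast
  qed
  note zero = this
  define Q where "Q = {u \<in> \<rat> \<times> \<rat>. {fst u..snd u} \<subseteq> I - {0}}"
  have "countable (\<rat> \<times> \<rat> :: (real \<times> real) set)" by (intro countable_SIGMA countable_rat)
  hence "countable Q" by (rule countable_subset[rotated]) (auto simp: Q_def)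
  hence "AE x in lborel. \<forall>u\<in>Q. x \<in> {fst u..snd u} \<longrightarrow> h x = 0"
    unfolding AE_ball_countable[OF \<open>countable Q\<close>] by (intro ballI zero) (simp add: Q_def)
  moreover have "AE x in lborel. x \<noteq> (0::real)" by (rule AE_lborel_singleton)
  ultimately have "AE x in lborel. x \<in> I \<longrightarrow> h x = 0"
  proof eventually_elim
    case (elim x)
    show ?case
    proof
      assume "x \<in> I"
      hence "x \<in> I - {0}" using elim(2) by simp
      moreover have "open (I - {0})" using I by (rule open_delete)
      ultimately obtain e where e: "e > 0" "cball x e \<subseteq> I - {0}" unfolding open_contains_cball by blast
      obtain r where r: "r \<in> \<rat>" "x - e < r" "r < x" using Rats_dense_in_real[of "x - e" x] e(1) by auto
      obtain s where s: "s \<in> \<rat>" "x < s" "s < x + e" using Rats_dense_in_real[of x "x + e"] e(1) by auto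
      have "{r..s} \<subseteq> cball x e" using r(2) s(3) by (auto simp: dist_real_def)
      hence "{r..s} \<subseteq> I - {0}" using e(2) by (rule order_trans)
      hence "(r, s) \<in> Q" using r(1) s(1) by (simp add: Q_def)
      from bspec[OF elim(1) this] show "h x = 0" using r(3) s(2) by simp
    qed
  qed
  thus False using nz by blast
qed

text \<open>Setting the Borel version to zero where it exceeds the essential bound turns a bound
  almost everywhere into one everywhere, as the domination and sampling arguments expect.\<close>

lemma Linf_borel_version:
  fixes \<sigma> :: "real \<Rightarrow> real"
  assumes "Linf lebesgue \<sigma>"
  obtains s S where "s \<in> borel_measurable borel" "AE x in lborel. \<sigma> x = s x" "\<And>x. \<bar>s x\<bar> \<le> S"
proof -
  from assms obtain B where m: "\<sigma> \<in> borel_measurable lebesgue" and B: "AE x in lebesgue. \<bar>\<sigma> x\<bar> \<le> B"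
    unfolding Linf_def by auto
  obtain s where s: "s \<in> borel_measurable lborel" "AE x in lborel. \<sigma> x = s x"
    using completion_ex_borel_measurable_real[OF m] by blast
  have B': "AE x in lborel. \<bar>\<sigma> x\<bar> \<le> B" using B by (simp add: AE_completion_iff)
  have [measurable]: "s \<in> borel_measurable borel" using s(1) by simp
  show ?thesis
  proof
    show "(\<lambda>x. if \<bar>s x\<bar> \<le> B then s x else 0) \<in> borel_measurable borel" by measurable
    show "AE x in lborel. \<sigma> x = (if \<bar>s x\<bar> \<le> B then s x else 0)"
      using s(2) B' by eventually_elim simp
    show "\<bar>if \<bar>s x\<bar> \<le> B then s x else 0\<bar> \<le> \<bar>B\<bar>" for x by auto
  qed
qed

lemma Linf_on_borel_version:
  fixes h :: "real \<Rightarrow> complex"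
  assumes "Linf (lebesgue_on I) h" and I: "open I"
  obtains k H where "k \<in> borel_measurable borel" "AE x in lborel. x \<in> I \<longrightarrow> h x = k x" "\<And>x. cmod (k x) \<le> H"
proof -
  from assms obtain B where m: "h \<in> borel_measurable (lebesgue_on I)" and B: "AE x in lebesgue_on I. cmod (h x) \<le> B"
    unfolding Linf_def by auto
  have Il: "I \<in> sets lebesgue" using I by auto
  have "(\<lambda>x. indicator I x *\<^sub>R h x) \<in> borel_measurable lebesgue"
    using m Il by (simp add: borel_measurable_restrict_space_iff)
  then obtain k where k: "k \<in> borel_measurable lborel" "AE x in lborel. indicator I x *\<^sub>R h x = k x"
    by (rule completion_ex_borel_measurable_complex)
  have B': "AE x in lborel. x \<in> I \<longrightarrow> cmod (h x) \<le> B"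
    using B Il by (subst (asm) AE_restrict_space_iff) (auto simp: AE_completion_iff)
  have [measurable]: "k \<in> borel_measurable borel" using k(1) by simp
  show ?thesis
  proof
    show "(\<lambda>x. if cmod (k x) \<le> B then k x else 0) \<in> borel_measurable borel" by measurable
    show "AE x in lborel. x \<in> I \<longrightarrow> h x = (if cmod (k x) \<le> B then k x else 0)"
      using k(2) B' by eventually_elim (auto simp: indicator_def split: if_splits)
    show "cmod (if cmod (k x) \<le> B then k x else 0) \<le> \<bar>B\<bar>" for x by auto
  qed
qed

text \<open>Provides room for the supports \<open>{a - 1 / L..a + 1 / L}\<close> uniformly in
  \<open>a\<close>; its margin determines the threshold for \<open>L\<close>.\<close>

lemma compact_interval_margin:
  fixes p q :: real
  assumes "open I" "{p..q} \<subseteq> I" "p \<le> q"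
  obtains \<delta> where "\<delta> > 0" "\<And>a. a \<in> {p..q} \<Longrightarrow> {a - \<delta>..a + \<delta>} \<subseteq> I"
proof -
  have "\<exists>e>0. cball p e \<subseteq> I" "\<exists>e>0. cball q e \<subseteq> I"
    using assms by (auto simp: open_contains_cball)
  then obtain e1 e2 where e: "e1 > 0" "cball p e1 \<subseteq> I" "e2 > 0" "cball q e2 \<subseteq> I" by blast
  show ?thesis
  proof (rule that[of "min e1 e2"])
    fix a assume a: "a \<in> {p..q}"
    show "{a - min e1 e2..a + min e1 e2} \<subseteq> I"
    proof
      fix x assume x: "x \<in> {a - min e1 e2..a + min e1 e2}"
      consider "x \<in> {p..q}" | "x \<in> cball p e1" | "x \<in> cball q e2"
        using x a by (fastforce simp: dist_real_def)
      thus "x \<in> I" using assms e by cases auto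
    qed
  qed (use e in auto)
qed

text \<open>With the shift \<tau>/\<open>a\<close>, the factor \<open>cis (a * (\<tau> / a))\<close>
  is the same for every \<open>a\<close> in the interval and leaves the average. What remains is the
  average of \<open>h\<close> over \<open>[p,q]\<close> up to the error of
  \<open>integral_average_bound\<close>; \<open>c\<close> is \<open>2 * pi\<close> times the
  integral of \<open>h\<close>.\<close>

lemma exponential_representation:
  fixes \<sigma> :: "real \<Rightarrow> real"
  assumes \<sigma>: "Linf lebesgue \<sigma>" and I: "open I" and nz: "fourier_nonzero_bounded_on \<sigma> I"
    and s: "s \<in> borel_measurable borel" "AE x in lborel. \<sigma> x = s x"
  obtains p q c E L0 where "p < q" "0 \<notin> {p..q}" "c \<noteq> (0::complex)" "E \<ge> 0" "L0 > 0"
    "\<And>L \<tau>. L \<ge> L0 \<Longrightarrow> cmod ((\<integral>a. indicator {p..q} a *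
        (\<integral>v. of_real (s (\<tau> / a + v)) * (cis (- (a * v)) * bump_hat (v / L)) \<partial>lborel) \<partial>lborel) - c * cis \<tau>)
      \<le> E * (1 + \<bar>\<tau>\<bar>) / L"
proof -
  from nz obtain h where h: "Linf (lebesgue_on I) h" "\<not> (AE \<omega> in lebesgue_on I. h \<omega> = 0)" "fourier_eq_on \<sigma> I h"
    unfolding fourier_nonzero_bounded_on_def by blast
  have Il: "I \<in> sets lebesgue" using I by auto
  obtain k H where k: "k \<in> borel_measurable borel" "AE x in lborel. x \<in> I \<longrightarrow> h x = k x"
      "\<And>x. cmod (k x) \<le> H"
    using Linf_on_borel_version[OF h(1) I] by blast
  have "\<not> (AE x in lborel. x \<in> I \<longrightarrow> k x = 0)"
  proof
    assume "AE x in lborel. x \<in> I \<longrightarrow> k x = 0"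
    with k(2) have "AE x in lborel. x \<in> I \<longrightarrow> h x = 0" by eventually_elim auto
    hence "AE x in lebesgue_on I. h x = 0"
      using Il by (subst AE_restrict_space_iff) (auto simp: AE_completion_iff)
    thus False using h(2) by blast
  qed
  then obtain p q where pq: "p < q" "{p..q} \<subseteq> I" "0 \<notin> {p..q}" and
      c: "(\<integral>a. indicator {p..q} a * k a \<partial>lborel) \<noteq> 0"
    using ex_interval_integral_neq_0[OF k(1,3) I] by blast
  obtain \<delta> where \<delta>: "\<delta> > 0" "\<And>a. a \<in> {p..q} \<Longrightarrow> {a - \<delta>..a + \<delta>} \<subseteq> I"
    using compact_interval_margin[OF I pq(2)] pq(1) by (metis less_imp_le)
  define c0 where "c0 = (\<integral>a. indicator {p..q} a * k a \<partial>lborel)"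
  define m where "m = min \<bar>p\<bar> \<bar>q\<bar>"
  \<comment> \<open>The factor \<open>2 * pi\<close> is the one in
    \<open>fourier_eq_on_bump\<close>; the bracket adds the two constants of
    \<open>integral_average_bound\<close>, so that one factor \<open>1 + \<bar>\<tau>\<bar>\<close>
    covers both terms.\<close>
  define E where "E = 2 * pi * (H * (q - p) / m + 2 * H)"
  have H0: "H \<ge> 0" using k(3)[of 0] norm_ge_zero order_trans by blast
  have m: "m > 0" using pq by (auto simp: m_def)
  show ?thesis
  proof (rule that[of p q "of_real (2 * pi) * c0" E "1 / \<delta>"])
    show "E \<ge> 0" using H0 m pq by (auto simp: E_def)
    fix L \<tau> :: real assume L: "L \<ge> 1 / \<delta>"
    hence L0: "L > 0" using \<delta>(1) by (smt (verit) divide_pos_pos)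
    have Ld: "1 / L \<le> \<delta>" using L L0 \<delta>(1) by (simp add: field_simps)
    let ?T = "\<lambda>a. \<integral>v. of_real (s (\<tau> / a + v)) * (cis (- (a * v)) * bump_hat (v / L)) \<partial>lborel"
    let ?R = "\<lambda>a. \<integral>z. k (a + z / L) * cis ((\<tau> / a) * z / L) * of_real (bump z) \<partial>lborel"
    have "indicator {p..q} a * ?T a = of_real (2 * pi) * cis \<tau> * (indicator {p..q} a * ?R a)" for a
    proof (cases "a \<in> {p..q}")
      case True
      hence "{a - 1 / L..a + 1 / L} \<subseteq> I" using \<delta>(2)[OF True] Ld by (auto simp: subset_iff)
      hence "?T a = of_real (2 * pi) * cis (a * (\<tau> / a)) * ?R a"
        using \<sigma> h(1) by (intro fourier_eq_on_bump[OF h(3) s I k(1,2) _ _ L0]) (auto simp: Linf_def)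
      thus ?thesis using True pq(3) by (cases "a = 0") auto
    qed simp
    hence "(\<integral>a. indicator {p..q} a * ?T a \<partial>lborel) =
        of_real (2 * pi) * cis \<tau> * (\<integral>a. indicator {p..q} a * ?R a \<partial>lborel)"
      by (simp only: integral_mult_right_zero)
    hence "(\<integral>a. indicator {p..q} a * ?T a \<partial>lborel) - of_real (2 * pi) * c0 * cis \<tau> =
        of_real (2 * pi) * cis \<tau> * ((\<integral>a. indicator {p..q} a * ?R a \<partial>lborel) - c0)"
      by (simp only: right_diff_distrib mult_ac)
    hence "cmod ((\<integral>a. indicator {p..q} a * ?T a \<partial>lborel) - of_real (2 * pi) * c0 * cis \<tau>) =
        2 * pi * cmod ((\<integral>a. indicator {p..q} a * ?R a \<partial>lborel) - c0)"
      by (simp add: norm_mult)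
    also have "\<dots> \<le> 2 * pi * ((H * (q - p) / m * \<bar>\<tau>\<bar> + 2 * H) / L)"
      unfolding c0_def m_def
      by (intro mult_left_mono integral_average_bound[OF k(1,3) pq(1,3) L0]) auto
    also have "\<dots> \<le> E * (1 + \<bar>\<tau>\<bar>) / L"
    proof -
      have "H * (q - p) / m * \<bar>\<tau>\<bar> + 2 * H \<le> (H * (q - p) / m + 2 * H) * (1 + \<bar>\<tau>\<bar>)"
        (is "?K * _ + _ \<le> _")
      proof -
        have "?K \<ge> 0" using H0 m pq by simp
        hence "0 \<le> ?K + 2 * H * \<bar>\<tau>\<bar>" using H0 by simp
        thus ?thesis by (simp only: distrib_left distrib_right mult_1_right)
      qed
      thus ?thesis using L0 by (simp add: E_def divide_right_mono mult.assoc)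
    qed
    finally show "cmod ((\<integral>a. indicator {p..q} a * ?T a \<partial>lborel) - of_real (2 * pi) * c0 * cis \<tau>)
      \<le> E * (1 + \<bar>\<tau>\<bar>) / L" .
  qed (use pq c \<delta> in \<open>auto simp: c0_def\<close>)
qed

section \<open>Gaussian test functions\<close>

lemma prod_ge_1_plus_sum:
  fixes a :: "'a \<Rightarrow> real"
  assumes "finite A" "\<And>i. i \<in> A \<Longrightarrow> a i \<ge> 0"
  shows "1 + (\<Sum>i\<in>A. a i) \<le> (\<Prod>i\<in>A. 1 + a i)"
  using assms
proof (induction A rule: finite_induct)
  case (insert i A)
  have "1 + (\<Sum>i\<in>insert i A. a i) \<le> (1 + a i) * (1 + (\<Sum>i\<in>A. a i))"
    using insert by (simp add: algebra_simps sum_nonneg)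
  also have "\<dots> \<le> (1 + a i) * (\<Prod>i\<in>A. 1 + a i)"
    using insert by (intro mult_left_mono) auto
  finally show ?case using insert by simp
qed simp

lemma enorm_nonneg: "enorm d x \<ge> 0"
  by (simp add: enorm_def L2_set_nonneg)

text \<open>Splits the Euclidean weight into one-variable weights, which reduces estimates for
  product functions to the line.\<close>

lemma enorm_power_le_prod: "(1 + enorm d x) ^ N \<le> (\<Prod>j<d. (1 + \<bar>x j\<bar>) ^ N)"
proof -
  have "1 + enorm d x \<le> 1 + (\<Sum>j<d. \<bar>x j\<bar>)"
    unfolding enorm_def by (simp add: L2_set_le_sum_abs)
  also have "\<dots> \<le> (\<Prod>j<d. 1 + \<bar>x j\<bar>)" by (rule prod_ge_1_plus_sum) auto
  finally have "(1 + enorm d x) ^ N \<le> (\<Prod>j<d. 1 + \<bar>x j\<bar>) ^ N"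
    using enorm_nonneg[of d x] by (intro power_mono) auto
  thus ?thesis by (simp add: prod_power_distrib)
qed

text \<open>\<open>D j m\<close> is the \<open>m\<close>-th derivative of the factor
  \<open>j\<close>. Partial derivatives of a product of one-variable functions act on separate
  factors, so a list \<open>js\<close> differentiates the factor \<open>j\<close> exactly
  \<open>count_list js j\<close> times.\<close>

lemma schwartz_prod:
  fixes D :: "nat \<Rightarrow> nat \<Rightarrow> real \<Rightarrow> complex"
  assumes deriv: "\<And>j m t. (D j m has_vector_derivative D j (Suc m) t) (at t)"
    and bound: "\<And>j m N. \<exists>B. \<forall>t. (1 + \<bar>t\<bar>) ^ N * cmod (D j m t) \<le> B"
  shows "schwartz d (\<lambda>x. \<Prod>j<d. D j 0 (x j))"
proof -
  have upd: "(\<Prod>j<d. D j (c j) ((x(i := t)) j)) = D i (c i) t * (\<Prod>j\<in>{..<d} - {i}. D j (c j) (x j))"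
    if "i < d" for i t c x
    using that by (subst prod.remove[of _ i]) auto
  have hd: "((\<lambda>t. \<Prod>j<d. D j (c j) ((x(i := t)) j)) has_vector_derivative
      D i (Suc (c i)) t * (\<Prod>j\<in>{..<d} - {i}. D j (c j) (x j))) (at t)" if "i < d" for i c x t
    unfolding upd[OF that] by (rule has_vector_derivative_mult_left[OF deriv])
  have it: "foldr partial_deriv js (\<lambda>x. \<Prod>j<d. D j 0 (x j)) = (\<lambda>x. \<Prod>j<d. D j (count_list js j) (x j))"
    if "js \<in> lists {..<d}" for js
    using that
  proof (induction js)
    case (Cons i js)
    hence i: "i < d" by simp
    show ?case
    proof
      fix x
      have "foldr partial_deriv (i # js) (\<lambda>x. \<Prod>j<d. D j 0 (x j)) x =
          D i (Suc (count_list js i)) (x i) * (\<Prod>j\<in>{..<d} - {i}. D j (count_list js j) (x j))"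
      proof -
        have "foldr partial_deriv (i # js) (\<lambda>x. \<Prod>j<d. D j 0 (x j)) x =
            partial_deriv i (foldr partial_deriv js (\<lambda>x. \<Prod>j<d. D j 0 (x j))) x"
          by simp
        also have "\<dots> = partial_deriv i (\<lambda>x. \<Prod>j<d. D j (count_list js j) (x j)) x"
          using Cons by simp
        finally show ?thesis
          unfolding partial_deriv_def using vector_derivative_at[OF hd[OF i]] by simp
      qed
      also have "\<dots> = (\<Prod>j<d. D j (count_list (i # js) j) (x j))"
        using i by (subst (2) prod.remove[of _ i]) (auto intro!: prod.cong)
      finally show "foldr partial_deriv (i # js) (\<lambda>x. \<Prod>j<d. D j 0 (x j)) x = \<dots>" .
    qed
  qed simp
  show ?thesis
    unfolding schwartz_def
  proof (intro ballI conjI allI impI)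
    fix js i x assume js: "js \<in> lists {..<d}" and i: "i < d"
    show "(\<lambda>t. foldr partial_deriv js (\<lambda>x. \<Prod>j<d. D j 0 (x j)) (x(i := t))) differentiable at (x i)"
      unfolding it[OF js] by (rule differentiableI_vector[OF hd[OF i]])
  next
    fix js N assume js: "js \<in> lists {..<d}"
    have "\<forall>j. \<exists>B. \<forall>t. (1 + \<bar>t\<bar>) ^ N * cmod (D j (count_list js j) t) \<le> B"
      using bound by blast
    from choice[OF this] obtain B where B: "\<forall>j t. (1 + \<bar>t\<bar>) ^ N * cmod (D j (count_list js j) t) \<le> B j"
      by blast
    show "\<exists>B. \<forall>x\<in>RR d. (1 + enorm d x) ^ N * cmod (foldr partial_deriv js (\<lambda>x. \<Prod>j<d. D j 0 (x j)) x) \<le> B"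
    proof (intro exI ballI)
      fix x
      have "(1 + enorm d x) ^ N * cmod (foldr partial_deriv js (\<lambda>x. \<Prod>j<d. D j 0 (x j)) x)
        \<le> (\<Prod>j<d. (1 + \<bar>x j\<bar>) ^ N) * (\<Prod>j<d. cmod (D j (count_list js j) (x j)))"
        unfolding it[OF js] prod_norm[symmetric]
        by (intro mult_right_mono enorm_power_le_prod prod_nonneg) auto
      also have "\<dots> = (\<Prod>j<d. (1 + \<bar>x j\<bar>) ^ N * cmod (D j (count_list js j) (x j)))"
        by (simp add: prod.distrib)
      also have "\<dots> \<le> (\<Prod>j<d. B j)"
        using B by (intro prod_mono) simp
      finally show "(1 + enorm d x) ^ N * cmod (foldr partial_deriv js (\<lambda>x. \<Prod>j<d. D j 0 (x j)) x) \<le> (\<Prod>j<d. B j)" .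
    qed
  qed
qed

section \<open>Modulated Gaussians and their Fourier transforms\<close>

definition gauss_wave :: "real \<Rightarrow> real \<Rightarrow> real \<Rightarrow> complex" where
  "gauss_wave y s t = cis (y * t) * of_real (exp (- (s\<^sup>2 * t\<^sup>2) / 2))"

text \<open>Variants of the Hermite polynomials: the recursion is the product rule, and its linear
  factor is the logarithmic derivative of \<open>gauss_wave\<close>.\<close>

fun gauss_poly :: "real \<Rightarrow> real \<Rightarrow> nat \<Rightarrow> complex poly" where
  "gauss_poly y s 0 = 1"
| "gauss_poly y s (Suc m) = pderiv (gauss_poly y s m) + gauss_poly y s m * [:\<i> * of_real y, - of_real (s\<^sup>2):]"

lemma has_vector_derivative_gauss_wave:
  "((\<lambda>t. poly (gauss_poly y s m) (of_real t) * gauss_wave y s t) has_vector_derivative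
      poly (gauss_poly y s (Suc m)) (of_real t) * gauss_wave y s t) (at t)"
proof -
  have 1: "((\<lambda>x. poly P (of_real x)) has_vector_derivative poly (pderiv P) (of_real t)) (at t)" for P :: "complex poly"
    by (rule has_vector_derivative_real_field) (rule poly_DERIV)
  have "((\<lambda>t. exp (- (s\<^sup>2 * t\<^sup>2) / 2)) has_real_derivative (- (s\<^sup>2) * t) * exp (- (s\<^sup>2 * t\<^sup>2) / 2)) (at t)"
    by (auto intro!: derivative_eq_intros)
  hence 2: "((\<lambda>t. complex_of_real (exp (- (s\<^sup>2 * t\<^sup>2) / 2))) has_vector_derivative
      of_real ((- (s\<^sup>2) * t) * exp (- (s\<^sup>2 * t\<^sup>2) / 2))) (at t)"
    by (intro has_vector_derivative_of_real) (simp add: has_real_derivative_iff_has_vector_derivative)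
  show ?thesis unfolding gauss_wave_def
    by (rule has_vector_derivative_eq_rhs,
        rule has_vector_derivative_mult[OF 1 has_vector_derivative_mult[OF has_vector_derivative_cis 2]])
       (simp add: algebra_simps)
qed

lemma poly_bound:
  fixes P :: "complex poly"
  shows "\<exists>C k. C \<ge> 0 \<and> (\<forall>t::real. cmod (poly P (of_real t)) \<le> C * (1 + \<bar>t\<bar>) ^ k)"
proof (induction P)
  case 0 show ?case by (intro exI[of _ 0]) simp
next
  case (pCons a P)
  then obtain C k where C: "C \<ge> 0" "\<And>t::real. cmod (poly P (of_real t)) \<le> C * (1 + \<bar>t\<bar>) ^ k" by blast
  have "cmod (poly (pCons a P) (of_real t)) \<le> (cmod a + C) * (1 + \<bar>t\<bar>) ^ Suc k" for t :: real
  proof -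
    have "cmod (poly (pCons a P) (of_real t)) \<le> cmod a + cmod (of_real t * poly P (of_real t))"
      by (simp add: norm_triangle_ineq)
    also have "\<dots> \<le> cmod a * (1 + \<bar>t\<bar>) ^ Suc k + (1 + \<bar>t\<bar>) * (C * (1 + \<bar>t\<bar>) ^ k)"
    proof (rule add_mono)
      show "cmod a \<le> cmod a * (1 + \<bar>t\<bar>) ^ Suc k"
        using one_le_power[of "1 + \<bar>t\<bar>" "Suc k"] mult_left_mono[of 1 "(1 + \<bar>t\<bar>) ^ Suc k" "cmod a"] by simp
      show "cmod (of_real t * poly P (of_real t)) \<le> (1 + \<bar>t\<bar>) * (C * (1 + \<bar>t\<bar>) ^ k)"
        unfolding norm_mult by (intro mult_mono C) auto
    qed
    finally show ?thesis by (simp add: algebra_simps)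
  qed
  thus ?case using C(1) by (intro exI[of _ "cmod a + C"] exI[of _ "Suc k"]) auto
qed

text \<open>One term of the exponential series bounds the power by
  \<open>fact k * exp (1 + \<bar>t\<bar>)\<close>; completing the square in the exponent removes the
  dependence on \<open>t\<close>.\<close>

lemma power_exp_bound:
  fixes s t :: real
  assumes s: "s > 0"
  shows "(1 + \<bar>t\<bar>) ^ k * exp (- (s\<^sup>2 * t\<^sup>2) / 2) \<le> fact k * exp (1 + 1 / (2 * s\<^sup>2))"
proof -
  have "(1 + \<bar>t\<bar>) ^ k / fact k \<le> exp (1 + \<bar>t\<bar>)"
  proof -
    have "(\<Sum>i\<in>{k}. (1 + \<bar>t\<bar>) ^ i /\<^sub>R fact i) \<le> exp (1 + \<bar>t\<bar>)"
      using sum_le_suminf[of "\<lambda>i. (1 + \<bar>t\<bar>) ^ i /\<^sub>R fact i" "{k}"] summable_exp_generic[of "1 + \<bar>t\<bar>"]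
      by (simp add: exp_def)
    thus ?thesis by (simp add: divide_inverse mult.commute)
  qed
  hence "(1 + \<bar>t\<bar>) ^ k \<le> fact k * exp (1 + \<bar>t\<bar>)" by (simp add: field_simps)
  hence "(1 + \<bar>t\<bar>) ^ k * exp (- (s\<^sup>2 * t\<^sup>2) / 2) \<le> fact k * exp (1 + \<bar>t\<bar>) * exp (- (s\<^sup>2 * t\<^sup>2) / 2)"
    by (intro mult_right_mono) auto
  also have "\<dots> = fact k * exp (1 + \<bar>t\<bar> - s\<^sup>2 * t\<^sup>2 / 2)" by (simp add: exp_add[symmetric])
  also have "\<dots> \<le> fact k * exp (1 + 1 / (2 * s\<^sup>2))"
  proof -
    have "0 \<le> (s * \<bar>t\<bar> - 1 / s)\<^sup>2" by simp
    also have "\<dots> = s\<^sup>2 * t\<^sup>2 - 2 * \<bar>t\<bar> + 1 / s\<^sup>2"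
      using s by (simp add: power2_diff power_mult_distrib power_divide)
    finally have "\<bar>t\<bar> - s\<^sup>2 * t\<^sup>2 / 2 \<le> 1 / (2 * s\<^sup>2)" by simp
    thus ?thesis by (intro mult_left_mono) auto
  qed
  finally show ?thesis .
qed

lemma schwartz_gauss_wave:
  assumes s: "s > 0"
  shows "schwartz d (\<lambda>x. \<Prod>j<d. gauss_wave (y j) s (x j))"
proof -
  have "schwartz d (\<lambda>x. \<Prod>j<d. (\<lambda>j m t. poly (gauss_poly (y j) s m) (of_real t) * gauss_wave (y j) s t) j 0 (x j))"
  proof (rule schwartz_prod)
    fix j m N
    obtain C k where C: "C \<ge> 0" "\<And>t::real. cmod (poly (gauss_poly (y j) s m) (of_real t)) \<le> C * (1 + \<bar>t\<bar>) ^ k"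
      using poly_bound by blast
    have "(1 + \<bar>t\<bar>) ^ N * cmod (poly (gauss_poly (y j) s m) (of_real t) * gauss_wave (y j) s t)
        \<le> C * (fact (N + k) * exp (1 + 1 / (2 * s\<^sup>2)))" for t
    proof -
      have "(1 + \<bar>t\<bar>) ^ N * cmod (poly (gauss_poly (y j) s m) (of_real t) * gauss_wave (y j) s t)
        = (1 + \<bar>t\<bar>) ^ N * (cmod (poly (gauss_poly (y j) s m) (of_real t)) * exp (- (s\<^sup>2 * t\<^sup>2) / 2))"
        by (simp add: norm_mult gauss_wave_def)
      also have "\<dots> \<le> (1 + \<bar>t\<bar>) ^ N * ((C * (1 + \<bar>t\<bar>) ^ k) * exp (- (s\<^sup>2 * t\<^sup>2) / 2))"
        by (intro mult_left_mono mult_right_mono C) auto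
      also have "\<dots> = C * ((1 + \<bar>t\<bar>) ^ (N + k) * exp (- (s\<^sup>2 * t\<^sup>2) / 2))"
        by (simp add: power_add)
      also have "\<dots> \<le> C * (fact (N + k) * exp (1 + 1 / (2 * s\<^sup>2)))"
        by (intro mult_left_mono power_exp_bound s C)
      finally show ?thesis .
    qed
    thus "\<exists>B. \<forall>t. (1 + \<bar>t\<bar>) ^ N * cmod (poly (gauss_poly (y j) s m) (of_real t) * gauss_wave (y j) s t) \<le> B"
      by blast
  qed (rule has_vector_derivative_gauss_wave)
  thus ?thesis by simp
qed

text \<open>Standardising the variable leaves the characteristic function of the standard normal
  distribution.\<close>

lemma integral_cis_normal_density:
  assumes s: "s > 0"
  shows "(\<integral>x. cis (w * x) * of_real (normal_density y s x) \<partial>lborel) =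
    cis (w * y) * of_real (exp (- (s\<^sup>2 * w\<^sup>2) / 2))"
proof -
  have n: "normal_density y s (y + s * z) = std_normal_density z / s" for z
    using s by (simp add: normal_density_def real_sqrt_mult power_mult_distrib)
  have "(\<integral>x. cis (w * x) * of_real (normal_density y s x) \<partial>lborel) =
      \<bar>s\<bar> *\<^sub>R (\<integral>z. cis (w * (y + s * z)) * of_real (normal_density y s (y + s * z)) \<partial>lborel)"
    using s by (intro lborel_integral_real_affine) auto
  also have "(\<lambda>z. cis (w * (y + s * z)) * of_real (normal_density y s (y + s * z))) =
      (\<lambda>z. (cis (w * y) / of_real s) * (std_normal_density z *\<^sub>R cis (s * w * z)))"
    unfolding n by (simp add: fun_eq_iff distrib_left cis_mult[symmetric] scaleR_conv_of_real mult_ac)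
  also have "\<bar>s\<bar> *\<^sub>R (\<integral>z. (cis (w * y) / of_real s) * (std_normal_density z *\<^sub>R cis (s * w * z)) \<partial>lborel)
    = cis (w * y) * char std_normal_distribution (s * w)"
    unfolding char_def cis_conv_exp[of "s * w * _", symmetric]
    using s by (subst integral_density) (auto simp: scaleR_conv_of_real)
  finally show ?thesis
    by (simp add: char_std_normal_distribution power_mult_distrib)
qed

text \<open>The Gaussian in \<open>gauss_wave\<close> is a multiple of a centred normal density of
  deviation \<open>1 / s\<close>, so the preceding lemma applies with frequency
  \<open>y - x\<close>. The parametrisation of \<open>gauss_wave\<close> is chosen for this result:
  \<open>y\<close> and \<open>s\<close> are the mean and deviation of its transform.\<close>

lemma integral_cis_gauss_wave:
  assumes s: "s > 0"
  shows "(\<integral>t. cis (- (x * t)) * gauss_wave y s t \<partial>lborel) = of_real (2 * pi * normal_density y s x)"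
proof -
  have "cis (- (x * t)) * gauss_wave y s t =
      of_real (sqrt (2 * pi) / s) * (cis ((y - x) * t) * of_real (normal_density 0 (1 / s) t))" for t
  proof -
    have "exp (- (s\<^sup>2 * t\<^sup>2) / 2) = sqrt (2 * pi) / s * normal_density 0 (1 / s) t"
      using s by (simp add: normal_density_def real_sqrt_mult real_sqrt_divide power_divide field_simps)
    moreover have "cis (- (x * t)) * cis (y * t) = cis ((y - x) * t)"
      by (simp add: cis_mult algebra_simps)
    ultimately show ?thesis by (simp add: gauss_wave_def mult.assoc[symmetric])
  qed
  hence "(\<integral>t. cis (- (x * t)) * gauss_wave y s t \<partial>lborel) =
      of_real (sqrt (2 * pi) / s) * (\<integral>t. cis ((y - x) * t) * of_real (normal_density 0 (1 / s) t) \<partial>lborel)"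
    by simp
  also have "\<dots> = of_real (sqrt (2 * pi) / s * exp (- (y - x)\<^sup>2 / (2 * s\<^sup>2)))"
    using s by (subst integral_cis_normal_density) (auto simp: power_divide)
  also have "sqrt (2 * pi) / s * exp (- (y - x)\<^sup>2 / (2 * s\<^sup>2)) = 2 * pi * normal_density y s x"
  proof -
    have "sqrt (2 * pi) / s = 2 * pi / sqrt (2 * pi * s\<^sup>2)"
    proof -
      have "sqrt (2 * pi * s\<^sup>2) = sqrt (2 * pi) * s"
        using s by (simp add: real_sqrt_mult)
      moreover have "2 * pi = sqrt (2 * pi) * sqrt (2 * pi)" by simp
      ultimately show ?thesis using s by (simp add: field_simps del: real_sqrt_mult_self)
    qed
    thus ?thesis by (simp add: normal_density_def power2_commute)
  qed
  finally show ?thesis .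
qed

lemma cis_sum: "finite A \<Longrightarrow> cis (\<Sum>i\<in>A. f i) = (\<Prod>i\<in>A. cis (f i))"
  by (induction A rule: finite_induct) (auto simp: cis_mult[symmetric])

text \<open>The product measure whose completion is \<open>leb\<close>. Fubini and the product
  formulas are applied to it, and measurability, integrals and null sets are carried over to the
  completion.\<close>

abbreviation blebd :: "nat \<Rightarrow> (nat \<Rightarrow> real) measure" where
  "blebd d \<equiv> (\<Pi>\<^sub>M i\<in>{..<d}. lborel)"

interpretation PL: product_sigma_finite "\<lambda>_::nat. lborel :: real measure" ..

lemma sigma_finite_blebd: "sigma_finite_measure (blebd d)"
  by (rule PL.sigma_finite) simp

lemma space_blebd: "space (blebd d) = RR d"
  by (simp add: space_PiM RR_def)

lemma integral_leb:
  fixes f :: "_ \<Rightarrow> complex"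
  shows "f \<in> borel_measurable (blebd d) \<Longrightarrow> integral\<^sup>L (leb d) f = integral\<^sup>L (blebd d) f"
  unfolding leb_def by (rule integral_completion)

lemma gauss_wave_measurable [measurable]: "gauss_wave y s \<in> borel_measurable borel"
  unfolding gauss_wave_def[abs_def] by measurable

lemma gauss_wave_integrable: "s > 0 \<Longrightarrow> integrable lborel (gauss_wave y s)"
proof (rule Bochner_Integration.integrable_bound[of _ "\<lambda>t. sqrt (2 * pi) / s * normal_density 0 (1 / s) t"])
  assume s: "s > 0"
  have "exp (- (s\<^sup>2 * t\<^sup>2) / 2) = sqrt (2 * pi) / s * normal_density 0 (1 / s) t" for t
    using s by (simp add: normal_density_def real_sqrt_mult real_sqrt_divide power_divide field_simps)
  moreover have "norm (gauss_wave y s t) = exp (- (s\<^sup>2 * t\<^sup>2) / 2)" for t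
    by (simp add: gauss_wave_def norm_mult)
  ultimately have "norm (gauss_wave y s t) = norm (sqrt (2 * pi) / s * normal_density 0 (1 / s) t)" for t
    using s by simp
  thus "AE t in lborel. norm (gauss_wave y s t) \<le> norm (sqrt (2 * pi) / s * normal_density 0 (1 / s) t)"
    by simp
qed auto

lemma dotp_measurable [measurable (raw)]:
  assumes "f \<in> N \<rightarrow>\<^sub>M blebd d" "g \<in> N \<rightarrow>\<^sub>M blebd d"
  shows "(\<lambda>z. dotp d (f z) (g z)) \<in> borel_measurable N"
proof -
  have m: "(\<lambda>x. x i) \<in> borel_measurable (blebd d)" if "i < d" for i
    using measurable_component_singleton[of i "{..<d}" "\<lambda>_. lborel :: real measure"] that by simp
  have "(\<lambda>z. f z i) \<in> borel_measurable N" "(\<lambda>z. g z i) \<in> borel_measurable N" if "i < d" for i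
    using measurable_compose[OF assms(1) m[OF that]] measurable_compose[OF assms(2) m[OF that]] by simp_all
  thus ?thesis unfolding dotp_def by (auto intro!: borel_measurable_sum borel_measurable_times)
qed

lemma fourier_gauss_wave:
  assumes s: "s > 0"
  shows "fourier d (\<lambda>x. \<Prod>j<d. gauss_wave (y j) s (x j)) x = of_real (\<Prod>j<d. normal_density (y j) s (x j))"
proof -
  have e: "cis (- dotp d x t) * (\<Prod>j<d. gauss_wave (y j) s (t j)) = (\<Prod>j<d. cis (- (x j * t j)) * gauss_wave (y j) s (t j))" for t
    unfolding dotp_def sum_negf[symmetric] by (simp add: cis_sum prod.distrib)
  have i: "integrable lborel (\<lambda>t. cis (- (x j * t)) * gauss_wave (y j) s t)" for j
    by (rule Bochner_Integration.integrable_bound[OF gauss_wave_integrable[OF s, of "y j"]]) (auto simp: norm_mult)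
  have "(\<integral>t. cis (- dotp d x t) * (\<Prod>j<d. gauss_wave (y j) s (t j)) \<partial>leb d) =
      (\<integral>t. (\<Prod>j<d. cis (- (x j * t j)) * gauss_wave (y j) s (t j)) \<partial>blebd d)"
    unfolding e by (rule integral_leb) measurable
  also have "\<dots> = (\<Prod>j<d. \<integral>t. cis (- (x j * t)) * gauss_wave (y j) s t \<partial>lborel)"
    by (rule PL.product_integral_prod) (auto intro: i)
  also have "\<dots> = of_real ((2 * pi) ^ d * (\<Prod>j<d. normal_density (y j) s (x j)))"
    unfolding integral_cis_gauss_wave[OF s] by (simp add: prod.distrib)
  finally show ?thesis by (simp add: fourier_def scaleR_conv_of_real)
qed

section \<open>Fourier inversion almost everywhere\<close>

lemma component_measurable:
  assumes "f \<in> N \<rightarrow>\<^sub>M blebd d" "i < d"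
  shows "(\<lambda>z. f z i) \<in> borel_measurable N"
proof -
  have "(\<lambda>x. x i) \<in> borel_measurable (blebd d)"
    using measurable_component_singleton[of i "{..<d}" "\<lambda>_. lborel :: real measure"] assms(2) by simp
  from measurable_compose[OF assms(1) this] show ?thesis by simp
qed

lemma prod_component_measurable:
  fixes h :: "nat \<Rightarrow> real \<Rightarrow> real"
  assumes "\<And>j. h j \<in> borel_measurable borel"
  shows "(\<lambda>x. \<Prod>j<d. h j (x j)) \<in> borel_measurable (blebd d)"
proof (rule borel_measurable_prod)
  fix j assume "j \<in> {..<d}"
  hence "(\<lambda>x. x j) \<in> borel_measurable (blebd d)"
    by (intro component_measurable measurable_ident_sets refl) auto
  from measurable_compose[OF this assms[of j]] show "(\<lambda>x. h j (x j)) \<in> borel_measurable (blebd d)" .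
qed

lemma enorm_measurable [measurable (raw)]:
  assumes "f \<in> N \<rightarrow>\<^sub>M blebd d"
  shows "(\<lambda>z. enorm d (f z)) \<in> borel_measurable N"
  unfolding enorm_def L2_set_def using component_measurable[OF assms]
  by (auto intro!: borel_measurable_sqrt borel_measurable_sum borel_measurable_power)

section \<open>Functions determined by their Gaussian averages\<close>

definition orthant :: "nat \<Rightarrow> (nat \<Rightarrow> real) \<Rightarrow> (nat \<Rightarrow> real) set" where
  "orthant d b = {x \<in> RR d. \<forall>i<d. x i \<le> b i}"

text \<open>Half-lines generate the Borel sets of the line, which is a countable union of them, so
  their products generate the product. Orthants are convenient because they are closed under
  intersection and their indicators split into one-variable factors.\<close>

lemma sets_blebd_orthants: "sets (blebd d) = sigma_sets (RR d) (range (orthant d))"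
proof -
  have "sets (blebd d) = sets (\<Pi>\<^sub>M i\<in>{..<d}. sigma (UNIV :: real set) (range (\<lambda>a. {..a})))"
    by (rule sets_PiM_cong) (auto simp: borel_eq_atMost[symmetric])
  also have "\<dots> = sets (sigma (\<Pi>\<^sub>E i\<in>{..<d}. UNIV)
      {{f \<in> (\<Pi>\<^sub>E i\<in>{..<d}. UNIV). \<forall>i\<in>j. f i \<in> A i} | A j. j \<in> {{..<d}} \<and> A \<in> Pi j (\<lambda>_. range (\<lambda>a::real. {..a}))})"
  proof (rule sets_PiM_sigma)
    have "(UNIV :: real set) = \<Union>(range (\<lambda>n::nat. {..real n}))"
      using real_arch_simple by auto
    thus "\<exists>S\<subseteq>range (\<lambda>a::real. {..a}). countable S \<and> UNIV = \<Union>S"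
      by (intro exI[of _ "range (\<lambda>n::nat. {..real n})"]) auto
  qed auto
  also have "{{f \<in> (\<Pi>\<^sub>E i\<in>{..<d}. UNIV). \<forall>i\<in>j. f i \<in> A i} | A j. j \<in> {{..<d}} \<and> A \<in> Pi j (\<lambda>_. range (\<lambda>a::real. {..a}))}
      = range (orthant d)"
  proof safe
    fix A assume A: "A \<in> Pi {..<d} (\<lambda>_. range (\<lambda>a::real. {..a}))"
    hence "\<forall>i\<in>{..<d}. \<exists>a. A i = {..a}" by blast
    then obtain b where "\<forall>i\<in>{..<d}. A i = {..b i}" by metis
    hence "{f \<in> (\<Pi>\<^sub>E i\<in>{..<d}. UNIV). \<forall>i\<in>{..<d}. f i \<in> A i} = orthant d b"
      by (auto simp: orthant_def RR_def)
    thus "{f \<in> (\<Pi>\<^sub>E i\<in>{..<d}. UNIV). \<forall>i\<in>{..<d}. f i \<in> A i} \<in> range (orthant d)" by blast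
  next
    fix b show "\<exists>A j. orthant d b = {f \<in> (\<Pi>\<^sub>E i\<in>{..<d}. UNIV). \<forall>i\<in>j. f i \<in> A i} \<and>
        j \<in> {{..<d}} \<and> A \<in> Pi j (\<lambda>_. range (\<lambda>a::real. {..a}))"
      by (rule exI[of _ "\<lambda>i. {..b i}"], rule exI[of _ "{..<d}"]) (auto simp: orthant_def RR_def)
  qed
  also have "sets (sigma (\<Pi>\<^sub>E i\<in>{..<d}. UNIV) (range (orthant d))) = sigma_sets (RR d) (range (orthant d))"
    by (subst sets_measure_of) (auto simp: orthant_def RR_def)
  finally show ?thesis .
qed

lemma AE_eq_0_if_orthant_integrals_eq_0:
  fixes r :: "(nat \<Rightarrow> real) \<Rightarrow> complex"
  assumes r: "integrable (blebd d) r" and z: "\<And>b. (\<integral>x\<in>orthant d b. r x \<partial>blebd d) = 0"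
  shows "AE x in blebd d. r x = 0"
proof (rule AE_eq_0_if_pi_system_integrals_eq_0[OF r, where G = "range (orthant d)"])
  show "Int_stable (range (orthant d))"
  proof (rule Int_stableI)
    fix A B assume "A \<in> range (orthant d)" "B \<in> range (orthant d)"
    then obtain a b where "A = orthant d a" "B = orthant d b" by blast
    hence "A \<inter> B = orthant d (\<lambda>i. min (a i) (b i))" by (auto simp: orthant_def)
    thus "A \<inter> B \<in> range (orthant d)" by blast
  qed
  show sets: "sets (blebd d) = sigma_sets (space (blebd d)) (range (orthant d))"
    unfolding space_blebd by (rule sets_blebd_orthants)
  show "range (orthant d) \<subseteq> Pow (space (blebd d))"
    unfolding space_blebd by (auto simp: orthant_def)
  show "(\<integral>x\<in>A. r x \<partial>blebd d) = 0" if "A \<in> range (orthant d)" for A using that z by blast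
  have o: "orthant d b \<in> sets (blebd d)" for b
    unfolding sets by (rule sigma_sets.Basic) simp
  \<comment> \<open>The whole space is exhausted by orthants with all bounds equal to
    \<open>k\<close>, which yields the total integral that the uniqueness lemma asks for.\<close>
  have "(\<lambda>k. \<integral>x. indicator (orthant d (\<lambda>_. real k)) x *\<^sub>R r x \<partial>blebd d) \<longlonglongrightarrow> (\<integral>x. r x \<partial>blebd d)"
  proof (rule integral_dominated_convergence[where w = "\<lambda>x. norm (r x)"])
    show "AE x in blebd d. (\<lambda>k. indicator (orthant d (\<lambda>_. real k)) x *\<^sub>R r x) \<longlonglongrightarrow> r x"
    proof (rule AE_I2)
      fix x assume x: "x \<in> space (blebd d)"
      have "eventually (\<lambda>k. \<forall>i\<in>{..<d}. x i \<le> real k) sequentially"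
      proof (rule eventually_ball_finite)
        show "\<forall>i\<in>{..<d}. \<forall>\<^sub>F k in sequentially. x i \<le> real k"
        proof
          fix i
          show "\<forall>\<^sub>F k in sequentially. x i \<le> real k"
            using eventually_ge_at_top[of "nat \<lceil>x i\<rceil>"] by eventually_elim linarith
        qed
      qed simp
      hence "eventually (\<lambda>k. indicator (orthant d (\<lambda>_. real k)) x *\<^sub>R r x = r x) sequentially"
        by eventually_elim (use x in \<open>simp add: orthant_def space_blebd\<close>)
      thus "(\<lambda>k. indicator (orthant d (\<lambda>_. real k)) x *\<^sub>R r x) \<longlonglongrightarrow> r x"
        by (rule tendsto_eventually)
    qed
    show "AE x in blebd d. norm (indicator (orthant d (\<lambda>_. real k)) x *\<^sub>R r x) \<le> norm (r x)" for k
      by (rule AE_I2) (auto simp: indicator_def)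
  qed (use r o in auto)
  moreover have "(\<integral>x. indicator (orthant d (\<lambda>_. real k)) x *\<^sub>R r x \<partial>blebd d) = 0" for k
    using z unfolding set_lebesgue_integral_def by blast
  ultimately show "(\<integral>x. r x \<partial>blebd d) = 0" using LIMSEQ_unique[OF _ tendsto_const] by fastforce
qed

definition smooth_step :: "real \<Rightarrow> real \<Rightarrow> real \<Rightarrow> real" where
  "smooth_step b s x = (\<integral>y. indicator {..b} y * normal_density x s y \<partial>lborel)"

lemma integrable_indicator_normal_density: "s > 0 \<Longrightarrow> integrable lborel (\<lambda>y. indicator {..b} y * normal_density x s y)"
  by (rule Bochner_Integration.integrable_bound[OF integrable_normal_density[of s x]])
     (auto simp: indicator_def)

text \<open>The half-line indicator smoothed by a Gaussian is a rescaled normal distribution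
  function; bounds and limits are read off from this form.\<close>

lemma smooth_step_eq_cdf:
  assumes s: "s > 0"
  shows "smooth_step b s x = cdf std_normal_distribution ((b - x) / s)"
proof -
  have n: "normal_density x s (x + s * z) = std_normal_density z / s" for z
    using s by (simp add: normal_density_def real_sqrt_mult power_mult_distrib)
  have "smooth_step b s x = \<bar>s\<bar> *\<^sub>R (\<integral>z. indicator {..b} (x + s * z) * normal_density x s (x + s * z) \<partial>lborel)"
    unfolding smooth_step_def using s by (intro lborel_integral_real_affine) auto
  also have "(\<lambda>z. indicator {..b} (x + s * z) * normal_density x s (x + s * z)) =
     (\<lambda>z. (1 / s) * (std_normal_density z *\<^sub>R indicator {..(b - x) / s} z))"
    unfolding n using s by (auto simp: fun_eq_iff indicator_def field_simps)
  also have "\<bar>s\<bar> *\<^sub>R (\<integral>z. (1 / s) * (std_normal_density z *\<^sub>R indicator {..(b - x) / s} z) \<partial>lborel) =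
     (\<integral>z. std_normal_density z *\<^sub>R indicator {..(b - x) / s} z \<partial>lborel)"
    using s by simp
  also have "\<dots> = (\<integral>z. indicator {..(b - x) / s} z \<partial>std_normal_distribution)"
    by (subst integral_density) auto
  also have "\<dots> = cdf std_normal_distribution ((b - x) / s)"
    by (simp add: cdf_def)
  finally show ?thesis .
qed

interpretation SN: real_distribution std_normal_distribution
  by (rule real_dist_normal_dist)

lemma smooth_step_bounds: "s > 0 \<Longrightarrow> 0 \<le> smooth_step b s x \<and> smooth_step b s x \<le> 1"
  using SN.cdf_nonneg SN.cdf_bounded_prob by (simp add: smooth_step_eq_cdf)

lemma smooth_step_measurable [measurable]: "smooth_step b s \<in> borel_measurable borel"
  unfolding smooth_step_def[abs_def] normal_density_def by measurable

text \<open>The shift of the threshold makes the limit the indicator also at the jump.\<close>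

lemma smooth_step_tendsto:
  "(\<lambda>k. smooth_step (b + 1 / (real k + 1)) (1 / (real k + 1)\<^sup>2) x) \<longlonglongrightarrow> indicator {..b} x"
proof -
  \<comment> \<open>The width is the square of the shift. Hence for \<open>x > b\<close> the
    quadratic term drives the argument to minus infinity, and at \<open>x = b\<close> the linear
    term alone drives it to plus infinity.\<close>
  have e: "smooth_step (b + 1 / (real k + 1)) (1 / (real k + 1)\<^sup>2) x =
      cdf std_normal_distribution ((b - x) * (real k + 1)\<^sup>2 + (real k + 1))" for k
  proof -
    have "(b + 1 / (real k + 1) - x) / (1 / (real k + 1)\<^sup>2) = (b - x) * (real k + 1)\<^sup>2 + (real k + 1)"
      by (simp add: field_simps power2_eq_square)
    thus ?thesis by (subst smooth_step_eq_cdf) auto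
  qed
  show ?thesis
  proof (cases "x \<le> b")
    case True
    have "filterlim (\<lambda>k. (b - x) * (real k + 1)\<^sup>2 + (real k + 1)) at_top sequentially"
    proof (rule filterlim_at_top_mono)
      show "filterlim (\<lambda>k. real k) at_top sequentially" by (rule filterlim_real_sequentially)
      show "\<forall>\<^sub>F k in sequentially. real k \<le> (b - x) * (real k + 1)\<^sup>2 + (real k + 1)"
        using True by (intro always_eventually allI) (smt (verit) mult_nonneg_nonneg zero_le_power2)
    qed
    from filterlim_compose[OF SN.cdf_lim_at_top_prob this] show ?thesis
      unfolding e using True by simp
  next
    case False
    hence "b - x < 0" by simp
    hence "filterlim (\<lambda>k. (b - x) * (real k + 1)\<^sup>2 + (real k + 1)) at_bot sequentially"
      by real_asymp
    from filterlim_compose[OF SN.cdf_lim_at_bot this] show ?thesis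
      unfolding e using False by simp
  qed
qed

text \<open>Integrating the vanishing averages over centres \<open>y\<close> in an orthant gives, by
  Fubini, vanishing integrals of \<open>r\<close> against products of \<open>smooth_step\<close>.
  These tend to the indicator of the orthant, and dominated convergence finishes the
  reduction.\<close>

lemma AE_eq_0_if_gaussian_averages_eq_0:
  fixes r :: "(nat \<Rightarrow> real) \<Rightarrow> complex"
  assumes r: "integrable (blebd d) r"
    and z: "\<And>y s. s > 0 \<Longrightarrow> (\<integral>x. r x * of_real (\<Prod>j<d. normal_density (y j) s (x j)) \<partial>blebd d) = 0"
  shows "AE x in blebd d. r x = 0"
proof (rule AE_eq_0_if_orthant_integrals_eq_0[OF r])
  fix b :: "nat \<Rightarrow> real"
  interpret S: sigma_finite_measure "blebd d" by (rule sigma_finite_blebd)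
  interpret P: pair_sigma_finite "blebd d" "blebd d" ..
  have [measurable]: "r \<in> borel_measurable (blebd d)" using r by simp
  \<comment> \<open>General in \<open>b\<close>, because the limit below is taken along shifted
    thresholds.\<close>
  have step: "(\<integral>x. r x * of_real (\<Prod>j<d. smooth_step (b j) s (x j)) \<partial>blebd d) = 0" if s: "s > 0" for s b
  proof -
    let ?w = "\<lambda>x y. \<Prod>j<d. indicator {..b j} (y j) * normal_density (x j) s (y j)"
    let ?F = "\<lambda>x y. r x * of_real (?w x y)"
    have wint: "(\<integral>y. ?w x y \<partial>blebd d) = (\<Prod>j<d. smooth_step (b j) s (x j))" for x
      unfolding smooth_step_def by (rule PL.product_integral_prod) (auto intro: integrable_indicator_normal_density[OF s])
    have wi: "integrable (blebd d) (?w x)" for x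
      by (rule PL.product_integrable_prod) (auto intro: integrable_indicator_normal_density[OF s])
    have w0: "?w x y \<ge> 0" for x y by (intro prod_nonneg) auto
    note [measurable (raw)] = component_measurable
    have m: "case_prod ?F \<in> borel_measurable (blebd d \<Otimes>\<^sub>M blebd d)"
      unfolding normal_density_def by measurable
    have i: "integrable (blebd d \<Otimes>\<^sub>M blebd d) (case_prod ?F)"
    proof (rule P.Fubini_integrable[OF m])
      have "(\<integral>y. norm (case_prod ?F (x, y)) \<partial>blebd d) = norm (r x) * (\<Prod>j<d. smooth_step (b j) s (x j))" for x
      proof -
        have "norm (case_prod ?F (x, y)) = norm (r x) * ?w x y" for y
          unfolding case_prod_conv norm_mult norm_of_real abs_of_nonneg[OF w0] ..
        thus ?thesis by (simp only: integral_mult_right_zero wint)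
      qed
      moreover have "integrable (blebd d) (\<lambda>x. norm (r x) * (\<Prod>j<d. smooth_step (b j) s (x j)))"
      proof (rule Bochner_Integration.integrable_bound[OF r])
        show "AE x in blebd d. norm (norm (r x) * (\<Prod>j<d. smooth_step (b j) s (x j))) \<le> norm (r x)"
        proof (rule AE_I2)
          fix x
          have "\<bar>\<Prod>j<d. smooth_step (b j) s (x j)\<bar> \<le> 1"
            unfolding abs_prod by (rule prod_le_1) (use smooth_step_bounds[OF s] in auto)
          thus "norm (norm (r x) * (\<Prod>j<d. smooth_step (b j) s (x j))) \<le> norm (r x)"
            by (simp add: abs_mult mult_left_le)
        qed
      qed measurable
      ultimately show "integrable (blebd d) (\<lambda>x. \<integral>y. norm (case_prod ?F (x, y)) \<partial>blebd d)" by simp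
      show "AE x in blebd d. integrable (blebd d) (\<lambda>y. case_prod ?F (x, y))"
        unfolding case_prod_conv
        by (intro AE_I2 integrable_mult_right integrable_of_real wi)
    qed
    have "(\<integral>x. r x * of_real (\<Prod>j<d. smooth_step (b j) s (x j)) \<partial>blebd d) = (\<integral>x. (\<integral>y. ?F x y \<partial>blebd d) \<partial>blebd d)"
      by (simp add: wint integral_complex_of_real del: of_real_prod)
    also have "\<dots> = (\<integral>y. (\<integral>x. ?F x y \<partial>blebd d) \<partial>blebd d)"
      by (rule P.Fubini_integral[OF i, symmetric])
    also have "\<dots> = (\<integral>y. 0 \<partial>blebd d)"
    proof (rule Bochner_Integration.integral_cong[OF refl])
      fix y
      \<comment> \<open>Symmetry in mean and argument exchanges the centre and the integration
        variable, which makes the inner integral an instance of \<open>z\<close>.\<close>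
      have "normal_density u s v = normal_density v s u" for u v by (simp add: normal_density_def power2_commute)
      hence "?F x y = of_real (\<Prod>j<d. indicator {..b j} (y j)) * (r x * of_real (\<Prod>j<d. normal_density (y j) s (x j)))" for x
        by (simp add: prod.distrib)
      hence "(\<integral>x. ?F x y \<partial>blebd d) = of_real (\<Prod>j<d. indicator {..b j} (y j)) *
          (\<integral>x. r x * of_real (\<Prod>j<d. normal_density (y j) s (x j)) \<partial>blebd d)"
        by (simp only: integral_mult_right_zero)
      thus "(\<integral>x. ?F x y \<partial>blebd d) = 0" using z[OF s] by simp
    qed
    finally show ?thesis by simp
  qed
  let ?u = "\<lambda>k j. smooth_step (b j + 1 / (real k + 1)) (1 / (real k + 1)\<^sup>2)"
  have "(\<lambda>k. \<integral>x. r x * of_real (\<Prod>j<d. ?u k j (x j)) \<partial>blebd d) \<longlonglongrightarrow>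
      (\<integral>x. r x * of_real (\<Prod>j<d. indicator {..b j} (x j)) \<partial>blebd d)"
  proof (rule integral_dominated_convergence[where w = "\<lambda>x. norm (r x)"])
    show "AE x in blebd d. (\<lambda>k. r x * of_real (\<Prod>j<d. ?u k j (x j))) \<longlonglongrightarrow> r x * of_real (\<Prod>j<d. indicator {..b j} (x j))"
      by (intro AE_I2 tendsto_mult tendsto_const tendsto_of_real tendsto_prod smooth_step_tendsto)
    fix k
    show "AE x in blebd d. norm (r x * of_real (\<Prod>j<d. ?u k j (x j))) \<le> norm (r x)"
    proof (rule AE_I2)
      fix x
      have "\<bar>\<Prod>j<d. ?u k j (x j)\<bar> \<le> 1"
        unfolding abs_prod by (rule prod_le_1) (use smooth_step_bounds[of "1 / (real k + 1)\<^sup>2"] in auto)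
      thus "norm (r x * of_real (\<Prod>j<d. ?u k j (x j))) \<le> norm (r x)"
        unfolding norm_mult norm_of_real by (rule mult_left_le) simp
    qed
    have "(\<lambda>x. \<Prod>j<d. ?u k j (x j)) \<in> borel_measurable (blebd d)"
      by (rule prod_component_measurable) (rule smooth_step_measurable)
    thus "(\<lambda>x. r x * of_real (\<Prod>j<d. ?u k j (x j))) \<in> borel_measurable (blebd d)"
      by measurable
  next
    have "(\<lambda>x. \<Prod>j<d. indicator {..b j} (x j) :: real) \<in> borel_measurable (blebd d)"
      by (rule prod_component_measurable) simp
    thus "(\<lambda>x. r x * of_real (\<Prod>j<d. indicator {..b j} (x j))) \<in> borel_measurable (blebd d)"
      by measurable
    show "integrable (blebd d) (\<lambda>x. norm (r x))" using r by simp
  qed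
  moreover have "(\<integral>x. r x * of_real (\<Prod>j<d. ?u k j (x j)) \<partial>blebd d) = 0" for k
    by (rule step) simp
  ultimately have "(\<integral>x. r x * of_real (\<Prod>j<d. indicator {..b j} (x j)) \<partial>blebd d) = 0"
    using LIMSEQ_unique[OF _ tendsto_const] by fastforce
  also have "(\<integral>x. r x * of_real (\<Prod>j<d. indicator {..b j} (x j)) \<partial>blebd d) = (\<integral>x\<in>orthant d b. r x \<partial>blebd d)"
    unfolding set_lebesgue_integral_def
  proof (rule Bochner_Integration.integral_cong[OF refl])
    fix x assume x: "x \<in> space (blebd d)"
    have "(\<Prod>j<d. indicator {..b j} (x j)) = (indicator (orthant d b) x :: real)"
    proof (cases "\<forall>j<d. x j \<le> b j")
      case True thus ?thesis using x by (simp add: orthant_def space_blebd)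
    next
      case False
      then obtain j where "j < d" "\<not> x j \<le> b j" by blast
      hence "(\<Prod>j<d. indicator {..b j} (x j)) = (0::real)" by (intro prod_zero bexI[of _ j]) auto
      thus ?thesis using False by (simp add: orthant_def)
    qed
    thus "r x * of_real (\<Prod>j<d. indicator {..b j} (x j)) = indicator (orthant d b) x *\<^sub>R r x"
      by (simp add: scaleR_conv_of_real del: of_real_prod)
  qed
  finally show "(\<integral>x\<in>orthant d b. r x \<partial>blebd d) = 0" .
qed

section \<open>Inversion for tempered functions with integrable transform\<close>

lemma normal_density_power_bound:
  assumes s: "s > 0"
  shows "\<exists>B. \<forall>t. (1 + \<bar>t\<bar>) ^ N * normal_density y s t \<le> B"
proof (intro exI allI)
  fix t
  let ?K = "(1 + \<bar>y\<bar>) ^ N / sqrt (2 * pi * s\<^sup>2)"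
  have K: "?K \<ge> 0" by simp
  \<comment> \<open>Moves the weight to the centre \<open>y\<close>, so that the bound for centred
    Gaussians applies with \<open>1 / s\<close> in place of \<open>s\<close>.\<close>
  have "1 + \<bar>t\<bar> \<le> (1 + \<bar>y\<bar>) * (1 + \<bar>t - y\<bar>)"
    by (simp add: algebra_simps) (smt (verit) mult_nonneg_nonneg)
  hence "(1 + \<bar>t\<bar>) ^ N \<le> ((1 + \<bar>y\<bar>) * (1 + \<bar>t - y\<bar>)) ^ N" by (intro power_mono) auto
  hence "(1 + \<bar>t\<bar>) ^ N * normal_density y s t \<le> ((1 + \<bar>y\<bar>) * (1 + \<bar>t - y\<bar>)) ^ N * normal_density y s t"
    by (intro mult_right_mono) auto
  also have "\<dots> = ?K * ((1 + \<bar>t - y\<bar>) ^ N * exp (- ((1 / s)\<^sup>2 * (t - y)\<^sup>2) / 2))"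
    by (simp add: normal_density_def power_mult_distrib power_divide)
  also have "\<dots> \<le> ?K * (fact N * exp (1 + 1 / (2 * (1 / s)\<^sup>2)))"
    using s by (intro mult_left_mono power_exp_bound K) auto
  finally show "(1 + \<bar>t\<bar>) ^ N * normal_density y s t \<le> ?K * (fact N * exp (1 + 1 / (2 * (1 / s)\<^sup>2)))" .
qed

text \<open>Completing the square. It keeps the family of Gaussian averages closed under
  multiplication by a standard Gaussian, which the inversion needs to gain integrability.\<close>

lemma normal_density_mult_std:
  assumes s: "s > 0"
  shows "\<exists>c. \<forall>t. std_normal_density t * normal_density y s t = c * normal_density (y / (1 + s\<^sup>2)) (s / sqrt (1 + s\<^sup>2)) t"
proof -
  let ?q = "1 + s\<^sup>2"
  have q: "?q > 0" by (smt (verit) zero_le_power2)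
  have "- t\<^sup>2 / 2 + - (t - y)\<^sup>2 / (2 * s\<^sup>2) = - y\<^sup>2 / (2 * ?q) + - (t - y / ?q)\<^sup>2 / (2 * (s / sqrt ?q)\<^sup>2)" for t
  proof -
    have "(s / sqrt ?q)\<^sup>2 = s\<^sup>2 / ?q" using q by (simp add: power_divide)
    moreover have "?q * (s\<^sup>2 * t\<^sup>2 + (t - y)\<^sup>2) = s\<^sup>2 * y\<^sup>2 + (?q * t - y)\<^sup>2"
      by (simp add: power2_eq_square algebra_simps)
    moreover have "(t - y / ?q)\<^sup>2 = (?q * t - y)\<^sup>2 / ?q\<^sup>2"
      using q by (simp add: power_divide[symmetric] diff_divide_distrib)
    ultimately show ?thesis using s q
      by (simp add: divide_simps power2_eq_square) (simp add: algebra_simps)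
  qed
  hence "exp (- t\<^sup>2 / 2) * exp (- (t - y)\<^sup>2 / (2 * s\<^sup>2)) =
      exp (- y\<^sup>2 / (2 * ?q)) * exp (- (t - y / ?q)\<^sup>2 / (2 * (s / sqrt ?q)\<^sup>2))" for t
    unfolding exp_add[symmetric] by simp
  hence "std_normal_density t * normal_density y s t =
      (1 / sqrt (2 * pi) * (1 / sqrt (2 * pi * s\<^sup>2)) * exp (- y\<^sup>2 / (2 * ?q)) * sqrt (2 * pi * (s / sqrt ?q)\<^sup>2))
        * normal_density (y / ?q) (s / sqrt ?q) t" for t
    using s q by (simp add: normal_density_def)
  thus ?thesis by blast
qed

text \<open>A tempered \<open>f\<close> is integrable only after division by some power of
  \<open>1 + enorm d x\<close>; in each coordinate the Gaussian compensates that power.\<close>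

lemma integrable_mult_prod_normal_density:
  fixes f :: "(nat \<Rightarrow> real) \<Rightarrow> complex"
  assumes f: "integrable (blebd d) (\<lambda>x. f x / of_real ((1 + enorm d x) ^ N))"
    and [measurable]: "f \<in> borel_measurable (blebd d)" and s: "s > 0"
  shows "integrable (blebd d) (\<lambda>x. f x * of_real (\<Prod>j<d. normal_density (y j) s (x j)))"
proof -
  have "\<forall>j. \<exists>B. \<forall>t. (1 + \<bar>t\<bar>) ^ N * normal_density (y j) s t \<le> B"
    using normal_density_power_bound[OF s] by blast
  from choice[OF this] obtain B where B: "\<forall>j t. (1 + \<bar>t\<bar>) ^ N * normal_density (y j) s t \<le> B j" by blast
  have "integrable (blebd d) (\<lambda>x. of_real (\<Prod>j<d. B j) * (f x / of_real ((1 + enorm d x) ^ N)))"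
    by (rule integrable_mult_right[OF f])
  thus ?thesis
  proof (rule Bochner_Integration.integrable_bound)
    show "AE x in blebd d. norm (f x * of_real (\<Prod>j<d. normal_density (y j) s (x j)))
      \<le> norm (of_real (\<Prod>j<d. B j) * (f x / of_real ((1 + enorm d x) ^ N)))"
    proof (rule AE_I2)
      fix x
      have e: "(1 + enorm d x) ^ N > 0" using enorm_nonneg[of d x] by (intro zero_less_power) simp
      have "(1 + enorm d x) ^ N * (\<Prod>j<d. normal_density (y j) s (x j))
        \<le> (\<Prod>j<d. (1 + \<bar>x j\<bar>) ^ N) * (\<Prod>j<d. normal_density (y j) s (x j))"
        by (intro mult_right_mono enorm_power_le_prod prod_nonneg) auto
      also have "\<dots> \<le> (\<Prod>j<d. B j)"
        unfolding prod.distrib[symmetric] using B by (intro prod_mono) auto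
      finally have "(\<Prod>j<d. normal_density (y j) s (x j)) \<le> (\<Prod>j<d. B j) / (1 + enorm d x) ^ N"
        using e by (simp add: field_simps)
      hence "norm (f x) * (\<Prod>j<d. normal_density (y j) s (x j)) \<le> norm (f x) * ((\<Prod>j<d. B j) / (1 + enorm d x) ^ N)"
        by (rule mult_left_mono) simp
      moreover have "(\<Prod>j<d. normal_density (y j) s (x j)) \<ge> 0" by (intro prod_nonneg) auto
      moreover have "norm (f x) * ((\<Prod>j<d. B j) / (1 + enorm d x) ^ N) \<le>
         norm (complex_of_real (\<Prod>j<d. B j) * (f x / of_real ((1 + enorm d x) ^ N)))"
        using e enorm_nonneg[of d x] abs_ge_self[of "\<Prod>j<d. B j"]
        unfolding norm_mult norm_divide norm_of_real
        by (simp add: mult.commute divide_right_mono mult_left_mono)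
      ultimately show "norm (f x * of_real (\<Prod>j<d. normal_density (y j) s (x j)))
        \<le> norm (complex_of_real (\<Prod>j<d. B j) * (f x / of_real ((1 + enorm d x) ^ N)))"
        unfolding norm_mult[of "f x"] norm_of_real by simp
    qed
  qed measurable
qed

text \<open>By Fubini the normal densities are integrated against \<open>cis\<close> first, and
  their characteristic functions are the factors \<open>gauss_wave\<close>. This is the counterpart
  of \<open>fourier_gauss_wave\<close>: together they let both sides of \<open>has_fourier\<close>
  be compared on Gaussians.\<close>

lemma integral_exponentials_mult_normal_density:
  fixes g :: "(nat \<Rightarrow> real) \<Rightarrow> complex"
  assumes g: "integrable (blebd d) g" and s: "s > 0"
  defines "F \<equiv> \<lambda>x. \<integral>\<omega>. g \<omega> * cis (dotp d \<omega> x) \<partial>blebd d"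
  shows "integrable (blebd d) (\<lambda>x. F x * of_real (\<Prod>j<d. normal_density (y j) s (x j)))" (is ?i)
    and "(\<integral>x. F x * of_real (\<Prod>j<d. normal_density (y j) s (x j)) \<partial>blebd d) =
      (\<integral>\<omega>. g \<omega> * (\<Prod>j<d. gauss_wave (y j) s (\<omega> j)) \<partial>blebd d)" (is ?e)
proof -
  interpret S: sigma_finite_measure "blebd d" by (rule sigma_finite_blebd)
  interpret P: pair_sigma_finite "blebd d" "blebd d" ..
  have [measurable]: "g \<in> borel_measurable (blebd d)" using g by simp
  let ?n = "\<lambda>x. \<Prod>j<d. normal_density (y j) s (x j)"
  let ?G = "\<lambda>\<omega> x. g \<omega> * cis (dotp d \<omega> x) * of_real (?n x)"
  have ni: "integrable (blebd d) ?n"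
    by (rule PL.product_integrable_prod) (auto intro: integrable_normal_density s)
  have nm [measurable]: "?n \<in> borel_measurable (blebd d)" using ni by simp
  have n0: "?n x \<ge> 0" for x by (intro prod_nonneg) auto
  have i: "integrable (blebd d \<Otimes>\<^sub>M blebd d) (case_prod ?G)"
    by (rule Bochner_Integration.integrable_bound[OF integrable_pair_mult[OF sigma_finite_blebd integrable_norm[OF g] ni]])
       (measurable, rule AE_I2, simp add: split_beta norm_mult abs_mult abs_of_nonneg[OF n0] del: of_real_prod)
  have fx: "(\<integral>\<omega>. ?G \<omega> x \<partial>blebd d) = F x * of_real (?n x)" for x
    unfolding F_def by simp
  show ?i using P.integrable_snd[OF i] unfolding fx .
  have "(\<integral>x. F x * of_real (?n x) \<partial>blebd d) = (\<integral>\<omega>. (\<integral>x. ?G \<omega> x \<partial>blebd d) \<partial>blebd d)"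
    unfolding fx[symmetric] by (rule P.Fubini_integral[OF i])
  also have "\<dots> = (\<integral>\<omega>. g \<omega> * (\<Prod>j<d. gauss_wave (y j) s (\<omega> j)) \<partial>blebd d)"
  proof (rule Bochner_Integration.integral_cong[OF refl])
    fix \<omega>
    have "?G \<omega> x = g \<omega> * (\<Prod>j<d. cis (\<omega> j * x j) * of_real (normal_density (y j) s (x j)))" for x
      by (simp add: dotp_def cis_sum prod.distrib)
    hence "(\<integral>x. ?G \<omega> x \<partial>blebd d) = g \<omega> * (\<integral>x. (\<Prod>j<d. cis (\<omega> j * x j) * of_real (normal_density (y j) s (x j))) \<partial>blebd d)"
      by (simp only: integral_mult_right_zero)
    also have "(\<integral>x. (\<Prod>j<d. cis (\<omega> j * x j) * of_real (normal_density (y j) s (x j))) \<partial>blebd d) =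
       (\<Prod>j<d. \<integral>x. cis (\<omega> j * x) * of_real (normal_density (y j) s x) \<partial>lborel)"
    proof (rule PL.product_integral_prod)
      fix j show "integrable lborel (\<lambda>x. cis (\<omega> j * x) * complex_of_real (normal_density (y j) s x))"
        by (rule Bochner_Integration.integrable_bound[OF integrable_normal_density[of s "y j", OF s]]) (auto simp: norm_mult)
    qed simp
    also have "\<dots> = (\<Prod>j<d. gauss_wave (y j) s (\<omega> j))"
      unfolding integral_cis_normal_density[OF s] gauss_wave_def by (simp add: mult.commute)
    finally show "(\<integral>x. ?G \<omega> x \<partial>blebd d) = g \<omega> * (\<Prod>j<d. gauss_wave (y j) s (\<omega> j))" .
  qed
  finally show ?e .
qed

lemma fourier_inversion_AE:
  assumes hf: "has_fourier d f g" and g1: "g1 \<in> borel_measurable (blebd d)" "AE x in blebd d. g x = g1 x"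
    and gi: "integrable (blebd d) g1"
  shows "AE x in blebd d. f x = (\<integral>\<omega>. g1 \<omega> * cis (dotp d \<omega> x) \<partial>blebd d)"
proof -
  define F where "F x = (\<integral>\<omega>. g1 \<omega> * cis (dotp d \<omega> x) \<partial>blebd d)" for x
  let ?n = "\<lambda>y s x. \<Prod>j<d. normal_density (y j) s (x j)"
  from hf obtain N where fm: "f \<in> borel_measurable (leb d)" and gm: "g \<in> borel_measurable (leb d)"
    and fi: "integrable (leb d) (\<lambda>x. f x / of_real ((1 + enorm d x) ^ N))"
    and eq: "\<And>\<phi>. schwartz d \<phi> \<Longrightarrow> (\<integral>x. f x * fourier d \<phi> x \<partial>leb d) = (\<integral>\<omega>. g \<omega> * \<phi> \<omega> \<partial>leb d)"
    unfolding has_fourier_def tempered_def by auto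
  have bl: "u \<in> borel_measurable (blebd d) \<Longrightarrow> u \<in> borel_measurable (leb d)" for u :: "_ \<Rightarrow> complex"
    unfolding leb_def by (rule measurable_completion)
  have ael: "(AE x in blebd d. Q x) \<Longrightarrow> (AE x in leb d. Q x)" for Q
    unfolding leb_def by (rule AE_completion)
  obtain f1 where f1: "f1 \<in> borel_measurable (blebd d)" "AE x in blebd d. f x = f1 x"
    using fm unfolding leb_def by (rule completion_ex_borel_measurable_complex)
  note [measurable] = f1(1) g1(1)
  have f1i: "integrable (blebd d) (\<lambda>x. f1 x / of_real ((1 + enorm d x) ^ N))"
  proof -
    have m: "(\<lambda>x. f1 x / of_real ((1 + enorm d x) ^ N)) \<in> borel_measurable (blebd d)" by measurable
    have "integrable (leb d) (\<lambda>x. f1 x / of_real ((1 + enorm d x) ^ N))"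
    proof (rule Bochner_Integration.integrable_cong_AE[THEN iffD1, OF _ _ _ fi])
      show "AE x in leb d. f x / of_real ((1 + enorm d x) ^ N) = f1 x / of_real ((1 + enorm d x) ^ N)"
        using ael[OF f1(2)] by eventually_elim simp
    qed (use fi bl[OF m] in auto)
    thus ?thesis using m unfolding leb_def by (simp add: integrable_completion)
  qed
  \<comment> \<open>Since the transform of \<open>?\<phi>\<close> is the normal density
    \<open>?n y s\<close>, testing with \<open>?\<phi>\<close> turns the distributional identity
    into equal Gaussian averages of \<open>f1\<close> and \<open>F\<close>.\<close>
  have moment: "(\<integral>x. (f1 x - F x) * of_real (?n y s x) \<partial>blebd d) = 0" if s: "s > 0" for y s
  proof -
    let ?\<phi> = "\<lambda>x. \<Prod>j<d. gauss_wave (y j) s (x j)"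
    have nm [measurable]: "?n y s \<in> borel_measurable (blebd d)" by measurable
    have pm [measurable]: "?\<phi> \<in> borel_measurable (blebd d)" by measurable
    have cn: "(\<lambda>x. complex_of_real (?n y s x)) \<in> borel_measurable (blebd d)" by measurable
    have "(\<integral>x. f1 x * of_real (?n y s x) \<partial>blebd d) = (\<integral>x. f1 x * of_real (?n y s x) \<partial>leb d)"
      by (rule integral_leb[symmetric]) measurable
    also have "\<dots> = (\<integral>x. f x * fourier d ?\<phi> x \<partial>leb d)"
      unfolding fourier_gauss_wave[OF s]
    proof (rule integral_cong_AE)
      show "AE x in leb d. f1 x * of_real (?n y s x) = f x * of_real (?n y s x)"
        using ael[OF f1(2)] by eventually_elim simp
      show "(\<lambda>x. f1 x * of_real (?n y s x)) \<in> borel_measurable (leb d)"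
        by (rule borel_measurable_times[OF bl[OF f1(1)] bl[OF cn]])
      show "(\<lambda>x. f x * of_real (?n y s x)) \<in> borel_measurable (leb d)"
        by (rule borel_measurable_times[OF fm bl[OF cn]])
    qed
    also have "\<dots> = (\<integral>\<omega>. g \<omega> * ?\<phi> \<omega> \<partial>leb d)"
      by (rule eq[OF schwartz_gauss_wave[OF s]])
    also have "\<dots> = (\<integral>\<omega>. g1 \<omega> * ?\<phi> \<omega> \<partial>leb d)"
    proof (rule integral_cong_AE)
      show "AE x in leb d. g x * ?\<phi> x = g1 x * ?\<phi> x"
        using ael[OF g1(2)] by eventually_elim simp
      show "(\<lambda>x. g x * ?\<phi> x) \<in> borel_measurable (leb d)"
        by (rule borel_measurable_times[OF gm bl[OF pm]])
      show "(\<lambda>x. g1 x * ?\<phi> x) \<in> borel_measurable (leb d)"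
        by (rule borel_measurable_times[OF bl[OF g1(1)] bl[OF pm]])
    qed
    also have "\<dots> = (\<integral>\<omega>. g1 \<omega> * ?\<phi> \<omega> \<partial>blebd d)"
      by (rule integral_leb) measurable
    also have "\<dots> = (\<integral>x. F x * of_real (?n y s x) \<partial>blebd d)"
      unfolding F_def by (rule integral_exponentials_mult_normal_density(2)[OF gi s, symmetric])
    finally have e: "(\<integral>x. f1 x * of_real (?n y s x) \<partial>blebd d) = (\<integral>x. F x * of_real (?n y s x) \<partial>blebd d)" .
    have i1: "integrable (blebd d) (\<lambda>x. f1 x * of_real (?n y s x))"
      by (rule integrable_mult_prod_normal_density[OF f1i f1(1) s])
    have i2: "integrable (blebd d) (\<lambda>x. F x * of_real (?n y s x))"
      unfolding F_def by (rule integral_exponentials_mult_normal_density(1)[OF gi s])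
    show ?thesis
      unfolding left_diff_distrib Bochner_Integration.integral_diff[OF i1 i2] e by simp
  qed
  \<comment> \<open>The uniqueness lemma asks for an integrable function, and \<open>f1 - F\<close>
    may fail to be one. Multiplication by a standard Gaussian repairs this, merges with the test
    Gaussians into Gaussians again, and loses no information because it is positive.\<close>
  let ?std = "?n (\<lambda>_. 0) 1"
  have "AE x in blebd d. (f1 x - F x) * of_real (?std x) = 0"
  proof (rule AE_eq_0_if_gaussian_averages_eq_0)
    show "integrable (blebd d) (\<lambda>x. (f1 x - F x) * of_real (?std x))"
      unfolding left_diff_distrib F_def
      by (rule Bochner_Integration.integrable_diff)
         (rule integrable_mult_prod_normal_density[OF f1i f1(1)] integral_exponentials_mult_normal_density(1)[OF gi]; simp)+
    fix y :: "nat \<Rightarrow> real" and s :: real assume s: "s > 0"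
    have "\<forall>j. \<exists>c. \<forall>t. std_normal_density t * normal_density (y j) s t =
        c * normal_density (y j / (1 + s\<^sup>2)) (s / sqrt (1 + s\<^sup>2)) t"
      using normal_density_mult_std[OF s] by blast
    from choice[OF this] obtain c where c: "\<And>j t. std_normal_density t * normal_density (y j) s t =
        c j * normal_density (y j / (1 + s\<^sup>2)) (s / sqrt (1 + s\<^sup>2)) t" by blast
    have s': "s / sqrt (1 + s\<^sup>2) > 0" using s by (intro divide_pos_pos) (auto intro: add_pos_nonneg)
    have "?std x * ?n y s x = (\<Prod>j<d. c j) * ?n (\<lambda>j. y j / (1 + s\<^sup>2)) (s / sqrt (1 + s\<^sup>2)) x" for x
      unfolding prod.distrib[symmetric] c ..
    hence "(f1 x - F x) * of_real (?std x) * of_real (?n y s x) =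
        of_real (\<Prod>j<d. c j) * ((f1 x - F x) * of_real (?n (\<lambda>j. y j / (1 + s\<^sup>2)) (s / sqrt (1 + s\<^sup>2)) x))" for x
      by (metis (no_types, lifting) mult.assoc mult.left_commute of_real_mult)
    thus "(\<integral>x. (f1 x - F x) * of_real (?std x) * of_real (?n y s x) \<partial>blebd d) = 0"
      using moment[OF s'] by (simp only: integral_mult_right_zero mult_zero_right)
  qed
  moreover have "?std x \<noteq> 0" for x
    using normal_density_pos[of 1 0] by (simp add: less_imp_neq[symmetric])
  ultimately have "AE x in blebd d. f1 x = F x"
    by (elim eventually_mono) (simp del: of_real_prod)
  with f1(2) show ?thesis by eventually_elim (simp add: F_def)
qed

section \<open>Sampling\<close>

text \<open>Some point does no worse than the mean, and it can be chosen outside a null set. The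
  condition \<open>Q\<close> is how the sampling excludes parameters at which the activation
  function differs from its Borel version.\<close>

lemma (in prob_space) ex_nn_integral_ge:
  assumes [measurable]: "J \<in> borel_measurable M" and c: "(\<integral>\<^sup>+p. J p \<partial>M) \<le> c" and Q: "AE p in M. Q p"
  shows "\<exists>p\<in>space M. Q p \<and> J p \<le> c"
proof (rule ccontr)
  assume c': "\<not> ?thesis"
  have lt: "AE p in M. c < J p" using Q AE_space[of M] by eventually_elim (use c' in \<open>auto simp: not_le\<close>)
  \<comment> \<open>Strict monotonicity of the integral requires the smaller side to be finite;
    nothing lies above an infinite \<open>c\<close>.\<close>
  have "c \<noteq> \<infinity>"
  proof
    assume "c = \<infinity>"
    with lt have "AE p in M. False" by simp
    thus False by simp
  qed
  moreover have "\<not> (AE p in M. J p \<le> c)"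
  proof
    assume "AE p in M. J p \<le> c"
    with lt have "AE p in M. False" by eventually_elim (simp add: not_le[symmetric])
    thus False by simp
  qed
  moreover have "AE p in M. c \<le> J p" using lt by eventually_elim simp
  ultimately have "(\<integral>\<^sup>+p. c \<partial>M) < (\<integral>\<^sup>+p. J p \<partial>M)"
    by (intro nn_integral_less) (auto simp: emeasure_space_1 top_unique)
  thus False using c by (simp add: emeasure_space_1)
qed

text \<open>Maurey's sampling argument, with the samples picked greedily: given the first ones, the
  expectation over the next one of the squared error does not see the cross term.\<close>

lemma (in prob_space) maurey_sampling:
  fixes K :: "'a \<Rightarrow> 'b \<Rightarrow> real"
  assumes \<mu>: "finite_measure \<mu>" and K [measurable]: "case_prod K \<in> borel_measurable (M \<Otimes>\<^sub>M \<mu>)"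
    and W: "\<And>p x. \<bar>K p x\<bar> \<le> W" and Q: "AE p in M. Q p"
  defines "A \<equiv> \<lambda>x. \<integral>p. K p x \<partial>M"
  shows "\<exists>p. (\<forall>i<n. p i \<in> space M \<and> Q (p i)) \<and>
    (\<integral>\<^sup>+x. ennreal ((\<Sum>i<n. A x - K (p i) x)\<^sup>2) \<partial>\<mu>) \<le> of_nat n * (ennreal (W\<^sup>2) * emeasure \<mu> (space \<mu>))"
proof (induction n)
  case (Suc n)
  have A [measurable]: "A \<in> borel_measurable \<mu>"
    unfolding A_def using measurable_pair_swap'[of \<mu> M] K
    by (intro borel_measurable_lebesgue_integral) (auto intro: measurable_compose simp: split_beta')
  interpret \<mu>: finite_measure \<mu> by fact
  interpret pair_sigma_finite M \<mu> ..
  from Suc.IH obtain p where p: "\<forall>i<n. p i \<in> space M \<and> Q (p i)"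
    and le: "(\<integral>\<^sup>+x. ennreal ((\<Sum>i<n. A x - K (p i) x)\<^sup>2) \<partial>\<mu>) \<le> of_nat n * (ennreal (W\<^sup>2) * emeasure \<mu> (space \<mu>))"
    by (elim exE conjE)
  have K1 [measurable]: "(\<lambda>p. K p x) \<in> borel_measurable M" if "x \<in> space \<mu>" for x
    using measurable_compose[OF measurable_Pair2'[OF that] K] by simp
  have K2 [measurable]: "(\<lambda>x. K p x) \<in> borel_measurable \<mu>" if "p \<in> space M" for p
    using measurable_compose[OF measurable_Pair1'[OF that] K] by simp
  define S where "S x = (\<Sum>i<n. A x - K (p i) x)" for x
  have S [measurable]: "S \<in> borel_measurable \<mu>"
    unfolding S_def using p by (auto intro!: borel_measurable_sum)
  have m: "(\<lambda>(q, x). ennreal ((S x + (A x - K q x))\<^sup>2)) \<in> borel_measurable (M \<Otimes>\<^sub>M \<mu>)"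
    using K by measurable
  have step: "(\<integral>\<^sup>+q. ennreal ((S x + (A x - K q x))\<^sup>2) \<partial>M) \<le> ennreal ((S x)\<^sup>2) + ennreal (W\<^sup>2)"
    if x: "x \<in> space \<mu>" for x
  proof -
    note [measurable] = K1[OF x]
    have b: "(K q x)\<^sup>2 \<le> W\<^sup>2" for q using W[of q x] by (metis abs_ge_zero power2_abs power_mono)
    have iK: "integrable M (\<lambda>q. K q x)"
      by (rule integrable_const_bound[of _ W]) (use W in auto)
    have Ax: "(\<integral>q. K q x \<partial>M) = A x" by (simp add: A_def)
    have iK2: "integrable M (\<lambda>q. (K q x)\<^sup>2)"
      by (rule integrable_const_bound[of _ "W\<^sup>2"]) (use b in auto)
    have e: "(S x + (A x - K q x))\<^sup>2 = (S x + A x)\<^sup>2 - 2 * (S x + A x) * K q x + (K q x)\<^sup>2" for q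
      by (simp add: power2_eq_square algebra_simps)
    have "(\<integral>\<^sup>+q. ennreal ((S x + (A x - K q x))\<^sup>2) \<partial>M) = ennreal (\<integral>q. (S x + (A x - K q x))\<^sup>2 \<partial>M)"
    proof (rule nn_integral_eq_integral)
      show "integrable M (\<lambda>q. (S x + (A x - K q x))\<^sup>2)"
        unfolding e using iK iK2
        by (intro Bochner_Integration.integrable_add Bochner_Integration.integrable_diff) auto
    qed simp
    also have "\<dots> \<le> ennreal ((S x)\<^sup>2 + W\<^sup>2)"
    proof (rule ennreal_leI)
      \<comment> \<open>\<open>A x\<close> is the mean of \<open>K q x\<close>, so the expansion
        leaves the old square plus a variance; the variance is bounded by the second moment on
        dropping \<open>- (A x)\<^sup>2\<close>.\<close>
      have "(\<integral>q. (S x + (A x - K q x))\<^sup>2 \<partial>M) = (S x + A x)\<^sup>2 - 2 * (S x + A x) * A x + (\<integral>q. (K q x)\<^sup>2 \<partial>M)"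
        unfolding e using iK iK2 Ax by (simp add: prob_space)
      also have "\<dots> = (S x)\<^sup>2 - (A x)\<^sup>2 + (\<integral>q. (K q x)\<^sup>2 \<partial>M)"
        by (simp add: power2_eq_square algebra_simps)
      also have "(\<integral>q. (K q x)\<^sup>2 \<partial>M) \<le> W\<^sup>2"
        using integral_mono[OF iK2 _ b] by (simp add: prob_space)
      finally show "(\<integral>q. (S x + (A x - K q x))\<^sup>2 \<partial>M) \<le> (S x)\<^sup>2 + W\<^sup>2"
        using zero_le_power2[of "A x"] by linarith
    qed
    also have "\<dots> = ennreal ((S x)\<^sup>2) + ennreal (W\<^sup>2)"
      by (rule ennreal_plus) auto
    finally show ?thesis .
  qed
  let ?J = "\<lambda>q. \<integral>\<^sup>+x. ennreal ((S x + (A x - K q x))\<^sup>2) \<partial>\<mu>"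
  have "(\<integral>\<^sup>+q. ?J q \<partial>M) = (\<integral>\<^sup>+x. (\<integral>\<^sup>+q. ennreal ((S x + (A x - K q x))\<^sup>2) \<partial>M) \<partial>\<mu>)"
    by (rule Fubini'[OF m, symmetric])
  also have "\<dots> \<le> (\<integral>\<^sup>+x. ennreal ((S x)\<^sup>2) + ennreal (W\<^sup>2) \<partial>\<mu>)"
    by (rule nn_integral_mono) (rule step)
  also have "\<dots> = (\<integral>\<^sup>+x. ennreal ((S x)\<^sup>2) \<partial>\<mu>) + ennreal (W\<^sup>2) * emeasure \<mu> (space \<mu>)"
    by (subst nn_integral_add) auto
  also have "\<dots> \<le> of_nat n * (ennreal (W\<^sup>2) * emeasure \<mu> (space \<mu>)) + ennreal (W\<^sup>2) * emeasure \<mu> (space \<mu>)"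
    using le unfolding S_def by (rule add_right_mono)
  also have "\<dots> = of_nat (Suc n) * (ennreal (W\<^sup>2) * emeasure \<mu> (space \<mu>))"
    by (simp add: distrib_right add.commute)
  finally have "\<exists>q\<in>space M. Q q \<and> ?J q \<le> of_nat (Suc n) * (ennreal (W\<^sup>2) * emeasure \<mu> (space \<mu>))"
    using m Q by (intro ex_nn_integral_ge) (auto intro!: \<mu>.borel_measurable_nn_integral)
  then obtain q where q: "q \<in> space M" "Q q" "?J q \<le> of_nat (Suc n) * (ennreal (W\<^sup>2) * emeasure \<mu> (space \<mu>))"
    by blast
  have "(\<Sum>i<Suc n. A x - K ((p(n := q)) i) x) = S x + (A x - K q x)" for x
    by (simp add: S_def)
  thus ?case using p q by (intro exI[of _ "p(n := q)"]) (auto simp: less_Suc_eq)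
qed simp

lemma integral_pair_mult:
  fixes f :: "'a \<Rightarrow> real" and g :: "'b \<Rightarrow> real"
  assumes "sigma_finite_measure M" "sigma_finite_measure N" and f: "integrable M f" and g: "integrable N g"
  shows "(\<integral>z. f (fst z) * g (snd z) \<partial>(M \<Otimes>\<^sub>M N)) = (\<integral>x. f x \<partial>M) * (\<integral>y. g y \<partial>N)"
proof -
  interpret M: sigma_finite_measure M by fact
  interpret N: sigma_finite_measure N by fact
  interpret P: pair_sigma_finite M N ..
  show ?thesis
    using P.integral_fst'[OF integrable_pair_mult[OF assms(2) f g]] by simp
qed

lemma sigma_finite_lborel2: "sigma_finite_measure (lborel \<Otimes>\<^sub>M lborel :: (real \<times> real) measure)"
  by (intro sigma_finite_pair_measure lborel.sigma_finite_measure_axioms)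

lemma abs_dotp_le: "\<bar>dotp d x y\<bar> \<le> enorm d x * enorm d y"
proof -
  have "\<bar>dotp d x y\<bar> \<le> (\<Sum>i<d. \<bar>x i\<bar> * \<bar>y i\<bar>)"
    unfolding dotp_def abs_mult[symmetric] by (rule sum_abs)
  also have "\<dots> \<le> enorm d x * enorm d y"
    unfolding enorm_def by (rule L2_set_mult_ineq)
  finally show ?thesis .
qed

lemma dotp_diff: "dotp d \<omega> x - dotp d \<omega> y = dotp d \<omega> (\<lambda>i. x i - y i)"
  unfolding dotp_def by (simp add: sum_subtractf right_diff_distrib)

text \<open>For fixed \<open>\<omega>\<close>, \<open>a\<close> and \<open>x\<close>, the argument
  is a translate of \<open>v\<close>, and translations preserve null sets. So the set of bad
  parameters and points is null in the product, and Fubini in the other order makes almost every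
  parameter good for almost every \<open>x\<close>.\<close>

lemma sampling_argument_avoids_null_set:
  assumes B: "B \<in> sets borel" "emeasure lborel B = 0" and x0: "x0 \<in> RR d"
  shows "AE (\<omega>, a, v) in blebd d \<Otimes>\<^sub>M (lborel \<Otimes>\<^sub>M lborel).
     AE x in blebd d. (dotp d \<omega> x - dotp d \<omega> x0) / a + v \<notin> B"
proof -
  interpret S: sigma_finite_measure "blebd d" by (rule sigma_finite_blebd)
  interpret Q: pair_sigma_finite "blebd d" "lborel \<Otimes>\<^sub>M lborel :: (real \<times> real) measure" ..
  interpret Q2: sigma_finite_measure "blebd d \<Otimes>\<^sub>M (lborel \<Otimes>\<^sub>M lborel) :: ((nat \<Rightarrow> real) \<times> real \<times> real) measure"
    by (intro sigma_finite_pair_measure sigma_finite_blebd lborel.sigma_finite_measure_axioms)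
  interpret P: pair_sigma_finite "blebd d \<Otimes>\<^sub>M (lborel \<Otimes>\<^sub>M lborel) :: ((nat \<Rightarrow> real) \<times> real \<times> real) measure" "blebd d" ..
  let ?N = "blebd d \<Otimes>\<^sub>M (lborel \<Otimes>\<^sub>M lborel) :: ((nat \<Rightarrow> real) \<times> real \<times> real) measure"
  let ?t = "\<lambda>z x. (dotp d (fst z) x - dotp d (fst z) x0) / fst (snd z) + snd (snd z)"
  let ?I = "\<lambda>z x. indicator B (?t z x) :: ennreal"
  have [measurable]: "B \<in> sets borel" by fact
  have [measurable]: "x0 \<in> space (blebd d)" using x0 by (simp add: space_blebd)
  have m: "(\<lambda>(z, x). ?I z x) \<in> borel_measurable (?N \<Otimes>\<^sub>M blebd d)"
    by measurable
  have inner: "(\<integral>\<^sup>+z. ?I z x \<partial>?N) = 0" if [measurable]: "x \<in> space (blebd d)" for x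
  proof -
    have mx: "(\<lambda>z. ?I z x) \<in> borel_measurable ?N" by measurable
    have "(\<integral>\<^sup>+z. ?I z x \<partial>?N) = (\<integral>\<^sup>+\<omega>. (\<integral>\<^sup>+u. ?I (\<omega>, u) x \<partial>(lborel \<Otimes>\<^sub>M lborel)) \<partial>blebd d)"
      by (rule sigma_finite_measure.nn_integral_fst[OF sigma_finite_lborel2, symmetric, OF mx])
    also have "\<dots> = (\<integral>\<^sup>+\<omega>. 0 \<partial>blebd d)"
    proof (rule nn_integral_cong)
      fix \<omega> assume [measurable]: "\<omega> \<in> space (blebd d)"
      have mo: "(\<lambda>u. ?I (\<omega>, u) x) \<in> borel_measurable (lborel \<Otimes>\<^sub>M lborel)" by measurable
      have "(\<integral>\<^sup>+u. ?I (\<omega>, u) x \<partial>(lborel \<Otimes>\<^sub>M lborel)) = (\<integral>\<^sup>+a. (\<integral>\<^sup>+v. ?I (\<omega>, a, v) x \<partial>lborel) \<partial>lborel)"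
        by (rule lborel.nn_integral_fst[symmetric, OF mo])
      also have "\<dots> = (\<integral>\<^sup>+a. 0 \<partial>(lborel :: real measure))"
      proof (rule nn_integral_cong)
        fix a :: real
        \<comment> \<open>This includes \<open>a = 0\<close>: the quotient is then 0 by convention
          and the argument is \<open>v\<close> itself.\<close>
        have "(\<integral>\<^sup>+v. ?I (\<omega>, a, v) x \<partial>lborel) = (\<integral>\<^sup>+v. indicator B v \<partial>lborel)"
          by (subst (2) nn_integral_real_affine[of _ 1 "(dotp d \<omega> x - dotp d \<omega> x0) / a"]) auto
        thus "(\<integral>\<^sup>+v. ?I (\<omega>, a, v) x \<partial>lborel) = 0" using B by simp
      qed
      finally show "(\<integral>\<^sup>+u. ?I (\<omega>, u) x \<partial>(lborel \<Otimes>\<^sub>M lborel)) = 0" by simp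
    qed
    finally show ?thesis by simp
  qed
  have "(\<integral>\<^sup>+z. (\<integral>\<^sup>+x. ?I z x \<partial>blebd d) \<partial>?N) = (\<integral>\<^sup>+x. (\<integral>\<^sup>+z. ?I z x \<partial>?N) \<partial>blebd d)"
    by (rule P.Fubini'[OF m, symmetric])
  also have "\<dots> = (\<integral>\<^sup>+x. 0 \<partial>blebd d)"
    by (rule nn_integral_cong) (rule inner)
  finally have "(\<integral>\<^sup>+z. (\<integral>\<^sup>+x. ?I z x \<partial>blebd d) \<partial>?N) = 0" by simp
  hence "AE z in ?N. (\<integral>\<^sup>+x. ?I z x \<partial>blebd d) = 0"
    by (subst (asm) nn_integral_0_iff_AE) (use S.borel_measurable_nn_integral[OF m] in simp_all)
  moreover have "AE z in ?N. z \<in> space ?N" by (rule AE_space)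
  ultimately have "AE z in ?N. AE x in blebd d. ?t z x \<notin> B"
  proof eventually_elim
    case (elim z)
    hence [measurable]: "fst z \<in> space (blebd d)" by (auto simp: space_pair_measure)
    have "(\<lambda>x. ?I z x) \<in> borel_measurable (blebd d)" by measurable
    with elim(1) have "AE x in blebd d. ?I z x = 0" by (subst (asm) nn_integral_0_iff_AE)
    thus ?case by eventually_elim (simp add: indicator_def split: if_splits)
  qed
  thus ?thesis by (simp add: split_beta)
qed

text \<open>The data of the integral representation: \<open>s\<close> is a Borel version of the activation
  function, and \<open>rep\<close> is what \<open>exponential_representation\<close> provides for one value of \<open>L\<close>.\<close>

locale representation =
  fixes s :: "real \<Rightarrow> real" and S p q :: real and c :: complex and E L D :: real and d :: nat
    and g :: "(nat \<Rightarrow> real) \<Rightarrow> complex" and x0 :: "nat \<Rightarrow> real"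
  assumes s_measurable [measurable]: "s \<in> borel_measurable borel" and s_le: "\<And>t. \<bar>s t\<bar> \<le> S"
    and pq: "p < q" and c: "c \<noteq> 0" and E: "E \<ge> 0" and L: "L > 0" and D: "D \<ge> 0"
    and rep: "\<And>\<tau>. cmod ((\<integral>a. indicator {p..q} a *
        (\<integral>v. of_real (s (\<tau> / a + v)) * (cis (- (a * v)) * bump_hat (v / L)) \<partial>lborel) \<partial>lborel) - c * cis \<tau>)
      \<le> E * (1 + \<bar>\<tau>\<bar>) / L"
    and g_measurable [measurable]: "g \<in> borel_measurable (blebd d)"
    and g_moment: "integrable (blebd d) (\<lambda>\<omega>. (1 + enorm d \<omega>) * cmod (g \<omega>))"
    and x0: "x0 \<in> RR d"
begin

definition "moment = (\<integral>\<omega>. (1 + enorm d \<omega>) * cmod (g \<omega>) \<partial>blebd d)"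
definition "par = (blebd d \<Otimes>\<^sub>M (lborel \<Otimes>\<^sub>M lborel) :: ((nat \<Rightarrow> real) \<times> real \<times> real) measure)"
text \<open>Affine in \<open>x\<close>, hence the argument of a neuron with direction
  \<open>\<omega> / a\<close>. Measuring from \<open>x0\<close> keeps the phase of size |\<omega>|
  times the diameter, wherever the domain lies.\<close>

definition "arg z x = (dotp d (fst z) x - dotp d (fst z) x0) / fst (snd z) + snd (snd z)"
text \<open>Restores the phase lost by measuring from \<open>x0\<close>, and divides by the constant
  \<open>c\<close> of the representation.\<close>

definition "u \<omega> = g \<omega> * cis (dotp d \<omega> x0) / c"
definition "ker y = indicator {p..q} (fst y) * (cis (- (fst y * snd y)) * bump_hat (snd y / L))"
definition "cweight z = u (fst z) * ker (snd z)"
definition "weight z = Re (cweight z)"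
definition "mass = (\<integral>z. \<bar>weight z\<bar> \<partial>par)"
definition "average x = (\<integral>z. weight z * s (arg z x) \<partial>par)"
definition "target x = (\<integral>\<omega>. g \<omega> * cis (dotp d \<omega> x) \<partial>blebd d)"

section \<open>Measurability, integrability and total mass of the weights\<close>

lemma x0_space [measurable]: "x0 \<in> space (blebd d)"
  using x0 by (simp add: space_blebd)

lemma S_nonneg: "S \<ge> 0" using s_le[of 0] by linarith

lemma sigma_finite_par: "sigma_finite_measure par"
proof -
  show ?thesis unfolding par_def by (intro sigma_finite_pair_measure sigma_finite_blebd lborel.sigma_finite_measure_axioms)
qed

lemma u_measurable [measurable]: "u \<in> borel_measurable (blebd d)"
  unfolding u_def[abs_def] by measurable

lemma ker_measurable [measurable]: "ker \<in> borel_measurable (lborel \<Otimes>\<^sub>M lborel)"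
  unfolding ker_def[abs_def] by measurable

lemma cweight_measurable [measurable]: "cweight \<in> borel_measurable par"
  unfolding cweight_def[abs_def] par_def by measurable

lemma weight_measurable [measurable]: "weight \<in> borel_measurable par"
  unfolding weight_def[abs_def] by measurable

lemma arg_measurable [measurable]: "(\<lambda>(z, x). arg z x) \<in> borel_measurable (par \<Otimes>\<^sub>M blebd d)"
  unfolding arg_def[abs_def] par_def by measurable

lemma arg_measurable1: "x \<in> space (blebd d) \<Longrightarrow> (\<lambda>z. arg z x) \<in> borel_measurable par"
  using measurable_compose[OF measurable_Pair2' arg_measurable] by simp

lemma arg_measurable2: "z \<in> space par \<Longrightarrow> (\<lambda>x. arg z x) \<in> borel_measurable (blebd d)"
  using measurable_compose[OF measurable_Pair1' arg_measurable] by simp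

lemma norm_u: "cmod (u \<omega>) = cmod (g \<omega>) / cmod c"
  by (simp add: u_def norm_mult norm_divide)

lemma g_integrable: "integrable (blebd d) g"
proof (rule Bochner_Integration.integrable_bound[OF g_moment])
  have "1 * norm (g x) \<le> (1 + enorm d x) * norm (g x)" for x
    using enorm_nonneg[of d x] by (intro mult_right_mono) auto
  thus "AE x in blebd d. norm (g x) \<le> norm ((1 + enorm d x) * cmod (g x))"
    using enorm_nonneg[of d] by (intro AE_I2) (simp add: abs_mult)
qed simp

lemma u_integrable: "integrable (blebd d) u"
  by (rule Bochner_Integration.integrable_bound[OF integrable_divide[OF g_integrable, of c]])
     (auto simp: norm_u norm_divide)

lemma norm_g_le_moment: "(\<integral>\<omega>. cmod (g \<omega>) \<partial>blebd d) \<le> moment"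
  unfolding moment_def
proof (rule integral_mono)
  show "integrable (blebd d) (\<lambda>\<omega>. cmod (g \<omega>))" using g_integrable by simp
  fix x show "cmod (g x) \<le> (1 + enorm d x) * cmod (g x)"
    using enorm_nonneg[of d x] by (simp add: algebra_simps)
qed (rule g_moment)

lemma bump_hat_scaled: "integrable lborel (\<lambda>v. cmod (bump_hat (v / L)))"
  "(\<integral>v. cmod (bump_hat (v / L)) \<partial>lborel) = L * (\<integral>v. cmod (bump_hat v) \<partial>lborel)"
proof -
  have i: "integrable lborel (\<lambda>v. cmod (bump_hat v))" using bump_hat_integrable by simp
  show "integrable lborel (\<lambda>v. cmod (bump_hat (v / L)))"
    using lborel_integrable_real_affine[OF i, of "1 / L" 0] L by simp
  show "(\<integral>v. cmod (bump_hat (v / L)) \<partial>lborel) = L * (\<integral>v. cmod (bump_hat v) \<partial>lborel)"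
    using lborel_integral_real_affine[of "1 / L" "\<lambda>v. cmod (bump_hat v)" 0] L by (simp add: field_simps)
qed

lemma ker_bound: "integrable (lborel \<Otimes>\<^sub>M lborel) (\<lambda>y. indicator {p..q} (fst y) * cmod (bump_hat (snd y / L)))"
  by (rule integrable_pair_mult[OF lborel.sigma_finite_measure_axioms _ bump_hat_scaled(1)]) simp

lemma norm_ker: "cmod (ker y) = indicator {p..q} (fst y) * cmod (bump_hat (snd y / L))"
  by (simp add: ker_def norm_mult indicator_def)

lemma ker_integrable: "integrable (lborel \<Otimes>\<^sub>M lborel) ker"
  by (rule Bochner_Integration.integrable_bound[OF ker_bound]) (auto simp: norm_ker)

lemma norm_ker_integral: "(\<integral>y. cmod (ker y) \<partial>(lborel \<Otimes>\<^sub>M lborel)) = (q - p) * (L * (\<integral>v. cmod (bump_hat v) \<partial>lborel))"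
  unfolding norm_ker
  by (subst integral_pair_mult[OF lborel.sigma_finite_measure_axioms lborel.sigma_finite_measure_axioms])
     (use pq bump_hat_scaled in auto)

lemma norm_cweight_integrable: "integrable par (\<lambda>z. cmod (u (fst z)) * cmod (ker (snd z)))"
  unfolding par_def
  by (rule integrable_pair_mult[OF sigma_finite_lborel2 integrable_norm[OF u_integrable] integrable_norm[OF ker_integrable]])

lemma cweight_integrable: "integrable par cweight"
  by (rule Bochner_Integration.integrable_bound[OF norm_cweight_integrable])
     (auto simp: cweight_def norm_mult)

lemma weight_integrable: "integrable par weight"
  unfolding weight_def[abs_def] using cweight_integrable by simp

text \<open>The complex weight is a product of a function of \<open>\<omega>\<close> and one of
  \<open>(a, v)\<close>, so its norm factorises. The factor \<open>L\<close> comes from the dilated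
  \<open>bump_hat\<close>.\<close>

lemma mass_le: "mass \<le> (q - p) * (\<integral>v. cmod (bump_hat v) \<partial>lborel) / cmod c * L * moment"
proof -
  have "mass \<le> (\<integral>z. cmod (u (fst z)) * cmod (ker (snd z)) \<partial>par)"
    unfolding mass_def
  proof (rule integral_mono)
    fix z
    have "\<bar>weight z\<bar> \<le> cmod (cweight z)" unfolding weight_def by (rule abs_Re_le_cmod)
    thus "\<bar>weight z\<bar> \<le> cmod (u (fst z)) * cmod (ker (snd z))" by (simp add: cweight_def norm_mult)
  qed (use weight_integrable norm_cweight_integrable in auto)
  also have "\<dots> = (\<integral>\<omega>. cmod (u \<omega>) \<partial>blebd d) * (\<integral>y. cmod (ker y) \<partial>(lborel \<Otimes>\<^sub>M lborel))"
    unfolding par_def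
    by (rule integral_pair_mult[OF sigma_finite_blebd sigma_finite_lborel2
          integrable_norm[OF u_integrable] integrable_norm[OF ker_integrable]])
  also have "(\<integral>\<omega>. cmod (u \<omega>) \<partial>blebd d) = (\<integral>\<omega>. cmod (g \<omega>) \<partial>blebd d) / cmod c"
    unfolding norm_u by simp
  also have "(\<integral>\<omega>. cmod (g \<omega>) \<partial>blebd d) / cmod c * (\<integral>y. cmod (ker y) \<partial>(lborel \<Otimes>\<^sub>M lborel))
    \<le> moment / cmod c * (\<integral>y. cmod (ker y) \<partial>(lborel \<Otimes>\<^sub>M lborel))"
    by (intro mult_right_mono divide_right_mono norm_g_le_moment integral_nonneg_AE) auto
  also have "\<dots> = (q - p) * (\<integral>v. cmod (bump_hat v) \<partial>lborel) / cmod c * L * moment"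
    unfolding norm_ker_integral by simp
  finally show ?thesis .
qed

lemma mass_nonneg: "mass \<ge> 0"
  unfolding mass_def by (rule integral_nonneg_AE) auto

lemma moment_nonneg: "moment \<ge> 0"
  unfolding moment_def using enorm_nonneg[of d] by (intro integral_nonneg_AE) auto

lemma target_measurable [measurable]: "target \<in> borel_measurable (blebd d)"
proof -
  interpret S: sigma_finite_measure "blebd d" by (rule sigma_finite_blebd)
  show ?thesis unfolding target_def[abs_def] by measurable
qed

text \<open>The error of \<open>rep\<close>, integrated over \<open>\<omega>\<close> against
  \<open>|g|\<close>. Its growth in |\<tau>| is what calls for the first moment of \<open>g\<close>,
  and thus for the Barron norm of order 1.\<close>

lemma average_error:
  assumes x: "x \<in> RR d" and dist: "edist d x x0 \<le> D"
  shows "\<bar>Re (target x) - average x\<bar> \<le> E * (1 + D) / (cmod c * L) * moment"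
proof -
  interpret S: sigma_finite_measure "blebd d" by (rule sigma_finite_blebd)
  interpret Q: pair_sigma_finite "blebd d" "lborel \<Otimes>\<^sub>M lborel :: (real \<times> real) measure" ..
  have xs [measurable]: "x \<in> space (blebd d)" using x by (simp add: space_blebd)
  define \<tau> where "\<tau> \<omega> = dotp d \<omega> x - dotp d \<omega> x0" for \<omega>
  let ?T = "\<lambda>\<omega>. \<integral>a. indicator {p..q} a * (\<integral>v. of_real (s (\<tau> \<omega> / a + v)) * (cis (- (a * v)) * bump_hat (v / L)) \<partial>lborel) \<partial>lborel"
  have ci: "integrable par (\<lambda>z. cweight z * of_real (s (arg z x)))"
  proof (rule Bochner_Integration.integrable_bound)
    show "integrable par (\<lambda>z. of_real S * cweight z)" using cweight_integrable by simp
    show "AE z in par. norm (cweight z * of_real (s (arg z x))) \<le> norm (complex_of_real S * cweight z)"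
      using s_le S_nonneg by (intro AE_I2) (simp add: norm_mult mult.commute[of S] mult_left_mono)
  qed (use arg_measurable1[OF xs] in measurable)
  have ki: "integrable (lborel \<Otimes>\<^sub>M lborel) (\<lambda>y. ker y * of_real (s (t / fst y + snd y)))" for t
  proof (rule Bochner_Integration.integrable_bound)
    show "integrable (lborel \<Otimes>\<^sub>M lborel) (\<lambda>z. of_real S * ker z)" using ker_integrable by simp
    show "AE y in lborel \<Otimes>\<^sub>M lborel. norm (ker y * of_real (s (t / fst y + snd y))) \<le> norm (complex_of_real S * ker y)"
      using s_le S_nonneg by (intro AE_I2) (simp add: norm_mult mult.commute[of S] mult_left_mono)
  qed measurable
  have inner: "(\<integral>y. cweight (\<omega>, y) * of_real (s (arg (\<omega>, y) x)) \<partial>(lborel \<Otimes>\<^sub>M lborel)) = u \<omega> * ?T \<omega>" for \<omega>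
  proof -
    have "(\<integral>y. cweight (\<omega>, y) * of_real (s (arg (\<omega>, y) x)) \<partial>(lborel \<Otimes>\<^sub>M lborel)) =
        u \<omega> * (\<integral>y. ker y * of_real (s (\<tau> \<omega> / fst y + snd y)) \<partial>(lborel \<Otimes>\<^sub>M lborel))"
      by (simp add: cweight_def arg_def \<tau>_def mult.assoc)
    also have "(\<integral>y. ker y * of_real (s (\<tau> \<omega> / fst y + snd y)) \<partial>(lborel \<Otimes>\<^sub>M lborel)) =
        (\<integral>a. (\<integral>v. ker (a, v) * of_real (s (\<tau> \<omega> / a + v)) \<partial>lborel) \<partial>lborel)"
      using lborel_pair.integral_fst'[OF ki] by simp
    also have "(\<lambda>a. \<integral>v. ker (a, v) * of_real (s (\<tau> \<omega> / a + v)) \<partial>lborel) =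
        (\<lambda>a. indicator {p..q} a * (\<integral>v. of_real (s (\<tau> \<omega> / a + v)) * (cis (- (a * v)) * bump_hat (v / L)) \<partial>lborel))"
    proof
      fix a
      have "ker (a, v) * of_real (s (\<tau> \<omega> / a + v)) =
          indicator {p..q} a * (of_real (s (\<tau> \<omega> / a + v)) * (cis (- (a * v)) * bump_hat (v / L)))" for v
        by (simp add: ker_def mult_ac)
      thus "(\<integral>v. ker (a, v) * of_real (s (\<tau> \<omega> / a + v)) \<partial>lborel) =
          indicator {p..q} a * (\<integral>v. of_real (s (\<tau> \<omega> / a + v)) * (cis (- (a * v)) * bump_hat (v / L)) \<partial>lborel)"
        by (simp only: integral_mult_right_zero)
    qed
    finally show ?thesis .
  qed
  have iT: "integrable (blebd d) (\<lambda>\<omega>. u \<omega> * ?T \<omega>)"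
    using Q.integrable_fst'[OF ci[unfolded par_def]] unfolding inner .
  have iF: "integrable (blebd d) (\<lambda>\<omega>. g \<omega> * cis (dotp d \<omega> x))"
    by (rule Bochner_Integration.integrable_bound[OF g_integrable]) (auto simp: norm_mult)
  have "average x = (\<integral>z. Re (cweight z * of_real (s (arg z x))) \<partial>par)"
    unfolding average_def weight_def by simp
  also have "\<dots> = Re (\<integral>z. cweight z * of_real (s (arg z x)) \<partial>par)"
    by (rule integral_Re[OF ci])
  also have "(\<integral>z. cweight z * of_real (s (arg z x)) \<partial>par) = (\<integral>\<omega>. u \<omega> * ?T \<omega> \<partial>blebd d)"
    using Q.integral_fst'[OF ci[unfolded par_def]] unfolding inner par_def by simp
  finally have avg: "average x = Re (\<integral>\<omega>. u \<omega> * ?T \<omega> \<partial>blebd d)" .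
  \<comment> \<open>Undoes the normalisation in \<open>u\<close>, so that the integrands differ
    exactly by \<open>u \<omega>\<close> times the error of the exponential.\<close>
  have ue: "g \<omega> * cis (dotp d \<omega> x) = u \<omega> * (c * cis (\<tau> \<omega>))" for \<omega>
    using c by (simp add: u_def \<tau>_def cis_mult mult.assoc[symmetric])
  have "\<bar>Re (target x) - average x\<bar> = \<bar>Re (target x - (\<integral>\<omega>. u \<omega> * ?T \<omega> \<partial>blebd d))\<bar>"
    unfolding avg by simp
  also have "\<dots> \<le> cmod (target x - (\<integral>\<omega>. u \<omega> * ?T \<omega> \<partial>blebd d))"
    by (rule abs_Re_le_cmod)
  also have "target x - (\<integral>\<omega>. u \<omega> * ?T \<omega> \<partial>blebd d) = (\<integral>\<omega>. g \<omega> * cis (dotp d \<omega> x) - u \<omega> * ?T \<omega> \<partial>blebd d)"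
    unfolding target_def by (rule Bochner_Integration.integral_diff[OF iF iT, symmetric])
  also have "cmod \<dots> \<le> (\<integral>\<omega>. cmod (g \<omega> * cis (dotp d \<omega> x) - u \<omega> * ?T \<omega>) \<partial>blebd d)"
    by (rule integral_norm_bound)
  also have "\<dots> \<le> (\<integral>\<omega>. E * (1 + D) / (cmod c * L) * ((1 + enorm d \<omega>) * cmod (g \<omega>)) \<partial>blebd d)"
  proof (rule integral_mono)
    show "integrable (blebd d) (\<lambda>\<omega>. cmod (g \<omega> * cis (dotp d \<omega> x) - u \<omega> * ?T \<omega>))"
      by (intro integrable_norm Bochner_Integration.integrable_diff iF iT)
    show "integrable (blebd d) (\<lambda>\<omega>. E * (1 + D) / (cmod c * L) * ((1 + enorm d \<omega>) * cmod (g \<omega>)))"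
      using g_moment by simp
    fix \<omega>
    have "g \<omega> * cis (dotp d \<omega> x) - u \<omega> * ?T \<omega> = - (u \<omega> * (?T \<omega> - c * cis (\<tau> \<omega>)))"
      unfolding ue by (simp add: algebra_simps)
    hence "cmod (g \<omega> * cis (dotp d \<omega> x) - u \<omega> * ?T \<omega>) = cmod (g \<omega>) / cmod c * cmod (?T \<omega> - c * cis (\<tau> \<omega>))"
      by (simp only: norm_minus_cancel norm_mult norm_u)
    also have "\<dots> \<le> cmod (g \<omega>) / cmod c * (E * (1 + \<bar>\<tau> \<omega>\<bar>) / L)"
      by (intro mult_left_mono rep) auto
    also have "\<dots> \<le> cmod (g \<omega>) / cmod c * (E * ((1 + D) * (1 + enorm d \<omega>)) / L)"
    proof -
      \<comment> \<open>Cauchy-Schwarz separates the frequency from the diameter.\<close>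
      have "\<bar>\<tau> \<omega>\<bar> \<le> enorm d \<omega> * edist d x x0"
        unfolding \<tau>_def dotp_diff edist_def by (rule abs_dotp_le)
      also have "\<dots> \<le> enorm d \<omega> * D" by (intro mult_left_mono dist enorm_nonneg)
      finally have "1 + \<bar>\<tau> \<omega>\<bar> \<le> (1 + D) * (1 + enorm d \<omega>)"
        using D enorm_nonneg[of d \<omega>] by (simp add: algebra_simps)
      thus ?thesis using E L by (intro mult_left_mono divide_right_mono) auto
    qed
    finally show "cmod (g \<omega> * cis (dotp d \<omega> x) - u \<omega> * ?T \<omega>) \<le> E * (1 + D) / (cmod c * L) * ((1 + enorm d \<omega>) * cmod (g \<omega>))"
      by (simp add: mult_ac)
  qed
  also have "\<dots> = E * (1 + D) / (cmod c * L) * moment" by (simp add: moment_def)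
  finally show ?thesis .
qed

lemma average_measurable [measurable]: "average \<in> borel_measurable (blebd d)"
proof -
  interpret par: sigma_finite_measure par by (rule sigma_finite_par)
  have "(\<lambda>(x, z). arg z x) \<in> borel_measurable (blebd d \<Otimes>\<^sub>M par)"
    using measurable_pair_swap[OF arg_measurable] by simp
  thus ?thesis unfolding average_def[abs_def] by measurable
qed

text \<open>Parameters are drawn with density \<open>\<bar>weight z\<bar> / mass\<close>; the neuron
  carries the sign of the weight and the factor \<open>mass\<close>, so its mean is
  \<open>average\<close> and it is bounded by \<open>mass * S\<close>. The Borel version
  \<open>h1\<close> of the network \<open>h\<close> serves for integration.\<close>

lemma sampled_net:
  assumes \<sigma>: "AE t in lborel. \<sigma> t = s t" and \<Omega>: "\<Omega> \<in> sets (blebd d)" "emeasure (blebd d) \<Omega> < \<infinity>"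
    and n: "n \<ge> 1"
  obtains h h1 where "h \<in> nets d n \<sigma>" "h1 \<in> borel_measurable (blebd d)" "AE x in blebd d. h x = h1 x"
    "(\<integral>\<^sup>+x\<in>\<Omega>. ennreal ((average x - h1 x)\<^sup>2) \<partial>blebd d) \<le> ennreal ((mass * S)\<^sup>2 / n) * emeasure (blebd d) \<Omega>"
proof (cases "mass = 0")
  case True
  \<comment> \<open>With zero mass there is no probability density to normalise, but then the
    weights vanish almost everywhere and the zero network is exact.\<close>
  have "AE z in par. \<bar>weight z\<bar> = 0"
    using True unfolding mass_def
    by (subst integral_nonneg_eq_0_iff_AE[symmetric]) (use weight_integrable in auto)
  hence w0: "AE z in par. weight z * s (arg z x) = 0" for x
    by eventually_elim simp
  have avg: "average x = 0" for x
    unfolding average_def by (rule integral_eq_zero_AE[OF w0])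
  show ?thesis
  proof (rule that[of "\<lambda>x. 0" "\<lambda>x. 0"])
    \<comment> \<open>The zero function has to be displayed with \<open>n\<close> neurons;
      \<open>restrict\<close> makes the zero direction extensional, as membership in
      \<open>RR d\<close> demands.\<close>
    have "(\<lambda>x. \<Sum>i<n. 0 * \<sigma> (dotp d (restrict (\<lambda>_. 0) {..<d}) x + 0)) \<in> nets d n \<sigma>"
      unfolding nets_def mem_Collect_eq
      by (rule exI[of _ "\<lambda>_. 0"], rule exI[of _ "\<lambda>_. restrict (\<lambda>_. 0) {..<d}"], rule exI[of _ "\<lambda>_. 0"])
         (simp add: RR_def)
    thus "(\<lambda>x. 0) \<in> nets d n \<sigma>" by simp
  qed (auto simp: avg)
next
  case False
  hence m0: "mass > 0" using mass_nonneg by simp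
  define P where "P = density par (\<lambda>z. ennreal (\<bar>weight z\<bar> / mass))"
  have sP: "sets P = sets par" by (simp add: P_def)
  have "emeasure P (space P) = (\<integral>\<^sup>+z. ennreal (\<bar>weight z\<bar> / mass) \<partial>par)"
    unfolding P_def by (simp add: emeasure_density cong: nn_integral_cong)
  also have "\<dots> = ennreal (\<integral>z. \<bar>weight z\<bar> / mass \<partial>par)"
    using weight_integrable m0 by (intro nn_integral_eq_integral) auto
  also have "(\<integral>z. \<bar>weight z\<bar> / mass \<partial>par) = 1"
    using m0 by (simp add: mass_def)
  finally interpret P: prob_space P by (intro prob_spaceI) simp
  define K where "K z x = sgn (weight z) * mass * s (arg z x)" for z x
  \<comment> \<open>Restriction to \<Omega> by a density leaves the space and the measurable sets of
    \<open>blebd d\<close> unchanged.\<close>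
  define \<mu> where "\<mu> = density (blebd d) (indicator \<Omega>)"
  have \<mu>: "emeasure \<mu> (space \<mu>) = emeasure (blebd d) \<Omega>"
    unfolding \<mu>_def using \<Omega>(1) by (simp add: emeasure_density sets.sets_into_space Int_absorb1 Int_absorb2)
  have fin: "finite_measure \<mu>"
    by (rule finite_measureI) (use \<mu> \<Omega> in auto)
  have K_measurable: "case_prod K \<in> borel_measurable (par \<Otimes>\<^sub>M blebd d)"
    unfolding K_def[abs_def] by measurable
  have KP: "case_prod K \<in> borel_measurable (P \<Otimes>\<^sub>M \<mu>)"
    using K_measurable by (simp add: P_def \<mu>_def cong: measurable_cong_sets sets_pair_measure_cong)
  have K_le: "\<bar>K z x\<bar> \<le> mass * S" for z x
  proof -
    have "\<bar>K z x\<bar> = \<bar>sgn (weight z)\<bar> * (mass * \<bar>s (arg z x)\<bar>)"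
      using m0 by (simp add: K_def abs_mult)
    also have "\<dots> \<le> 1 * (mass * S)"
      using m0 s_le S_nonneg by (intro mult_mono) (auto simp: abs_sgn_eq)
    finally show ?thesis by simp
  qed
  have avg: "(\<integral>z. K z x \<partial>P) = average x" if x: "x \<in> space (blebd d)" for x
  proof -
    note [measurable] = arg_measurable1[OF x]
    have "(\<integral>z. K z x \<partial>P) = (\<integral>z. (\<bar>weight z\<bar> / mass) *\<^sub>R K z x \<partial>par)"
      unfolding P_def
    proof (rule integral_density)
      show "(\<lambda>z. K z x) \<in> borel_measurable par" unfolding K_def by measurable
    qed (use m0 in auto)
    also have "(\<lambda>z. (\<bar>weight z\<bar> / mass) *\<^sub>R K z x) = (\<lambda>z. weight z * s (arg z x))"
      using m0 by (auto simp: fun_eq_iff K_def abs_sgn)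
    finally show ?thesis by (simp add: average_def)
  qed
  \<comment> \<open>A Borel null set containing every point where \<sigma> and \<open>s\<close>
    differ.\<close>
  obtain B where B: "{t \<in> space lborel. \<sigma> t \<noteq> s t} \<subseteq> B" "emeasure lborel B = 0" "B \<in> sets lborel"
    using AE_E[OF \<sigma>] by blast
  have "AE z in par. AE x in blebd d. arg z x \<notin> B"
    using sampling_argument_avoids_null_set[OF _ B(2) x0] B(3)
    unfolding par_def arg_def by (simp add: split_beta)
  hence "AE z in par. AE x in blebd d. \<sigma> (arg z x) = s (arg z x)"
  proof eventually_elim
    case (elim z)
    thus ?case by eventually_elim (use B(1) in auto)
  qed
  hence good: "AE z in P. AE x in blebd d. \<sigma> (arg z x) = s (arg z x)"
    unfolding P_def by (subst AE_density) (auto elim: eventually_mono)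
  obtain z where z: "\<And>i. i < n \<Longrightarrow> z i \<in> space P" "\<And>i. i < n \<Longrightarrow> AE x in blebd d. \<sigma> (arg (z i) x) = s (arg (z i) x)"
    and le: "(\<integral>\<^sup>+x. ennreal ((\<Sum>i<n. (\<integral>y. K y x \<partial>P) - K (z i) x)\<^sup>2) \<partial>\<mu>) \<le>
      of_nat n * (ennreal ((mass * S)\<^sup>2) * emeasure \<mu> (space \<mu>))"
    using P.maurey_sampling[OF fin KP K_le good, of n] by blast
  define \<beta> where "\<beta> i = sgn (weight (z i)) * mass / n" for i
  define h where "h x = (\<Sum>i<n. \<beta> i * \<sigma> (arg (z i) x))" for x
  define h1 where "h1 x = (\<Sum>i<n. \<beta> i * s (arg (z i) x))" for x
  show ?thesis
  proof (rule that)
    \<comment> \<open>The quotient by \<open>a\<close> goes into the direction, the translation and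
      the offset at \<open>x0\<close> into the bias.\<close>
    define \<omega> where "\<omega> i = restrict (\<lambda>j. fst (z i) j / fst (snd (z i))) {..<d}" for i
    define b where "b i = snd (snd (z i)) - dotp d (fst (z i)) x0 / fst (snd (z i))" for i
    have a: "arg (z i) x = dotp d (\<omega> i) x + b i" for i x
    proof -
      have "dotp d (\<omega> i) x = dotp d (fst (z i)) x / fst (snd (z i))"
        unfolding dotp_def \<omega>_def sum_divide_distrib by (rule sum.cong) auto
      thus ?thesis by (simp add: arg_def b_def diff_divide_distrib)
    qed
    show "h \<in> nets d n \<sigma>"
      unfolding nets_def mem_Collect_eq
      by (rule exI[of _ \<beta>], rule exI[of _ \<omega>], rule exI[of _ b])
         (auto simp: h_def[abs_def] a RR_def \<omega>_def)
    show h1: "h1 \<in> borel_measurable (blebd d)"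
      unfolding h1_def
    proof (intro borel_measurable_sum borel_measurable_times borel_measurable_const)
      fix i assume "i \<in> {..<n}"
      hence "z i \<in> space par" using z(1) by (simp add: P_def)
      from arg_measurable2[OF this] show "(\<lambda>x. s (arg (z i) x)) \<in> borel_measurable (blebd d)"
        by measurable
    qed
    have "AE x in blebd d. \<forall>i\<in>{..<n}. \<sigma> (arg (z i) x) = s (arg (z i) x)"
      using z(2) by (subst AE_finite_all) auto
    thus "AE x in blebd d. h x = h1 x"
      by eventually_elim (simp add: h_def h1_def)
    have e: "(average x - h1 x)\<^sup>2 = (1 / (real n)\<^sup>2) * (\<Sum>i<n. (\<integral>y. K y x \<partial>P) - K (z i) x)\<^sup>2"
      if x: "x \<in> space (blebd d)" for x
    proof -
      have "(\<Sum>i<n. (\<integral>y. K y x \<partial>P) - K (z i) x) = real n * average x - (\<Sum>i<n. K (z i) x)"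
        using avg[OF x] by (simp add: sum_subtractf)
      also have "(\<Sum>i<n. K (z i) x) = real n * h1 x"
        using n by (simp add: h1_def K_def \<beta>_def sum_distrib_left)
      finally have "(\<Sum>i<n. (\<integral>y. K y x \<partial>P) - K (z i) x) = real n * (average x - h1 x)"
        by (simp add: right_diff_distrib)
      thus ?thesis using n by (simp add: power_mult_distrib)
    qed
    have "(\<integral>\<^sup>+x\<in>\<Omega>. ennreal ((average x - h1 x)\<^sup>2) \<partial>blebd d) = (\<integral>\<^sup>+x. ennreal ((average x - h1 x)\<^sup>2) \<partial>\<mu>)"
      unfolding \<mu>_def using h1 \<Omega>(1) by (subst nn_integral_density) (auto simp: mult.commute)
    also have "\<dots> = (\<integral>\<^sup>+x. ennreal (1 / (real n)\<^sup>2) * ennreal ((\<Sum>i<n. (\<integral>y. K y x \<partial>P) - K (z i) x)\<^sup>2) \<partial>\<mu>)"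
      by (rule nn_integral_cong) (simp add: \<mu>_def e ennreal_mult'[symmetric])
    also have "\<dots> = ennreal (1 / (real n)\<^sup>2) * (\<integral>\<^sup>+x. ennreal ((\<Sum>i<n. (\<integral>y. K y x \<partial>P) - K (z i) x)\<^sup>2) \<partial>\<mu>)"
    proof (rule nn_integral_cmult)
      have "(\<lambda>x. ennreal ((real n * (average x - h1 x))\<^sup>2)) \<in> borel_measurable \<mu>"
        unfolding \<mu>_def using h1 by simp
      also have "?this \<longleftrightarrow> (\<lambda>x. ennreal ((\<Sum>i<n. (\<integral>y. K y x \<partial>P) - K (z i) x)\<^sup>2)) \<in> borel_measurable \<mu>"
        using n by (intro measurable_cong) (simp add: \<mu>_def power_mult_distrib e)
      finally show "(\<lambda>x. ennreal ((\<Sum>i<n. (\<integral>y. K y x \<partial>P) - K (z i) x)\<^sup>2)) \<in> borel_measurable \<mu>" .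
    qed
    also have "\<dots> \<le> ennreal (1 / (real n)\<^sup>2) * (of_nat n * (ennreal ((mass * S)\<^sup>2) * emeasure \<mu> (space \<mu>)))"
      by (intro mult_left_mono le) auto
    also have "\<dots> = ennreal (1 / (real n)\<^sup>2 * (real n * (mass * S)\<^sup>2)) * emeasure \<mu> (space \<mu>)"
      by (subst ennreal_mult, simp, simp, subst ennreal_mult, simp, simp)
         (simp only: ennreal_of_nat_eq_real_of_nat mult.assoc)
    also have "1 / (real n)\<^sup>2 * (real n * (mass * S)\<^sup>2) = (mass * S)\<^sup>2 / n"
      using n by (simp add: power2_eq_square)
    finally show "(\<integral>\<^sup>+x\<in>\<Omega>. ennreal ((average x - h1 x)\<^sup>2) \<partial>blebd d) \<le> ennreal ((mass * S)\<^sup>2 / n) * emeasure (blebd d) \<Omega>"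
      unfolding \<mu> .
  qed
qed

lemma net_error:
  assumes \<sigma>: "AE t in lborel. \<sigma> t = s t" and \<Omega>: "\<Omega> \<in> sets (blebd d)" "emeasure (blebd d) \<Omega> < \<infinity>"
    and dist: "\<And>x. x \<in> \<Omega> \<Longrightarrow> edist d x x0 \<le> D" and n: "n \<ge> 1"
  obtains h where "h \<in> nets d n \<sigma>"
    "(\<integral>\<^sup>+x\<in>\<Omega>. ennreal ((Re (target x) - h x)\<^sup>2) \<partial>blebd d) \<le>
      ennreal (2 * (E * (1 + D) / (cmod c * L) * moment)\<^sup>2 + 2 * (mass * S)\<^sup>2 / n) * emeasure (blebd d) \<Omega>"
proof -
  let ?e = "E * (1 + D) / (cmod c * L) * moment"
  obtain h h1 where h: "h \<in> nets d n \<sigma>" and [measurable]: "h1 \<in> borel_measurable (blebd d)"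
    and hh: "AE x in blebd d. h x = h1 x"
    and le: "(\<integral>\<^sup>+x\<in>\<Omega>. ennreal ((average x - h1 x)\<^sup>2) \<partial>blebd d) \<le> ennreal ((mass * S)\<^sup>2 / n) * emeasure (blebd d) \<Omega>"
    using sampled_net[OF \<sigma> \<Omega> n] by blast
  note [measurable] = \<Omega>(1)
  have "(\<integral>\<^sup>+x\<in>\<Omega>. ennreal ((Re (target x) - h x)\<^sup>2) \<partial>blebd d) = (\<integral>\<^sup>+x\<in>\<Omega>. ennreal ((Re (target x) - h1 x)\<^sup>2) \<partial>blebd d)"
    by (rule nn_integral_cong_AE) (use hh in eventually_elim, simp)
  also have "\<dots> \<le> (\<integral>\<^sup>+x. ennreal (2 * ?e\<^sup>2) * indicator \<Omega> x + 2 * (ennreal ((average x - h1 x)\<^sup>2) * indicator \<Omega> x) \<partial>blebd d)"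
  proof (rule nn_integral_mono)
    fix x assume x: "x \<in> space (blebd d)"
    show "ennreal ((Re (target x) - h1 x)\<^sup>2) * indicator \<Omega> x \<le>
      ennreal (2 * ?e\<^sup>2) * indicator \<Omega> x + 2 * (ennreal ((average x - h1 x)\<^sup>2) * indicator \<Omega> x)"
    proof (cases "x \<in> \<Omega>")
      case True
      have "\<bar>Re (target x) - average x\<bar> \<le> ?e"
        using x True by (intro average_error dist) (simp add: space_blebd)
      hence 1: "(Re (target x) - average x)\<^sup>2 \<le> ?e\<^sup>2"
        by (metis abs_ge_zero power2_abs power_mono)
      \<comment> \<open>\<open>(a + b)^2 \<le> 2 * a^2 + 2 * b^2\<close>, the source of both factors
        2 in the final bound.\<close>
      have "(Re (target x) - h1 x)\<^sup>2 \<le> 2 * (Re (target x) - average x)\<^sup>2 + 2 * (average x - h1 x)\<^sup>2"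
        using zero_le_power2[of "(Re (target x) - average x) - (average x - h1 x)"]
        by (simp add: power2_eq_square algebra_simps)
      also have "\<dots> \<le> 2 * ?e\<^sup>2 + 2 * (average x - h1 x)\<^sup>2" using 1 by simp
      finally have "ennreal ((Re (target x) - h1 x)\<^sup>2) \<le> ennreal (2 * ?e\<^sup>2 + 2 * (average x - h1 x)\<^sup>2)"
        by (rule ennreal_leI)
      also have "\<dots> = ennreal (2 * ?e\<^sup>2) + 2 * ennreal ((average x - h1 x)\<^sup>2)"
        by (simp add: ennreal_plus ennreal_mult')
      finally show ?thesis using True by simp
    qed simp
  qed
  also have "\<dots> = ennreal (2 * ?e\<^sup>2) * emeasure (blebd d) \<Omega> + 2 * (\<integral>\<^sup>+x\<in>\<Omega>. ennreal ((average x - h1 x)\<^sup>2) \<partial>blebd d)"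
    by (subst nn_integral_add) (auto simp: nn_integral_cmult nn_integral_cmult_indicator)
  also have "\<dots> \<le> ennreal (2 * ?e\<^sup>2) * emeasure (blebd d) \<Omega> + 2 * (ennreal ((mass * S)\<^sup>2 / n) * emeasure (blebd d) \<Omega>)"
    by (intro add_left_mono mult_left_mono le) auto
  also have "\<dots> = ennreal (2 * ?e\<^sup>2 + 2 * (mass * S)\<^sup>2 / n) * emeasure (blebd d) \<Omega>"
  proof -
    have "2 * ennreal ((mass * S)\<^sup>2 / n) = ennreal (2 * (mass * S)\<^sup>2 / n)"
      by (simp add: ennreal_mult'[symmetric] flip: ennreal_numeral)
    thus ?thesis
      by (subst ennreal_plus) (auto simp: distrib_right mult.assoc[symmetric])
  qed
  finally show ?thesis using h that by blast
qed

end

section \<open>Conclusion\<close>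

text \<open>An arbitrary union of open boxes need not be measurable for formal reasons alone; a
  countable basis of the line makes the union countable.\<close>

lemma openin_RR_top_measurable:
  assumes "openin (RR_top d) \<Omega>"
  shows "\<Omega> \<in> sets (blebd d)"
proof -
  obtain \<B> :: "real set set" where \<B>: "countable \<B>" "topological_basis \<B>"
    using ex_countable_basis by blast
  define \<C> where "\<C> = {U \<in> (\<lambda>U. Pi\<^sub>E {..<d} U) ` (Pi\<^sub>E {..<d} (\<lambda>_. \<B>)). U \<subseteq> \<Omega>}"
  have cC: "countable \<C>"
    unfolding \<C>_def
    by (rule countable_subset[OF _ countable_image[OF countable_PiE[of "{..<d}" "\<lambda>_. \<B>"]]]) (use \<B> in auto)
  have "\<Omega> = \<Union>\<C>"
  proof
    show "\<Omega> \<subseteq> \<Union>\<C>"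
    proof
      fix x assume x: "x \<in> \<Omega>"
      obtain U where U: "\<forall>i\<in>{..<d}. open (U i)" "x \<in> Pi\<^sub>E {..<d} U" "Pi\<^sub>E {..<d} U \<subseteq> \<Omega>"
        using assms x unfolding RR_top_def openin_product_topology_alt by (auto simp: Ball_def)
      have "\<forall>i\<in>{..<d}. \<exists>V. V \<in> \<B> \<and> x i \<in> V \<and> V \<subseteq> U i"
      proof
        fix i assume i: "i \<in> {..<d}"
        show "\<exists>V. V \<in> \<B> \<and> x i \<in> V \<and> V \<subseteq> U i"
        proof -
          have "open (U i)" "x i \<in> U i" using U(1,2) i by (auto simp: PiE_iff)
          from topological_basisE[OF \<B>(2) this] show ?thesis by blast
        qed
      qed
      from bchoice[OF this] obtain V where V: "\<forall>i\<in>{..<d}. V i \<in> \<B> \<and> x i \<in> V i \<and> V i \<subseteq> U i" ..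
      \<comment> \<open>Countability is available for extensional families of basis sets only, hence
        the restriction of \<open>V\<close>.\<close>
      have "Pi\<^sub>E {..<d} (restrict V {..<d}) = Pi\<^sub>E {..<d} V" by (rule PiE_cong) simp
      moreover have "x \<in> Pi\<^sub>E {..<d} V" using U(2) V by (auto simp: PiE_iff)
      moreover have "Pi\<^sub>E {..<d} V \<subseteq> Pi\<^sub>E {..<d} U" using V by (intro PiE_mono) auto
      ultimately have sub: "Pi\<^sub>E {..<d} (restrict V {..<d}) \<subseteq> \<Omega>" "x \<in> Pi\<^sub>E {..<d} (restrict V {..<d})"
        using U(3) by simp_all
      have "restrict V {..<d} \<in> Pi\<^sub>E {..<d} (\<lambda>_. \<B>)" using V by auto
      hence "Pi\<^sub>E {..<d} (restrict V {..<d}) \<in> Pi\<^sub>E {..<d} ` Pi\<^sub>E {..<d} (\<lambda>_. \<B>)" by (rule imageI)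
      with sub(1) have "Pi\<^sub>E {..<d} (restrict V {..<d}) \<in> \<C>" unfolding \<C>_def by simp
      thus "x \<in> \<Union>\<C>" using sub(2) by (rule UnionI)
    qed
  qed (auto simp: \<C>_def)
  moreover have "\<Union>\<C> \<in> sets (blebd d)"
  proof (rule sets.countable_Union[OF cC])
    show "\<C> \<subseteq> sets (blebd d)"
    proof
      fix A assume "A \<in> \<C>"
      then obtain U where U: "U \<in> Pi\<^sub>E {..<d} (\<lambda>_. \<B>)" "A = Pi\<^sub>E {..<d} U" by (auto simp: \<C>_def)
      have "U i \<in> sets lborel" if "i < d" for i
      proof -
        have "U i \<in> \<B>" using U(1) that by auto
        thus ?thesis using topological_basis_open[OF \<B>(2)] by simp
      qed
      thus "A \<in> sets (blebd d)" unfolding U(2) by (intro sets_PiM_I_finite) auto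
    qed
  qed
  ultimately show ?thesis by simp
qed

lemma bounded_emeasure_finite:
  assumes \<Omega>: "\<Omega> \<in> sets (blebd d)" and B: "\<And>x. x \<in> \<Omega> \<Longrightarrow> enorm d x \<le> B"
  shows "emeasure (blebd d) \<Omega> < \<infinity>"
proof -
  have "\<Omega> \<subseteq> Pi\<^sub>E {..<d} (\<lambda>_. {-B..B})"
  proof
    fix x assume x: "x \<in> \<Omega>"
    have "x \<in> RR d" using x sets.sets_into_space[OF \<Omega>] by (auto simp: space_blebd)
    moreover have "\<bar>x i\<bar> \<le> B" if "i < d" for i
    proof -
      have "\<bar>x i\<bar> \<le> L2_set (\<lambda>i. \<bar>x i\<bar>) {..<d}" using that by (intro member_le_L2_set) auto
      also have "\<dots> = enorm d x" by (simp add: enorm_def L2_set_def)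
      finally show ?thesis using B[OF x] by simp
    qed
    ultimately show "x \<in> Pi\<^sub>E {..<d} (\<lambda>_. {-B..B})" by (auto simp: RR_def PiE_iff abs_le_iff minus_le_iff)
  qed
  hence "emeasure (blebd d) \<Omega> \<le> emeasure (blebd d) (Pi\<^sub>E {..<d} (\<lambda>_. {-B..B}))"
    by (rule emeasure_mono) (auto intro: sets_PiM_I_finite)
  also have "\<dots> = (\<Prod>i<d. emeasure lborel {-B..B})"
    by (rule PL.emeasure_PiM) auto
  also have "\<dots> < \<infinity>"
    by (auto simp: emeasure_lborel_Icc_eq ennreal_power power_0_left)
  finally show ?thesis .
qed

text \<open>A real supremum is guaranteed to dominate its elements only over a set bounded above;
  here the triangle inequality gives the bound \<open>2 * B\<close>.\<close>

lemma edist_le_ediam: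
  assumes B: "\<And>x. x \<in> \<Omega> \<Longrightarrow> enorm d x \<le> B" and x: "x \<in> \<Omega>" and y: "y \<in> \<Omega>"
  shows "edist d x y \<le> ediam d \<Omega>"
proof -
  have "edist d u v \<le> 2 * B" if "u \<in> \<Omega>" "v \<in> \<Omega>" for u v
  proof -
    have "edist d u v = L2_set (\<lambda>i. u i + - v i) {..<d}" by (simp add: edist_def enorm_def)
    also have "\<dots> \<le> L2_set u {..<d} + L2_set (\<lambda>i. - v i) {..<d}" by (rule L2_set_triangle_ineq)
    also have "L2_set (\<lambda>i. - v i) {..<d} = enorm d v" by (simp add: enorm_def L2_set_def)
    finally show ?thesis using B[OF that(1)] B[OF that(2)] by (simp add: enorm_def)
  qed
  hence "bdd_above ((\<lambda>(x, y). edist d x y) ` (\<Omega> \<times> \<Omega>))"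
    by (intro bdd_aboveI[of _ "2 * B"]) auto
  hence "(\<lambda>(x, y). edist d x y) (x, y) \<le> (SUP u\<in>\<Omega> \<times> \<Omega>. (\<lambda>(x, y). edist d x y) u)"
    by (rule cSUP_upper[rotated]) (use x y in auto)
  thus ?thesis using x by (auto simp: ediam_def)
qed

lemma L2norm_le:
  assumes "(\<integral>\<^sup>+x\<in>\<Omega>. ennreal ((g x)\<^sup>2) \<partial>leb d) \<le> ennreal (K\<^sup>2)" and "K \<ge> 0"
  shows "L2norm d \<Omega> g \<le> ennreal K"
proof -
  let ?J = "\<integral>\<^sup>+x\<in>\<Omega>. ennreal ((g x)\<^sup>2) \<partial>leb d"
  have fin: "?J \<noteq> \<infinity>" using assms(1) by (auto simp: top_unique)
  have "enn2real ?J \<le> K\<^sup>2"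
    using enn2real_mono[OF assms(1)] by simp
  hence "sqrt (enn2real ?J) \<le> K" using assms(2) by (simp add: real_le_lsqrt)
  thus ?thesis using fin by (simp add: L2norm_def Let_def ennreal_leI)
qed

theorem theorem4:
  fixes \<sigma> :: "real \<Rightarrow> real"
  assumes "Linf lebesgue \<sigma>"
    and "\<exists>I. open I \<and> is_interval I \<and> I \<noteq> {} \<and> fourier_nonzero_bounded_on \<sigma> I"
  shows "\<exists>C :: real \<Rightarrow> real.
    \<forall>d\<ge>1. \<forall>\<Omega>. bounded_domain d \<Omega> \<longrightarrow>
      (\<forall>f\<in>barron_space d 1. \<forall>n\<ge>1.
         (INF g\<in>nets d n \<sigma>. L2norm d \<Omega> (\<lambda>x. f x - g x))
         \<le> ennreal (sqrt (measure (leb d) \<Omega>) * C (ediam d \<Omega>) * real n powr (-1/4))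
            * barron_norm d 1 f)"
proof -
  from assms(2) obtain I where I: "open I" "fourier_nonzero_bounded_on \<sigma> I" by blast
  obtain s S where s: "s \<in> borel_measurable borel" "AE x in lborel. \<sigma> x = s x" "\<And>x. \<bar>s x\<bar> \<le> S"
    using Linf_borel_version[OF assms(1)] by blast
  obtain p q c E L0 where pq: "p < q" "0 \<notin> {p..q}" and c: "c \<noteq> (0::complex)" and E: "E \<ge> 0" and L0: "L0 > 0"
    and rep: "\<And>L \<tau>. L \<ge> L0 \<Longrightarrow> cmod ((\<integral>a. indicator {p..q} a *
        (\<integral>v. of_real (s (\<tau> / a + v)) * (cis (- (a * v)) * bump_hat (v / L)) \<partial>lborel) \<partial>lborel) - c * cis \<tau>)
      \<le> E * (1 + \<bar>\<tau>\<bar>) / L"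
    by (rule exponential_representation[OF assms(1) I s(1,2)]) (rule that)
  \<comment> \<open>\<open>M * L\<close> times the Barron norm will bound the mass. \<open>C\<close>
    collects the two squared errors of \<open>net_error\<close> at \<open>L = L0\<close> and
    \<open>n = 1\<close>; everything in it except \<open>D\<close> comes from \<sigma> and is fixed
    before the dimension.\<close>
  define M where "M = (q - p) * (\<integral>v. cmod (bump_hat v) \<partial>lborel) / cmod c"
  define C where "C D = sqrt (2 * (E * (1 + D) / (cmod c * L0))\<^sup>2 + 2 * (M * L0 * S)\<^sup>2)" for D
  have S0: "S \<ge> 0" using s(3)[of 0] by linarith
  show ?thesis
  proof (intro exI[of _ C] allI impI ballI)
    fix d \<Omega> f n
    assume \<Omega>: "bounded_domain d \<Omega>" and f: "f \<in> barron_space d 1" and n: "1 \<le> (n::nat)"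
    from \<Omega> obtain B x0 where op: "openin (RR_top d) \<Omega>" and x0: "x0 \<in> \<Omega>" and B: "\<And>x. x \<in> \<Omega> \<Longrightarrow> enorm d x \<le> B"
      unfolding bounded_domain_def by blast
    have \<Omega>m: "\<Omega> \<in> sets (blebd d)" by (rule openin_RR_top_measurable[OF op])
    have \<Omega>f: "emeasure (blebd d) \<Omega> < \<infinity>" by (rule bounded_emeasure_finite[OF \<Omega>m]) (rule B)
    define D where "D = ediam d \<Omega>"
    have dist: "edist d x x0 \<le> D" if "x \<in> \<Omega>" for x
      unfolding D_def by (rule edist_le_ediam[of \<Omega>, OF _ that x0]) (rule B)
    have D0: "D \<ge> 0"
      using dist[OF x0] enorm_nonneg[of d "\<lambda>i. x0 i - x0 i"] unfolding edist_def by linarith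
    \<comment> \<open>Membership in the Barron space includes existence of a transform, which makes
      the choice in \<open>fhat\<close> meaningful.\<close>
    have "\<exists>g. has_fourier d (\<lambda>x. complex_of_real (f x)) g"
      using f by (simp add: barron_space_def)
    hence hf: "has_fourier d (\<lambda>x. complex_of_real (f x)) (fhat d f)"
      unfolding fhat_def by (rule someI_ex)
    hence "fhat d f \<in> borel_measurable (completion (blebd d))"
      by (simp add: has_fourier_def tempered_def leb_def)
    then obtain g where g: "g \<in> borel_measurable (blebd d)" "AE x in blebd d. fhat d f x = g x"
      by (rule completion_ex_borel_measurable_complex)
    note [measurable] = g(1)
    have "barron_norm d 1 f = (\<integral>\<^sup>+\<omega>. ennreal ((1 + enorm d \<omega>) powr 1 * cmod (fhat d f \<omega>)) \<partial>blebd d)"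
      unfolding barron_norm_def leb_def by (rule nn_integral_completion)
    also have "\<dots> = (\<integral>\<^sup>+\<omega>. ennreal ((1 + enorm d \<omega>) * cmod (g \<omega>)) \<partial>blebd d)"
    proof (rule nn_integral_cong_AE)
      show "AE \<omega> in blebd d. ennreal ((1 + enorm d \<omega>) powr 1 * cmod (fhat d f \<omega>)) = ennreal ((1 + enorm d \<omega>) * cmod (g \<omega>))"
        using g(2) by eventually_elim (use enorm_nonneg[of d] in \<open>simp add: add_nonneg_nonneg\<close>)
    qed
    finally have bn: "barron_norm d 1 f = (\<integral>\<^sup>+\<omega>. ennreal ((1 + enorm d \<omega>) * cmod (g \<omega>)) \<partial>blebd d)" .
    have gm: "integrable (blebd d) (\<lambda>\<omega>. (1 + enorm d \<omega>) * cmod (g \<omega>))"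
    proof (rule integrableI_nonneg)
      show "AE \<omega> in blebd d. 0 \<le> (1 + enorm d \<omega>) * cmod (g \<omega>)"
        using enorm_nonneg[of d] by (intro AE_I2 mult_nonneg_nonneg add_nonneg_nonneg) auto
      show "(\<integral>\<^sup>+\<omega>. ennreal ((1 + enorm d \<omega>) * cmod (g \<omega>)) \<partial>blebd d) < \<infinity>"
        using f unfolding bn[symmetric] barron_space_def by simp
    qed measurable
    \<comment> \<open>Both \<open>1 / L\<close> and \<open>L / sqrt n\<close> become multiples of
      \<open>n powr (-1/4)\<close>; the factor \<open>L0\<close> keeps \<open>L\<close> above the
      threshold for every \<open>n \<ge> 1\<close>.\<close>
    define L where "L = L0 * real n powr (1/4)"
    have n1: "real n powr (1/4) \<ge> 1" using n by (intro ge_one_powr_ge_zero) auto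
    have LL: "L \<ge> L0" unfolding L_def using L0 n1 by simp
    interpret R: representation s S p q c E L D d g x0
    proof
      show "x0 \<in> RR d" using x0 sets.sets_into_space[OF \<Omega>m] by (auto simp: space_blebd)
      show "L > 0" using LL L0 by linarith
      show "cmod ((\<integral>a. indicator {p..q} a *
        (\<integral>v. of_real (s (\<tau> / a + v)) * (cis (- (a * v)) * bump_hat (v / L)) \<partial>lborel) \<partial>lborel) - c * cis \<tau>)
         \<le> E * (1 + \<bar>\<tau>\<bar>) / L" for \<tau> by (rule rep[OF LL])
    qed (fact s(1) s(3) pq(1) c E D0 g(1) gm)+
    have bnm: "barron_norm d 1 f = ennreal R.moment"
      unfolding bn R.moment_def using enorm_nonneg[of d]
      by (intro nn_integral_eq_integral gm AE_I2 mult_nonneg_nonneg add_nonneg_nonneg) auto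
    \<comment> \<open>Equality almost everywhere suffices, as the error is measured in the norm of
      square integrable functions.\<close>
    have inv: "AE x in blebd d. complex_of_real (f x) = R.target x"
      unfolding R.target_def by (rule fourier_inversion_AE[OF hf g R.g_integrable])
    obtain h where h: "h \<in> nets d n \<sigma>" and
      le: "(\<integral>\<^sup>+x\<in>\<Omega>. ennreal ((Re (R.target x) - h x)\<^sup>2) \<partial>blebd d) \<le>
      ennreal (2 * (E * (1 + D) / (cmod c * L) * R.moment)\<^sup>2 + 2 * (R.mass * S)\<^sup>2 / n) * emeasure (blebd d) \<Omega>"
      using R.net_error[OF s(2) \<Omega>m \<Omega>f dist n] by blast
    define K where "K = sqrt (measure (leb d) \<Omega>) * C D * real n powr (-1/4) * R.moment"
    have C0: "C D \<ge> 0" by (simp add: C_def)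
    have K0: "K \<ge> 0" unfolding K_def using C0 R.moment_nonneg by simp
    have mass: "R.mass \<le> M * L * R.moment" using R.mass_le unfolding M_def .
    have pw: "(real n powr (1/4))\<^sup>2 = real n powr (1/2)" "(real n powr (-1/4))\<^sup>2 = real n powr (-1/2)"
      using n by (simp_all add: powr_power)
    have bound: "2 * (E * (1 + D) / (cmod c * L) * R.moment)\<^sup>2 + 2 * (R.mass * S)\<^sup>2 / n
      \<le> (C D)\<^sup>2 * (real n powr (-1/4))\<^sup>2 * R.moment\<^sup>2"
    proof -
      have "(R.mass * S)\<^sup>2 \<le> (M * L * R.moment * S)\<^sup>2"
        using mass R.mass_nonneg S0 by (intro power_mono mult_right_mono mult_nonneg_nonneg) auto
      hence "2 * (R.mass * S)\<^sup>2 / n \<le> 2 * (M * L * R.moment * S)\<^sup>2 / n" by (intro divide_right_mono) auto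
      also have "\<dots> = 2 * (M * L0 * S)\<^sup>2 * R.moment\<^sup>2 * (real n powr (1/2) / n)"
        unfolding L_def by (simp add: power_mult_distrib pw)
      also have "real n powr (1/2) / n = real n powr (-1/2)"
        using n powr_diff[of "real n" "1/2" 1] by simp
      finally have 2: "2 * (R.mass * S)\<^sup>2 / n \<le> 2 * (M * L0 * S)\<^sup>2 * R.moment\<^sup>2 * real n powr (-1/2)" .
      have "2 * (E * (1 + D) / (cmod c * L) * R.moment)\<^sup>2 = 2 * (E * (1 + D) / (cmod c * L0))\<^sup>2 * R.moment\<^sup>2 * (1 / real n powr (1/2))"
        unfolding L_def by (simp add: power_mult_distrib power_divide pw)
      also have "1 / real n powr (1/2) = real n powr (-1/2)"
        by (simp add: powr_minus_divide)
      finally have 1: "2 * (E * (1 + D) / (cmod c * L) * R.moment)\<^sup>2 =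
          2 * (E * (1 + D) / (cmod c * L0))\<^sup>2 * R.moment\<^sup>2 * real n powr (-1/2)" .
      have "(C D)\<^sup>2 = 2 * (E * (1 + D) / (cmod c * L0))\<^sup>2 + 2 * (M * L0 * S)\<^sup>2"
        unfolding C_def by (intro real_sqrt_pow2 add_nonneg_nonneg) auto
      hence "(C D)\<^sup>2 * (real n powr (-1/4))\<^sup>2 * R.moment\<^sup>2 =
          2 * (E * (1 + D) / (cmod c * L0))\<^sup>2 * R.moment\<^sup>2 * real n powr (-1/2) +
          2 * (M * L0 * S)\<^sup>2 * R.moment\<^sup>2 * real n powr (-1/2)"
        unfolding pw by (simp only: distrib_left distrib_right mult_ac)
      thus ?thesis using 1 2 by linarith
    qed
    note le
    also have "ennreal (2 * (E * (1 + D) / (cmod c * L) * R.moment)\<^sup>2 + 2 * (R.mass * S)\<^sup>2 / n) * emeasure (blebd d) \<Omega>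
      \<le> ennreal ((C D)\<^sup>2 * (real n powr (-1/4))\<^sup>2 * R.moment\<^sup>2) * emeasure (blebd d) \<Omega>"
      by (intro mult_right_mono ennreal_leI bound) simp
    also have "emeasure (blebd d) \<Omega> = ennreal (measure (leb d) \<Omega>)"
      using \<Omega>f \<Omega>m unfolding leb_def by (simp add: emeasure_eq_ennreal_measure measure_completion less_top)
    also have "ennreal ((C D)\<^sup>2 * (real n powr (-1/4))\<^sup>2 * R.moment\<^sup>2) * ennreal (measure (leb d) \<Omega>) = ennreal (K\<^sup>2)"
    proof -
      have "(sqrt (measure (leb d) \<Omega>))\<^sup>2 = measure (leb d) \<Omega>" by simp
      hence "K\<^sup>2 = (C D)\<^sup>2 * (real n powr (-1/4))\<^sup>2 * R.moment\<^sup>2 * measure (leb d) \<Omega>"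
        unfolding K_def power_mult_distrib by simp
      thus ?thesis by (simp add: ennreal_mult')
    qed
    finally have "(\<integral>\<^sup>+x\<in>\<Omega>. ennreal ((Re (R.target x) - h x)\<^sup>2) \<partial>blebd d) \<le> ennreal (K\<^sup>2)" .
    moreover have "(\<integral>\<^sup>+x\<in>\<Omega>. ennreal ((f x - h x)\<^sup>2) \<partial>leb d) = (\<integral>\<^sup>+x\<in>\<Omega>. ennreal ((Re (R.target x) - h x)\<^sup>2) \<partial>blebd d)"
      unfolding leb_def nn_integral_completion
    proof (rule nn_integral_cong_AE)
      show "AE x in blebd d. ennreal ((f x - h x)\<^sup>2) * indicator \<Omega> x = ennreal ((Re (R.target x) - h x)\<^sup>2) * indicator \<Omega> x"
        using inv
      proof eventually_elim
        case (elim x)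
        hence "f x = Re (R.target x)" by (metis Re_complex_of_real)
        thus ?case by simp
      qed
    qed
    ultimately have "L2norm d \<Omega> (\<lambda>x. f x - h x) \<le> ennreal K"
      by (intro L2norm_le K0) simp
    hence "(INF g\<in>nets d n \<sigma>. L2norm d \<Omega> (\<lambda>x. f x - g x)) \<le> ennreal K"
      by (rule INF_lower2[OF h])
    also have "ennreal K = ennreal (sqrt (measure (leb d) \<Omega>) * C (ediam d \<Omega>) * real n powr (-1/4)) * barron_norm d 1 f"
      unfolding bnm K_def D_def by (rule ennreal_mult''[OF R.moment_nonneg])
    finally show "(INF g\<in>nets d n \<sigma>. L2norm d \<Omega> (\<lambda>x. f x - g x))
         \<le> ennreal (sqrt (measure (leb d) \<Omega>) * C (ediam d \<Omega>) * real n powr (-1/4)) * barron_norm d 1 f" .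
  qed
qed

end
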